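(* Let $n\ge 1$, $\beta\in(0,2]$, $\alpha\in(0,n)$, $p>\frac{n}{n-\alpha}$, and let $u_0\in L^s(\mathbb{R}^n)\cap L^\infty(\mathbb{R}^n)$ with $\frac{n}{n-\alpha}<s<\frac{n(p-1)}{\alpha}$. Consider the Cauchy problem $$u_t+(-\Delta)^{\beta/2}u=I_\alpha(|u|^p),\quad x\in\mathbb{R}^n,\ t>0,\qquad u(x,0)=u_0(x),\quad x\in\mathbb{R}^n. \quad (P)$$ Then there exists a time $T=T(u_0)>0$ such that (P) possesses a unique mild solution $$u\in C([0,T],L^s(\mathbb{R}^n))\cap L^\infty((0,T),L^\infty(\mathbb{R}^n)).$$ Moreover, the following properties hold: (i) Problem (P) possesses a maximal mild solution $$u\in C([0,T_{\max}),L^s(\mathbb{R}^n))\cap L^\infty((0,T_{\max}),L^\infty(\mathbb{R}^n))$$ with $u(0)=u_0$, where $T_{\max}=T_{\max}(u_0)\le\infty$. Furthermore, either $T_{\max}=\infty$, or else $T_{\max}<\infty$ and $$\lim_{t\to T_{\max}^-}\left(\|u(t)\|_{L^\infty(\mathbb{R}^n)}+\|u(t)\|_{L^s(\mathbb{R}^n)}\right)=+\infty.$$ (ii) If $u_0\ge 0$, then the mild solution $u$ remains nonnegative, $u(t)\ge 0$, for all $t\in[0,T]$.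
   Context: For $\alpha\in(0,n)$ the Riesz potential is $I_\alpha f(x)=A_\alpha\int_{\mathbb{R}^n}\frac{f(y)}{|x-y|^{n-\alpha}}\,dy$ with $A_\alpha=\frac{\Gamma((n-\alpha)/2)}{\Gamma(\alpha/2)\,\pi^{n/2}\,2^\alpha}$. For $\beta\in(0,2)$, $(-\Delta)^{\beta/2}$ is the fractional Laplacian (the operator with Fourier multiplier $|\xi|^\beta$); for $\beta=2$ it is $-\Delta$. For $\beta\in(0,2]$, $S_\beta(t)$ denotes the semigroup generated by $-(-\Delta)^{\beta/2}$, i.e. $S_\beta(t)v=S_\beta(\cdot,t)*v$ for $t>0$ and $S_\beta(0)v=v$, where $$S_\beta(x,t)=\frac{1}{(2\pi)^{n}}\int_{\mathbb{R}^n}e^{ix\cdot\xi-t|\xi|^\beta}\,d\xi .$$ This kernel satisfies $S_\beta(x,t)\ge 0$ and $\int_{\mathbb{R}^n}S_\beta(x,t)\,dx=1$. A mild solution of (P) on $[0,T]$ is a function $u\in L^\infty((0,T),X)$, here with $X=L^s(\mathbb{R}^n)\cap L^\infty(\mathbb{R}^n)$, which has initial data $u_0$ and satisfies $$u(t)=S_\beta(t)u_0+\int_0^tS_\beta(t-\tau)I_\alpha(|u|^p)(\tau)\,d\tau .$$ The maximal existence time is $$T_{\max}=\sup\{T>0:\text{ there is a mild solution } u\in C([0,T],L^s(\mathbb{R}^n))\cap L^\infty((0,T),L^\infty(\mathbb{R}^n))\text{ of (P)}\},$$ and the maximal mild solution is the one defined on $[0,T_{\max})$, whose restriction to each $[0,T]$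 with $T<T_{\max}$ is the mild solution on $[0,T]$. *)

theory Defs
  imports "HOL-Analysis.Analysis" "HOL-Probability.Essential_Supremum"
begin

text \<open>Elements of function spaces are represented by functions; identification up to null sets
  is made explicit by AE-equality. The norms are real-valued and meaningful only for members of the
  corresponding space.\<close>

definition Lp_space :: "real \<Rightarrow> (real^'n \<Rightarrow> real) set" where
  "Lp_space s = {f. f \<in> borel_measurable lborel \<and> integrable lborel (\<lambda>x. \<bar>f x\<bar> powr s)}"

definition Lp_norm :: "real \<Rightarrow> (real^'n \<Rightarrow> real) \<Rightarrow> real" where
  "Lp_norm s f = (\<integral>x. \<bar>f x\<bar> powr s \<partial>lborel) powr (1 / s)"

definition Linf_space :: "(real^'n \<Rightarrow> real) set" where
  "Linf_space = {f. f \<in> borel_measurable lborel \<and> esssup lborel (\<lambda>x. ereal \<bar>f x\<bar>) < \<infinity>}"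

definition Linf_norm :: "(real^'n \<Rightarrow> real) \<Rightarrow> real" where
  "Linf_norm f = real_of_ereal (esssup lborel (\<lambda>x. ereal \<bar>f x\<bar>))"

definition X_space :: "real \<Rightarrow> (real^'n \<Rightarrow> real) set" where
  "X_space s = Lp_space s \<inter> Linf_space"

definition X_norm :: "real \<Rightarrow> (real^'n \<Rightarrow> real) \<Rightarrow> real" where
  "X_norm s f = Lp_norm s f + Linf_norm f"

text \<open>In the following, a space of functions is given by its set \<open>V\<close> of members and its norm \<open>N\<close>.
  Strong (Bochner) measurability of a space-valued map on \<open>I\<close>: it is almost everywhere the
  norm limit of a sequence of simple maps.\<close>

definition strongly_measurable_into ::
  "(real^'n \<Rightarrow> real) set \<Rightarrow> ((real^'n \<Rightarrow> real) \<Rightarrow> real) \<Rightarrow> real set \<Rightarrow>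
    (real \<Rightarrow> real^'n \<Rightarrow> real) \<Rightarrow> bool" where
  "strongly_measurable_into V N I u \<longleftrightarrow>
     (\<exists>\<sigma> :: nat \<Rightarrow> real \<Rightarrow> real^'n \<Rightarrow> real.
        (\<forall>k. simple_function (restrict_space lborel I) (\<sigma> k) \<and> \<sigma> k ` I \<subseteq> V) \<and>
        (AE t in restrict_space lborel I.
           u t \<in> V \<and> (\<lambda>k. N (\<lambda>x. \<sigma> k t x - u t x)) \<longlonglongrightarrow> 0))"

definition Linf_time ::
  "(real^'n \<Rightarrow> real) set \<Rightarrow> ((real^'n \<Rightarrow> real) \<Rightarrow> real) \<Rightarrow> real set \<Rightarrow>
    (real \<Rightarrow> real^'n \<Rightarrow> real) set" where
  "Linf_time V N I = {u. strongly_measurable_into V N I u \<and>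
     (\<exists>C. AE t in restrict_space lborel I. u t \<in> V \<and> N (u t) \<le> C)}"

definition C_time ::
  "(real^'n \<Rightarrow> real) set \<Rightarrow> ((real^'n \<Rightarrow> real) \<Rightarrow> real) \<Rightarrow> real set \<Rightarrow>
    (real \<Rightarrow> real^'n \<Rightarrow> real) set" where
  "C_time V N I = {u. \<forall>t\<in>I. u t \<in> V \<and>
     ((\<lambda>r. N (\<lambda>x. u r x - u t x)) \<longlongrightarrow> 0) (at t within I)}"

definition riesz_const :: "nat \<Rightarrow> real \<Rightarrow> real" where
  "riesz_const n \<alpha> =
     Gamma ((real n - \<alpha>) / 2) / (Gamma (\<alpha> / 2) * pi powr (real n / 2) * 2 powr \<alpha>)"

definition riesz_potential :: "real \<Rightarrow> (real^'n \<Rightarrow> real) \<Rightarrow> real^'n \<Rightarrow> real" where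
  "riesz_potential \<alpha> f x =
     riesz_const CARD('n) \<alpha> *
       (\<integral>y. f y / norm (x - y) powr (real CARD('n) - \<alpha>) \<partial>lborel)"

text \<open>The integral is real, because the imaginary part of the integrand is odd in \<open>\<xi>\<close>;
  \<open>Re\<close> only adjusts the type.\<close>

definition S_kernel :: "real \<Rightarrow> real^'n \<Rightarrow> real \<Rightarrow> real" where
  "S_kernel \<beta> x t =
     Re (complex_of_real (1 / (2 * pi) ^ CARD('n)) *
         (\<integral>\<xi>. exp (\<i> * complex_of_real (x \<bullet> \<xi>) -
                   complex_of_real (t * norm (\<xi> :: real^'n) powr \<beta>)) \<partial>lborel))"

definition S_semigroup :: "real \<Rightarrow> real \<Rightarrow> (real^'n \<Rightarrow> real) \<Rightarrow> real^'n \<Rightarrow> real" where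
  "S_semigroup \<beta> t v =
     (if t = 0 then v else (\<lambda>x. \<integral>y. S_kernel \<beta> (x - y) t * v y \<partial>lborel))"

definition duhamel_integrand ::
  "real \<Rightarrow> real \<Rightarrow> real \<Rightarrow> (real \<Rightarrow> real^'n \<Rightarrow> real) \<Rightarrow> real \<Rightarrow> real \<Rightarrow> real^'n \<Rightarrow> real" where
  "duhamel_integrand \<alpha> \<beta> p u t \<tau> =
     S_semigroup \<beta> (t - \<tau>) (riesz_potential \<alpha> (\<lambda>y. \<bar>u \<tau> y\<bar> powr p))"

text \<open>The Duhamel equation is an identity almost everywhere in \<open>x\<close> for every time \<open>t\<close>; its time
  integral is an absolutely convergent Lebesgue integral for almost every \<open>x\<close>.\<close>

definition mild_solution ::
  "real \<Rightarrow> real \<Rightarrow> real \<Rightarrow> real \<Rightarrow> (real^'n \<Rightarrow> real) \<Rightarrow> real \<Rightarrow>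
    (real \<Rightarrow> real^'n \<Rightarrow> real) \<Rightarrow> bool" where
  "mild_solution \<alpha> \<beta> p s u0 T u \<longleftrightarrow>
     u \<in> Linf_time (X_space s) (X_norm s) {0<..<T} \<and>
     (AE x in lborel. u 0 x = u0 x) \<and>
     (\<forall>t\<in>{0..T}. AE x in lborel.
        set_integrable lborel {0..t} (\<lambda>\<tau>. duhamel_integrand \<alpha> \<beta> p u t \<tau> x) \<and>
        u t x = S_semigroup \<beta> t u0 x +
                (LINT \<tau>:{0..t}|lborel. duhamel_integrand \<alpha> \<beta> p u t \<tau> x))"

definition regular_mild_solution ::
  "real \<Rightarrow> real \<Rightarrow> real \<Rightarrow> real \<Rightarrow> (real^'n \<Rightarrow> real) \<Rightarrow> real \<Rightarrow>
    (real \<Rightarrow> real^'n \<Rightarrow> real) \<Rightarrow> bool" where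
  "regular_mild_solution \<alpha> \<beta> p s u0 T u \<longleftrightarrow>
     mild_solution \<alpha> \<beta> p s u0 T u \<and>
     u \<in> C_time (Lp_space s) (Lp_norm s) {0..T} \<inter> Linf_time Linf_space Linf_norm {0<..<T}"

definition is_the_mild_solution ::
  "real \<Rightarrow> real \<Rightarrow> real \<Rightarrow> real \<Rightarrow> (real^'n \<Rightarrow> real) \<Rightarrow> real \<Rightarrow>
    (real \<Rightarrow> real^'n \<Rightarrow> real) \<Rightarrow> bool" where
  "is_the_mild_solution \<alpha> \<beta> p s u0 T u \<longleftrightarrow>
     regular_mild_solution \<alpha> \<beta> p s u0 T u \<and>
     (\<forall>v. regular_mild_solution \<alpha> \<beta> p s u0 T v \<longrightarrow>
        (\<forall>t\<in>{0..T}. AE x in lborel. v t x = u t x))"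

definition T_max :: "real \<Rightarrow> real \<Rightarrow> real \<Rightarrow> real \<Rightarrow> (real^'n \<Rightarrow> real) \<Rightarrow> ereal" where
  "T_max \<alpha> \<beta> p s u0 =
     Sup {ereal T | T. T > 0 \<and> (\<exists>u. regular_mild_solution \<alpha> \<beta> p s u0 T u)}"

text \<open>Boundedness in time is required on each \<open>(0,T)\<close> with \<open>T < T_max\<close>, not uniformly up to
  \<open>T_max\<close>.\<close>

definition maximal_mild_solution ::
  "real \<Rightarrow> real \<Rightarrow> real \<Rightarrow> real \<Rightarrow> (real^'n \<Rightarrow> real) \<Rightarrow>
    (real \<Rightarrow> real^'n \<Rightarrow> real) \<Rightarrow> bool" where
  "maximal_mild_solution \<alpha> \<beta> p s u0 u \<longleftrightarrow>
     (\<forall>T. 0 < T \<and> ereal T < T_max \<alpha> \<beta> p s u0 \<longrightarrow> is_the_mild_solution \<alpha> \<beta> p s u0 T u)"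

end

theory Submission
  imports Defs "HOL-Probability.Probability" "HOL-Real_Asymp.Real_Asymp"
begin

text \<open>The kernel is nonnegative because \<open>exp (- t * norm \<xi> powr \<beta>)\<close> is a limit of nonnegative
  combinations of Gaussians; Gaussian regularisation of its Fourier integral then yields mass one and
  the convolution semigroup law.

  The strict bounds on \<open>s\<close> leave room to replace the Hardy-Littlewood-Sobolev inequality by an
  integrable majorant of the Riesz kernel: with \<open>g = (\<bar>u\<bar> + \<bar>v\<bar>) powr (p - 1)\<close> the source is
  Lipschitz in the sup norm, with a constant controlled by the sup and \<open>L\<^sup>s\<close> bounds of \<open>u\<close> and \<open>v\<close>.
  Hence the Picard iterates, which keep both bounds on a time interval whose length depends only on
  the size of the data, converge uniformly, and no completeness of function spaces is needed: the
  \<open>L\<^sup>s\<close> bound passes to the limit by Fatou's lemma.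

  The limit satisfies the Duhamel equation at every point and restarts at every time
  by the semigroup law. Comparing \<open>u t\<close> with the evolution of \<open>u r\<close> for \<open>r < t\<close>
  gives continuity in time, because the kernel is \<open>L\<^sup>1\<close>-continuous for positive times, and restarting
  gives continuation, hence the blow-up alternative.\<close>

section \<open>Integrals on Euclidean space\<close>

text \<open>What counts as a solution shapes the proof. The constructed solutions are jointly
  measurable and satisfy the equation everywhere. Hence there are two notions:
  \<open>pointwise_solution\<close> for what is built, glued and restarted, and
  \<open>ae_solution\<close> for what every mild solution supplies. Uniqueness is proved in the weak
  class; \<open>pointwise_of_regular\<close> shows that both classes reach the same existence times,
  so that \<open>T_max\<close> can be computed with constructed solutions.

  Sizes are measured by \<open>Lp_mass\<close>, the s-th power of the L^s norm. Jensen and Tonelli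
  then replace the inequalities of Minkowski and Young, at the price of a factor 2^s for sums.
  Sup-norm continuity may fail at time 0 for merely bounded data; it is used at positive times only,
  and L^s continuity at 0 comes separately from the L^1 modulus of translation.\<close>

lemma nn_integral_affine:
  fixes f :: "'a::euclidean_space \<Rightarrow> ennreal"
  assumes [measurable]: "f \<in> borel_measurable borel" and c: "c \<noteq> 0"
  shows "(\<integral>\<^sup>+x. f x \<partial>lborel) = \<bar>c\<bar> ^ DIM('a) * (\<integral>\<^sup>+x. f (t + c *\<^sub>R x) \<partial>lborel)"
  by (subst lborel_affine[OF c, of t])
     (simp add: nn_integral_density nn_integral_distr nn_integral_cmult ennreal_power)

lemma integrable_affine:
  fixes f :: "'a::euclidean_space \<Rightarrow> real"
  assumes f: "integrable lborel f" and c: "c \<noteq> 0"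
  shows "integrable lborel (\<lambda>x. f (t + c *\<^sub>R x))"
proof -
  have [measurable]: "f \<in> borel_measurable borel" using f by simp
  from f have "(\<integral>\<^sup>+x. ennreal (norm (f x)) \<partial>lborel) < \<infinity>"
    by (simp add: integrable_iff_bounded)
  then have "(\<integral>\<^sup>+x. ennreal (norm (f (t + c *\<^sub>R x))) \<partial>lborel) < \<infinity>"
    using c by (subst (asm) nn_integral_affine[OF _ c, of _ t]) (auto simp: ennreal_mult_less_top)
  then show ?thesis by (simp add: integrable_iff_bounded)
qed

lemma integral_affine:
  fixes f :: "'a::euclidean_space \<Rightarrow> real"
  assumes [measurable]: "f \<in> borel_measurable borel" and c: "c \<noteq> 0"
  shows "(\<integral>x. f x \<partial>lborel) = \<bar>c\<bar> ^ DIM('a) * (\<integral>x. f (t + c *\<^sub>R x) \<partial>lborel)"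
  by (subst lborel_affine[OF c, of t]) (simp add: integral_density integral_distr)

lemma nn_integral_reflect:
  fixes f :: "'a::euclidean_space \<Rightarrow> ennreal"
  assumes [measurable]: "f \<in> borel_measurable borel"
  shows "(\<integral>\<^sup>+y. f (x - y) \<partial>lborel) = (\<integral>\<^sup>+y. f y \<partial>lborel)"
  using nn_integral_affine[OF assms, of "-1" x] by simp

lemma nn_integral_translate:
  fixes f :: "'a::euclidean_space \<Rightarrow> ennreal"
  assumes [measurable]: "f \<in> borel_measurable borel"
  shows "(\<integral>\<^sup>+y. f (y - x) \<partial>lborel) = (\<integral>\<^sup>+y. f y \<partial>lborel)"
  using nn_integral_affine[OF assms, of "1" "-x"] by simp

lemma integrable_reflect:
  fixes f :: "'a::euclidean_space \<Rightarrow> real"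
  assumes "integrable lborel f"
  shows "integrable lborel (\<lambda>y. f (x - y))"
  using integrable_affine[OF assms, of "-1" x] by simp

lemma integral_reflect:
  fixes f :: "'a::euclidean_space \<Rightarrow> real"
  assumes "f \<in> borel_measurable borel"
  shows "(\<integral>y. f (x - y) \<partial>lborel) = (\<integral>y. f y \<partial>lborel)"
  using integral_affine[OF assms, of "-1" x] by simp

lemma emeasure_cball_scaled:
  assumes "r > 0"
  shows "emeasure lborel (cball (0::'a::euclidean_space) r)
    = ennreal (r ^ DIM('a)) * emeasure lborel (cball (0::'a) 1)"
  using assms by (simp add: emeasure_cball ennreal_mult[symmetric] mult.commute)

lemma le_suminf_ennreal: "f k \<le> suminf f" for f :: "nat \<Rightarrow> ennreal"
  using sum_le_suminf[of f "{k}"] by simp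

lemma ennreal_mult_emeasure_cball:
  assumes "0 \<le> c" "0 < r" "c * r ^ DIM('a) = d"
  shows "ennreal c * emeasure lborel (cball (0::'a::euclidean_space) r)
    = ennreal d * emeasure lborel (cball (0::'a) 1)"
proof -
  have "ennreal d = ennreal c * ennreal (r ^ DIM('a))"
    using assms by (simp add: ennreal_mult flip: assms(3))
  then show ?thesis
    by (simp only: emeasure_cball_scaled[OF assms(2)] mult.assoc)
qed

text \<open>On the shell where |z| lies between 2^k and 2^(k+1) the integrand is at most 2^(- b k),
  and the ball of radius 2^(k+1) has volume proportional to 2^(n (k+1)). Summing over k leaves a
  geometric series with ratio 2^(n - b) < 1.\<close>

lemma integrable_powr_outside_ball:
  assumes b: "b > real DIM('a::euclidean_space)"
  shows "integrable lborel (\<lambda>z::'a. if norm z \<le> 1 then 0 else norm z powr - b)"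
proof (rule integrableI_nonneg)
  let ?V = "emeasure lborel (cball (0::'a) 1)"
  let ?n = "DIM('a)"
  let ?q = "2 powr (real ?n - b)"
  have q: "0 < ?q" "?q < 1"
    using b powr_less_mono[of "real ?n - b" 0 2] by simp_all
  have bound: "ennreal (if norm z \<le> 1 then 0 else norm z powr - b)
      \<le> (\<Sum>k. ennreal ((2 powr - b) ^ k) * indicator (cball 0 (2 ^ Suc k)) z)" for z :: 'a
  proof (cases "norm z \<le> 1")
    case False
    define k where "k = nat \<lfloor>log 2 (norm z)\<rfloor>"
    have z: "norm z > 1" "z \<noteq> 0" using False by auto
    have l0: "0 \<le> log 2 (norm z)" using z by (subst zero_le_log_cancel_iff) linarith+
    have k1: "real k \<le> log 2 (norm z)" and k2: "log 2 (norm z) \<le> real k + 1"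
      unfolding k_def using l0 by linarith+
    have "2 powr real k \<le> norm z" using k1 z by (simp add: le_log_iff)
    then have "norm z powr - b \<le> (2 powr real k) powr - b"
      using b z by (intro powr_mono2') auto
    also have "\<dots> = (2 powr - b) ^ k"
      by (simp add: powr_powr powr_power mult.commute)
    finally have le: "norm z powr - b \<le> (2 powr - b) ^ k" .
    have "norm z \<le> 2 powr (real k + 1)" using k2 z by (simp add: log_le_iff)
    also have "\<dots> = 2 ^ Suc k" by (simp add: powr_add powr_realpow)
    finally have "z \<in> cball 0 (2 ^ Suc k)" by simp
    then have "ennreal (if norm z \<le> 1 then 0 else norm z powr - b)
        \<le> ennreal ((2 powr - b) ^ k) * indicator (cball 0 (2 ^ Suc k)) z"
      using le z by (simp add: ennreal_leI)
    also have "\<dots> \<le> (\<Sum>k. ennreal ((2 powr - b) ^ k) * indicator (cball 0 (2 ^ Suc k)) z)"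
      by (rule le_suminf_ennreal[where f="\<lambda>k. ennreal ((2 powr - b) ^ k) * indicator (cball 0 (2 ^ Suc k)) z"])
    finally show ?thesis .
  qed simp
  have "(\<integral>\<^sup>+z. ennreal (if norm z \<le> 1 then 0 else norm z powr - b) \<partial>(lborel::'a measure))
      \<le> (\<integral>\<^sup>+z. (\<Sum>k. ennreal ((2 powr - b) ^ k) * indicator (cball 0 (2 ^ Suc k)) (z::'a)) \<partial>lborel)"
    by (intro nn_integral_mono bound)
  also have "\<dots> = (\<Sum>k. ennreal ((2 powr - b) ^ k) * emeasure lborel (cball (0::'a) (2 ^ Suc k)))"
    by (subst nn_integral_suminf) (simp_all only: nn_integral_cmult_indicator sets_lborel borel_closed closed_cball borel_measurable_times_ennreal borel_measurable_const borel_measurable_indicator measurable_lborel1)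
  also have "\<dots> = (\<Sum>k. ennreal (2 ^ ?n * ?q ^ k) * ?V)"
  proof (intro suminf_cong)
    fix k
    have qeq: "?q = 2 ^ ?n * 2 powr - b"
      unfolding diff_conv_add_uminus powr_add by (simp add: powr_realpow)
    have "(2 powr - b) ^ k * (2 ^ Suc k) ^ ?n = 2 ^ ?n * ?q ^ k"
      by (simp add: qeq power_mult_distrib mult_ac flip: power_mult)
    then show "ennreal ((2 powr - b) ^ k) * emeasure lborel (cball (0::'a) (2 ^ Suc k)) = ennreal (2 ^ ?n * ?q ^ k) * ?V"
      by (intro ennreal_mult_emeasure_cball) auto
  qed
  also have "\<dots> = (\<Sum>k. ennreal (2 ^ ?n * ?q ^ k)) * ?V" by (rule ennreal_suminf_multc)
  also have "(\<Sum>k. ennreal (2 ^ ?n * ?q ^ k)) = ennreal (\<Sum>k. 2 ^ ?n * ?q ^ k)"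
    using q by (intro suminf_ennreal2) (auto intro!: summable_mult summable_geometric)
  also have "\<dots> * ?V < \<infinity>"
    using emeasure_lborel_cball_finite[of "0::'a" 1] by (simp add: ennreal_mult_less_top)
  finally show "(\<integral>\<^sup>+z. ennreal (if norm z \<le> 1 then 0 else norm z powr - b) \<partial>(lborel::'a measure)) < \<infinity>" .
qed auto

text \<open>Dyadic balls again, now shrinking: for 2^(-k-1) \<le> |z| \<le> 2^(-k) the integrand is
  at most 2^(a (k+1)), and the series has ratio 2^(a - n) < 1. At the origin the integrand is 0,
  because \<open>0 powr - a\<close> is 0.\<close>

lemma integrable_powr_inside_ball:
  assumes a: "a < real DIM('a::euclidean_space)" "0 \<le> a"
  shows "integrable lborel (\<lambda>z::'a. if norm z \<le> 1 then norm z powr - a else 0)"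
proof (rule integrableI_nonneg)
  let ?V = "emeasure lborel (cball (0::'a) 1)"
  let ?n = "DIM('a)"
  let ?q = "2 powr (a - real ?n)"
  have q: "0 < ?q" "?q < 1"
    using a powr_less_mono[of "a - real ?n" 0 2] by simp_all
  have bound: "ennreal (if norm z \<le> 1 then norm z powr - a else 0)
      \<le> (\<Sum>k. ennreal ((2 powr a) ^ Suc k) * indicator (cball 0 ((1/2) ^ k)) z)" for z :: 'a
  proof (cases "norm z \<le> 1 \<and> z \<noteq> 0")
    case True
    define k where "k = nat \<lfloor>- log 2 (norm z)\<rfloor>"
    have z: "norm z \<le> 1" "0 < norm z" using True by auto
    have l0: "0 \<le> - log 2 (norm z)" using z by (simp add: log_le_zero_cancel_iff)
    have k1: "log 2 (norm z) \<le> - real k" and k2: "- real k - 1 \<le> log 2 (norm z)"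
      unfolding k_def using l0 by linarith+
    have "2 powr (- real k - 1) \<le> norm z" using k2 z by (simp add: le_log_iff)
    then have "norm z powr - a \<le> (2 powr (- real k - 1)) powr - a"
      using a z by (intro powr_mono2') auto
    also have "\<dots> = (2 powr a) ^ Suc k"
      unfolding powr_powr by (subst powr_power) (auto simp: algebra_simps)
    finally have le: "norm z powr - a \<le> (2 powr a) ^ Suc k" .
    have "norm z \<le> 2 powr (- real k)" using k1 z by (simp add: log_le_iff)
    also have "\<dots> = (1/2) ^ k" by (simp add: powr_minus powr_realpow power_one_over inverse_eq_divide)
    finally have "z \<in> cball 0 ((1/2) ^ k)" by simp
    then have "ennreal (if norm z \<le> 1 then norm z powr - a else 0)
        \<le> ennreal ((2 powr a) ^ Suc k) * indicator (cball 0 ((1/2) ^ k)) z"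
      using le z by (simp add: ennreal_leI del: power_Suc)
    also have "\<dots> \<le> (\<Sum>k. ennreal ((2 powr a) ^ Suc k) * indicator (cball 0 ((1/2) ^ k)) z)"
      by (rule le_suminf_ennreal[where f="\<lambda>k. ennreal ((2 powr a) ^ Suc k) * indicator (cball 0 ((1/2) ^ k)) z"])
    finally show ?thesis .
  next
    case False
    then have "(if norm z \<le> 1 then norm z powr - a else 0) = 0" by auto
    then show ?thesis by (simp only: ennreal_0 zero_le)
  qed
  have "(\<integral>\<^sup>+z. ennreal (if norm z \<le> 1 then norm z powr - a else 0) \<partial>(lborel::'a measure))
      \<le> (\<integral>\<^sup>+z. (\<Sum>k. ennreal ((2 powr a) ^ Suc k) * indicator (cball 0 ((1/2) ^ k)) (z::'a)) \<partial>lborel)"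
    by (intro nn_integral_mono bound)
  also have "\<dots> = (\<Sum>k. ennreal ((2 powr a) ^ Suc k) * emeasure lborel (cball (0::'a) ((1/2) ^ k)))"
    by (subst nn_integral_suminf) (simp_all only: nn_integral_cmult_indicator sets_lborel borel_closed closed_cball borel_measurable_times_ennreal borel_measurable_const borel_measurable_indicator measurable_lborel1)
  also have "\<dots> = (\<Sum>k. ennreal (2 powr a * ?q ^ k) * ?V)"
  proof (intro suminf_cong)
    fix k
    have qeq: "?q = 2 powr a * (1/2) ^ ?n"
      by (simp add: powr_diff powr_realpow power_one_over)
    have "A ^ Suc k * (B ^ k) ^ ?n = A * (A * B ^ ?n) ^ k" for A B :: real
      by (simp add: power_mult_distrib mult_ac flip: power_mult)
    from this[of "2 powr a" "1/2"] have "(2 powr a) ^ Suc k * ((1/2) ^ k) ^ ?n = 2 powr a * ?q ^ k"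
      unfolding qeq .
    then show "ennreal ((2 powr a) ^ Suc k) * emeasure lborel (cball (0::'a) ((1/2) ^ k)) = ennreal (2 powr a * ?q ^ k) * ?V"
      by (intro ennreal_mult_emeasure_cball) auto
  qed
  also have "\<dots> = (\<Sum>k. ennreal (2 powr a * ?q ^ k)) * ?V" by (rule ennreal_suminf_multc)
  also have "(\<Sum>k. ennreal (2 powr a * ?q ^ k)) = ennreal (\<Sum>k. 2 powr a * ?q ^ k)"
    using q by (intro suminf_ennreal2) (auto intro!: summable_mult summable_geometric)
  also have "\<dots> * ?V < \<infinity>"
    using emeasure_lborel_cball_finite[of "0::'a" 1] by (simp add: ennreal_mult_less_top)
  finally show "(\<integral>\<^sup>+z. ennreal (if norm z \<le> 1 then norm z powr - a else 0) \<partial>(lborel::'a measure)) < \<infinity>" .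
qed auto

text \<open>From exp z \<ge> z^N / N! the decay is at least that of |\<xi>|^(- N \<beta>), and N is
  chosen with N \<beta> beyond the dimension. Inside the unit ball the bound 1 suffices.\<close>

lemma integrable_exp_powr_norm:
  assumes t: "0 < t" and \<beta>: "0 < \<beta>"
  shows "integrable lborel (\<lambda>\<xi>::'a::euclidean_space. exp (- (t * norm \<xi> powr \<beta>)))"
proof -
  obtain N :: nat where N: "real N * \<beta> > real DIM('a)"
    using \<beta> reals_Archimedean3 by blast
  define C where "C = fact N / t ^ N"
  have C: "C > 0" using t by (simp add: C_def)
  \<comment> \<open>The first summand is the indicator of the unit ball without the origin, since
    \<open>0 powr - 0\<close> is 0; the indicator of the singleton restores the missing
    point.\<close>
  have bound: "exp (- (t * norm \<xi> powr \<beta>))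
     \<le> (if norm \<xi> \<le> 1 then norm \<xi> powr - 0 else 0) + indicator {0} \<xi>
       + C * (if norm \<xi> \<le> 1 then 0 else norm \<xi> powr - (real N * \<beta>))" for \<xi> :: 'a
  proof (cases "norm \<xi> \<le> 1")
    case True
    then show ?thesis using t by (auto split: split_indicator)
  next
    case False
    define z where "z = t * norm \<xi> powr \<beta>"
    have z: "z > 0" using False t unfolding z_def by (intro mult_pos_pos) auto
    have "z ^ N / fact N \<le> exp z"
      unfolding exp_def using z sum_le_suminf[OF summable_exp_generic[of z], of "{N}"]
      by (simp add: divide_inverse mult.commute)
    then have "exp (- z) \<le> fact N / z ^ N"
      using z by (simp add: exp_minus field_simps)
    also have "\<dots> = C * norm \<xi> powr - (real N * \<beta>)"
    proof -
      have "\<xi> \<noteq> 0" using False by auto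
      then show ?thesis
        using t by (simp add: z_def C_def power_mult_distrib powr_minus powr_power field_simps)
    qed
    finally show ?thesis using False by (auto simp: z_def split: split_indicator)
  qed
  show ?thesis
  proof (rule Bochner_Integration.integrable_bound[OF _ _ AE_I2])
    show "integrable lborel (\<lambda>\<xi>::'a. (if norm \<xi> \<le> 1 then norm \<xi> powr - 0 else 0) + indicator {0} \<xi>
       + C * (if norm \<xi> \<le> 1 then 0 else norm \<xi> powr - (real N * \<beta>)))"
      using N by (intro Bochner_Integration.integrable_add integrable_mult_right
          integrable_powr_inside_ball integrable_powr_outside_ball) auto
    fix \<xi> :: 'a
    show "norm (exp (- (t * norm \<xi> powr \<beta>))) \<le> norm ((if norm \<xi> \<le> 1 then norm \<xi> powr - 0 else 0) + indicator {0} \<xi>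
       + C * (if norm \<xi> \<le> 1 then 0 else norm \<xi> powr - (real N * \<beta>)))"
      using bound[of \<xi>] by (simp add: abs_of_nonneg)
  qed simp
qed

section \<open>Fourier transforms of Gaussians\<close>

lemma gaussian_fourier_real:
  fixes a \<epsilon> :: real
  assumes e: "\<epsilon> > 0"
  shows "integrable lborel (\<lambda>y::real. exp (\<i> * of_real (a * y) - of_real (\<epsilon> * y\<^sup>2)))"
    and "(\<integral>y. exp (\<i> * of_real (a * y) - of_real (\<epsilon> * y\<^sup>2)) \<partial>lborel)
      = complex_of_real (sqrt (pi / \<epsilon>) * exp (- a\<^sup>2 / (4 * \<epsilon>)))"
proof -
  \<comment> \<open>The substitution of c y for y turns exp (- y^2 / 2) into exp (- \<epsilon> y^2),
    so the integral is a multiple of the characteristic function of the standard normal law at a /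
    c.\<close>
  define c where "c = sqrt (2 * \<epsilon>)"
  have c: "c > 0" "c\<^sup>2 = 2 * \<epsilon>" using e by (auto simp: c_def)
  let ?g = "\<lambda>y::real. of_real (std_normal_density y) * iexp (a / c * y)"
  have int: "integrable lborel ?g"
    by (rule Bochner_Integration.integrable_bound[where f = "std_normal_density"])
       (auto simp: norm_mult)
  have "char std_normal_distribution (a / c) = (\<integral>y. ?g y \<partial>lborel)"
    unfolding char_def by (subst integral_density) (auto simp: scaleR_conv_of_real)
  then have val: "(\<integral>y. ?g y \<partial>lborel) = of_real (exp (- (a / c)\<^sup>2 / 2))"
    by (simp add: char_std_normal_distribution)
  have eq: "?g (0 + c * y) = of_real (1 / sqrt (2 * pi)) * exp (\<i> * of_real (a * y) - of_real (\<epsilon> * y\<^sup>2))" for y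
  proof -
    have "?g (0 + c * y) = of_real (1 / sqrt (2 * pi)) * (of_real (exp (- (c * y)\<^sup>2 / 2)) * iexp (a * y))"
      using c by (simp add: normal_density_def)
    also have "of_real (exp (- (c * y)\<^sup>2 / 2)) * iexp (a * y) = exp (\<i> * of_real (a * y) - of_real (\<epsilon> * y\<^sup>2))"
      using c by (simp only: exp_of_real[symmetric] exp_add[symmetric]) (simp add: power_mult_distrib)
    finally show ?thesis .
  qed
  have "integrable lborel (\<lambda>y. ?g (0 + c * y))"
    using lborel_integrable_real_affine[OF int, of c 0] c by simp
  then have "integrable lborel (\<lambda>y. of_real (sqrt (2 * pi)) * ?g (0 + c * y))" by (rule integrable_mult_right)
  then show "integrable lborel (\<lambda>y::real. exp (\<i> * of_real (a * y) - of_real (\<epsilon> * y\<^sup>2)))"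
    unfolding eq by (simp add: mult.assoc[symmetric] flip: of_real_mult)
  have "(\<integral>y. ?g y \<partial>lborel) = \<bar>c\<bar> *\<^sub>R (\<integral>y. ?g (0 + c * y) \<partial>lborel)"
    using c by (intro lborel_integral_real_affine) auto
  also have "\<dots> = of_real (c / sqrt (2 * pi)) * (\<integral>y. exp (\<i> * of_real (a * y) - of_real (\<epsilon> * y\<^sup>2)) \<partial>lborel)"
    unfolding eq using c by (simp add: scaleR_conv_of_real)
  finally have "of_real (c / sqrt (2 * pi)) * (\<integral>y. exp (\<i> * of_real (a * y) - of_real (\<epsilon> * y\<^sup>2)) \<partial>lborel) = of_real (exp (- (a / c)\<^sup>2 / 2))"
    using val by simp
  moreover have "(a / c)\<^sup>2 / 2 = a\<^sup>2 / (4 * \<epsilon>)" using c by (simp add: power_divide)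
  moreover have "sqrt (pi / \<epsilon>) * (c / sqrt (2 * pi)) = 1"
    using e unfolding c_def by (simp add: real_sqrt_divide real_sqrt_mult)
  ultimately have "of_real (sqrt (pi / \<epsilon>)) * (of_real (c / sqrt (2 * pi)) * (\<integral>y. exp (\<i> * of_real (a * y) - of_real (\<epsilon> * y\<^sup>2)) \<partial>lborel))
     = complex_of_real (sqrt (pi / \<epsilon>)) * of_real (exp (- a\<^sup>2 / (4 * \<epsilon>)))"
    "of_real (sqrt (pi / \<epsilon>)) * of_real (c / sqrt (2 * pi)) = (1::complex)"
    by (simp_all only: minus_divide_left[symmetric] of_real_mult[symmetric] of_real_1)
  then show "(\<integral>y. exp (\<i> * of_real (a * y) - of_real (\<epsilon> * y\<^sup>2)) \<partial>lborel)
      = complex_of_real (sqrt (pi / \<epsilon>) * exp (- a\<^sup>2 / (4 * \<epsilon>)))"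
    unfolding mult.assoc[symmetric] by simp
qed


lemma integrable_gaussian:
  assumes "\<epsilon> > 0"
  shows "integrable lborel (\<lambda>\<xi>::'a::euclidean_space. exp (- (\<epsilon> * (norm \<xi>)\<^sup>2)))"
  using integrable_exp_powr_norm[OF assms, of 2] by simp

text \<open>In coordinates the complex exponential factors over the basis, which reduces the
  integral to the one-dimensional formula; the cosine version is its real part.\<close>

lemma gaussian_fourier:
  fixes x :: "'a::euclidean_space"
  assumes e: "\<epsilon> > 0"
  shows "(\<integral>\<xi>. cos (x \<bullet> \<xi>) * exp (- (\<epsilon> * (norm \<xi>)\<^sup>2)) \<partial>lborel)
     = sqrt (pi / \<epsilon>) ^ DIM('a) * exp (- (norm x)\<^sup>2 / (4 * \<epsilon>))"
proof -
  interpret P: product_sigma_finite "\<lambda>b::'a. lborel :: real measure" ..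
  let ?f = "\<lambda>\<xi>::'a. exp (\<i> * of_real (x \<bullet> \<xi>) - of_real (\<epsilon> * (norm \<xi>)\<^sup>2)) :: complex"
  have int: "integrable lborel ?f"
    by (rule Bochner_Integration.integrable_bound[OF integrable_gaussian[OF e]]) auto
  have *: "?f (\<Sum>b\<in>Basis. y b *\<^sub>R b) = (\<Prod>b\<in>Basis. exp (\<i> * of_real ((x \<bullet> b) * y b) - of_real (\<epsilon> * (y b)\<^sup>2)))" for y
  proof -
    have "(norm (\<Sum>b\<in>Basis. y b *\<^sub>R b :: 'a))\<^sup>2 = (\<Sum>b\<in>Basis. (y b)\<^sup>2)"
      unfolding power2_norm_eq_inner by (subst euclidean_inner) (simp add: power2_eq_square)
    moreover have "x \<bullet> (\<Sum>b\<in>Basis. y b *\<^sub>R b) = (\<Sum>b\<in>Basis. (x \<bullet> b) * y b)"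
      by (simp add: inner_sum_right mult.commute)
    ultimately show ?thesis
      by (simp add: exp_sum[symmetric] sum_subtractf sum_distrib_left)
  qed
  have "(\<integral>\<xi>. ?f \<xi> \<partial>lborel) = (\<integral>y. ?f (\<Sum>b\<in>Basis. y b *\<^sub>R b) \<partial>(\<Pi>\<^sub>M b\<in>Basis. lborel))"
    by (subst lborel_eq) (subst integral_distr, auto)
  also have "\<dots> = (\<Prod>b\<in>Basis. \<integral>y. exp (\<i> * of_real ((x \<bullet> b) * y) - of_real (\<epsilon> * y\<^sup>2)) \<partial>lborel)"
    unfolding * by (rule P.product_integral_prod[OF finite_Basis gaussian_fourier_real(1)[OF e]])
  also have "\<dots> = of_real (\<Prod>b\<in>Basis. sqrt (pi / \<epsilon>) * exp (- (x \<bullet> b)\<^sup>2 / (4 * \<epsilon>)))"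
    by (simp only: gaussian_fourier_real(2)[OF e] of_real_prod)
  also have "(\<Prod>b\<in>Basis. sqrt (pi / \<epsilon>) * exp (- (x \<bullet> b)\<^sup>2 / (4 * \<epsilon>)))
      = sqrt (pi / \<epsilon>) ^ DIM('a) * exp (- (norm x)\<^sup>2 / (4 * \<epsilon>))"
  proof -
    have "(norm x)\<^sup>2 = (\<Sum>b\<in>Basis. (x \<bullet> b)\<^sup>2)"
      unfolding power2_norm_eq_inner by (subst euclidean_inner) (simp add: power2_eq_square)
    then show ?thesis
      by (simp add: prod.distrib exp_sum[symmetric] sum_negf sum_divide_distrib[symmetric])
  qed
  finally have "Re (\<integral>\<xi>. ?f \<xi> \<partial>lborel) = sqrt (pi / \<epsilon>) ^ DIM('a) * exp (- (norm x)\<^sup>2 / (4 * \<epsilon>))"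
    by (metis Re_complex_of_real)
  moreover have "Re (\<integral>\<xi>. ?f \<xi> \<partial>lborel) = (\<integral>\<xi>. Re (?f \<xi>) \<partial>lborel)"
    using int by (rule integral_Re[symmetric])
  moreover have "Re (?f \<xi>) = cos (x \<bullet> \<xi>) * exp (- (\<epsilon> * (norm \<xi>)\<^sup>2))" for \<xi>
    by (simp add: Re_exp mult.commute)
  ultimately show ?thesis by simp
qed

section \<open>Functions with nonnegative Fourier transform\<close>

text \<open>Nonnegativity of the Fourier transform is tested after a Gaussian cut-off, so that
  merely bounded functions such as the constant 1 qualify. The origin is left out of the bound
  because the binomial series used below is controlled for \<xi> \<noteq> 0.\<close>

definition pos_fourier :: "('a::euclidean_space \<Rightarrow> real) \<Rightarrow> bool" where
  "pos_fourier F \<longleftrightarrow> F \<in> borel_measurable borel \<and> (\<exists>B. \<forall>\<xi>. \<xi> \<noteq> 0 \<longrightarrow> \<bar>F \<xi>\<bar> \<le> B) \<and>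
     (\<forall>\<epsilon> x. 0 < \<epsilon> \<longrightarrow> 0 \<le> (\<integral>\<xi>. cos (x \<bullet> \<xi>) * F \<xi> * exp (- (\<epsilon> * (norm \<xi>)\<^sup>2)) \<partial>lborel))"

lemma pos_fourierD:
  assumes "pos_fourier F"
  shows "F \<in> borel_measurable borel"
    and "0 < \<epsilon> \<Longrightarrow> 0 \<le> (\<integral>\<xi>. cos (x \<bullet> \<xi>) * F \<xi> * exp (- (\<epsilon> * (norm \<xi>)\<^sup>2)) \<partial>lborel)"
  using assms by (auto simp: pos_fourier_def)

lemma AE_nonzero: "(\<And>\<xi>::'a::euclidean_space. \<xi> \<noteq> 0 \<Longrightarrow> P \<xi>) \<Longrightarrow> AE \<xi> in lborel. P \<xi>"
  using AE_lborel_singleton[of "0::'a"] by (auto elim: eventually_mono)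

lemma integrable_mult_gaussian:
  fixes F :: "'a::euclidean_space \<Rightarrow> real"
  assumes [measurable]: "F \<in> borel_measurable borel" and B: "\<And>\<xi>. \<xi> \<noteq> 0 \<Longrightarrow> \<bar>F \<xi>\<bar> \<le> B" and e: "0 < \<epsilon>"
  shows "integrable lborel (\<lambda>\<xi>. cos (x \<bullet> \<xi>) * F \<xi> * exp (- (\<epsilon> * (norm \<xi>)\<^sup>2)))"
proof (rule Bochner_Integration.integrable_bound[OF integrable_mult_right[OF integrable_gaussian[OF e], of B]])
  show "AE \<xi> in lborel. norm (cos (x \<bullet> \<xi>) * F \<xi> * exp (- (\<epsilon> * (norm \<xi>)\<^sup>2))) \<le> norm (B * exp (- (\<epsilon> * (norm \<xi>)\<^sup>2)))"
  proof (rule AE_nonzero)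
    fix \<xi> :: 'a assume "\<xi> \<noteq> 0"
    then have "\<bar>F \<xi>\<bar> \<le> \<bar>B\<bar>" using B[of \<xi>] by linarith
    then have "\<bar>cos (x \<bullet> \<xi>)\<bar> * \<bar>F \<xi>\<bar> \<le> 1 * \<bar>B\<bar>" by (intro mult_mono) auto
    then show "norm (cos (x \<bullet> \<xi>) * F \<xi> * exp (- (\<epsilon> * (norm \<xi>)\<^sup>2))) \<le> norm (B * exp (- (\<epsilon> * (norm \<xi>)\<^sup>2)))"
      by (simp add: abs_mult)
  qed
qed measurable

lemma pos_fourier_integrable:
  assumes F: "pos_fourier F" and "0 < \<epsilon>"
  shows "integrable lborel (\<lambda>\<xi>. cos (x \<bullet> \<xi>) * F \<xi> * exp (- (\<epsilon> * (norm \<xi>)\<^sup>2)))"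
proof -
  obtain B where "\<And>\<xi>. \<xi> \<noteq> 0 \<Longrightarrow> \<bar>F \<xi>\<bar> \<le> B" using F by (auto simp: pos_fourier_def)
  with F assms(2) show ?thesis
    by (intro integrable_mult_gaussian) (auto simp: pos_fourier_def)
qed

lemma pos_fourier_one: "pos_fourier (\<lambda>\<xi>. 1)"
  by (auto simp: pos_fourier_def gaussian_fourier intro!: exI[of _ 1] mult_nonneg_nonneg zero_le_power)

lemma pos_fourier_cmult:
  assumes F: "pos_fourier F" and c: "0 \<le> c"
  shows "pos_fourier (\<lambda>\<xi>. c * F \<xi>)"
  unfolding pos_fourier_def
proof (intro conjI allI impI)
  show "(\<lambda>\<xi>. c * F \<xi>) \<in> borel_measurable borel" using pos_fourierD(1)[OF F] by simp
  obtain B where "\<And>\<xi>. \<xi> \<noteq> 0 \<Longrightarrow> \<bar>F \<xi>\<bar> \<le> B" using F by (auto simp: pos_fourier_def)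
  then show "\<exists>B. \<forall>\<xi>. \<xi> \<noteq> 0 \<longrightarrow> \<bar>c * F \<xi>\<bar> \<le> B"
    using c by (intro exI[of _ "c * B"]) (auto simp: abs_mult intro!: mult_left_mono)
  fix \<epsilon> :: real and x assume e: "0 < \<epsilon>"
  have "(\<integral>\<xi>. cos (x \<bullet> \<xi>) * (c * F \<xi>) * exp (- (\<epsilon> * (norm \<xi>)\<^sup>2)) \<partial>lborel)
    = c * (\<integral>\<xi>. cos (x \<bullet> \<xi>) * F \<xi> * exp (- (\<epsilon> * (norm \<xi>)\<^sup>2)) \<partial>lborel)"
    by (subst integral_mult_right_zero[symmetric]) (simp add: mult_ac)
  then show "0 \<le> (\<integral>\<xi>. cos (x \<bullet> \<xi>) * (c * F \<xi>) * exp (- (\<epsilon> * (norm \<xi>)\<^sup>2)) \<partial>lborel)"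
    using pos_fourierD(2)[OF F e] c by simp
qed

text \<open>A Gaussian factor merely raises the cut-off parameter from \<epsilon> to \<epsilon> + r,
  and the class quantifies over all positive parameters.\<close>

lemma pos_fourier_mult_gaussian:
  assumes F: "pos_fourier F" and r: "0 \<le> r"
  shows "pos_fourier (\<lambda>\<xi>. F \<xi> * exp (- (r * (norm \<xi>)\<^sup>2)))"
  unfolding pos_fourier_def
proof (intro conjI allI impI)
  show "(\<lambda>\<xi>. F \<xi> * exp (- (r * (norm \<xi>)\<^sup>2))) \<in> borel_measurable borel"
    using pos_fourierD(1)[OF F] by simp
  obtain B where B: "\<And>\<xi>. \<xi> \<noteq> 0 \<Longrightarrow> \<bar>F \<xi>\<bar> \<le> B" using F by (auto simp: pos_fourier_def)
  have "\<bar>F \<xi>\<bar> * exp (- (r * (norm \<xi>)\<^sup>2)) \<le> B * 1" if "\<xi> \<noteq> 0" for \<xi>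
    using B[OF that] r by (intro mult_mono) auto
  then show "\<exists>B. \<forall>\<xi>. \<xi> \<noteq> 0 \<longrightarrow> \<bar>F \<xi> * exp (- (r * (norm \<xi>)\<^sup>2))\<bar> \<le> B"
    by (intro exI[of _ B]) (auto simp: abs_mult)
  fix \<epsilon> :: real and x assume e: "0 < \<epsilon>"
  have eq: "cos (x \<bullet> \<xi>) * (F \<xi> * exp (- (r * (norm \<xi>)\<^sup>2))) * exp (- (\<epsilon> * (norm \<xi>)\<^sup>2))
      = cos (x \<bullet> \<xi>) * F \<xi> * exp (- ((\<epsilon> + r) * (norm \<xi>)\<^sup>2))" for \<xi>
  proof -
    have "exp (- (r * (norm \<xi>)\<^sup>2)) * exp (- (\<epsilon> * (norm \<xi>)\<^sup>2)) = exp (- ((\<epsilon> + r) * (norm \<xi>)\<^sup>2))"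
      by (simp add: exp_add[symmetric] algebra_simps)
    then show ?thesis by (simp only: mult.assoc)
  qed
  show "0 \<le> (\<integral>\<xi>. cos (x \<bullet> \<xi>) * (F \<xi> * exp (- (r * (norm \<xi>)\<^sup>2))) * exp (- (\<epsilon> * (norm \<xi>)\<^sup>2)) \<partial>lborel)"
    unfolding eq using pos_fourierD(2)[OF F, of "\<epsilon> + r"] e r by simp
qed

lemma pos_fourier_add:
  assumes F: "pos_fourier F" and G: "pos_fourier G"
  shows "pos_fourier (\<lambda>\<xi>. F \<xi> + G \<xi>)"
  unfolding pos_fourier_def
proof (intro conjI allI impI)
  show "(\<lambda>\<xi>. F \<xi> + G \<xi>) \<in> borel_measurable borel"
    using pos_fourierD(1)[OF F] pos_fourierD(1)[OF G] by simp
  obtain B C where "\<And>\<xi>. \<xi> \<noteq> 0 \<Longrightarrow> \<bar>F \<xi>\<bar> \<le> B" "\<And>\<xi>. \<xi> \<noteq> 0 \<Longrightarrow> \<bar>G \<xi>\<bar> \<le> C"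
    using F G unfolding pos_fourier_def by blast
  then show "\<exists>B. \<forall>\<xi>. \<xi> \<noteq> 0 \<longrightarrow> \<bar>F \<xi> + G \<xi>\<bar> \<le> B"
    by (intro exI[of _ "B + C"]) (smt (verit))
  fix \<epsilon> :: real and x assume e: "0 < \<epsilon>"
  have "(\<integral>\<xi>. cos (x \<bullet> \<xi>) * (F \<xi> + G \<xi>) * exp (- (\<epsilon> * (norm \<xi>)\<^sup>2)) \<partial>lborel)
    = (\<integral>\<xi>. cos (x \<bullet> \<xi>) * F \<xi> * exp (- (\<epsilon> * (norm \<xi>)\<^sup>2)) \<partial>lborel)
      + (\<integral>\<xi>. cos (x \<bullet> \<xi>) * G \<xi> * exp (- (\<epsilon> * (norm \<xi>)\<^sup>2)) \<partial>lborel)"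
    by (subst Bochner_Integration.integral_add[symmetric, OF pos_fourier_integrable[OF F e] pos_fourier_integrable[OF G e]])
       (simp add: algebra_simps)
  then show "0 \<le> (\<integral>\<xi>. cos (x \<bullet> \<xi>) * (F \<xi> + G \<xi>) * exp (- (\<epsilon> * (norm \<xi>)\<^sup>2)) \<partial>lborel)"
    using pos_fourierD(2)[OF F e] pos_fourierD(2)[OF G e] by simp
qed

lemma pos_fourier_zero: "pos_fourier (\<lambda>\<xi>. 0)"
  using pos_fourier_cmult[OF pos_fourier_one, of 0] by simp

lemma pos_fourier_sum:
  fixes N :: nat
  assumes "\<And>k. k < N \<Longrightarrow> pos_fourier (F k)"
  shows "pos_fourier (\<lambda>\<xi>. \<Sum>k<N. F k \<xi>)"
  using assms by (induction N) (auto intro: pos_fourier_zero pos_fourier_add)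

text \<open>The uniform bound times the Gaussian dominates, so the nonnegative integrals converge.
  This closure leads from finite sums of Gaussians to exponentials of fractional powers.\<close>

lemma pos_fourier_lim:
  fixes F :: "'a::euclidean_space \<Rightarrow> real"
  assumes Fk: "\<And>k. pos_fourier (Fk k)"
    and B: "\<And>k \<xi>. \<xi> \<noteq> 0 \<Longrightarrow> \<bar>Fk k \<xi>\<bar> \<le> B"
    and lim: "\<And>\<xi>. \<xi> \<noteq> 0 \<Longrightarrow> (\<lambda>k. Fk k \<xi>) \<longlonglongrightarrow> F \<xi>"
    and [measurable]: "F \<in> borel_measurable borel"
  shows "pos_fourier F"
  unfolding pos_fourier_def
proof (intro conjI allI impI)
  show "\<exists>B. \<forall>\<xi>. \<xi> \<noteq> 0 \<longrightarrow> \<bar>F \<xi>\<bar> \<le> B"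
    using LIMSEQ_le_const2[OF tendsto_rabs[OF lim]] B by (metis (no_types, lifting))
  have [measurable]: "Fk k \<in> borel_measurable borel" for k using pos_fourierD(1)[OF Fk] .
  fix \<epsilon> :: real and x :: 'a assume e: "0 < \<epsilon>"
  have "(\<lambda>k. \<integral>\<xi>. cos (x \<bullet> \<xi>) * Fk k \<xi> * exp (- (\<epsilon> * (norm \<xi>)\<^sup>2)) \<partial>lborel)
     \<longlonglongrightarrow> (\<integral>\<xi>. cos (x \<bullet> \<xi>) * F \<xi> * exp (- (\<epsilon> * (norm \<xi>)\<^sup>2)) \<partial>lborel)"
  proof (rule integral_dominated_convergence[where w = "\<lambda>\<xi>. B * exp (- (\<epsilon> * (norm \<xi>)\<^sup>2))"])
    show "integrable lborel (\<lambda>\<xi>::'a. B * exp (- (\<epsilon> * (norm \<xi>)\<^sup>2)))"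
      by (rule integrable_mult_right[OF integrable_gaussian[OF e]])
    show "AE \<xi> in lborel. (\<lambda>k. cos (x \<bullet> \<xi>) * Fk k \<xi> * exp (- (\<epsilon> * (norm \<xi>)\<^sup>2)))
        \<longlonglongrightarrow> cos (x \<bullet> \<xi>) * F \<xi> * exp (- (\<epsilon> * (norm \<xi>)\<^sup>2))"
      by (rule AE_nonzero) (intro tendsto_intros lim)
    fix k
    show "AE \<xi> in lborel. norm (cos (x \<bullet> \<xi>) * Fk k \<xi> * exp (- (\<epsilon> * (norm \<xi>)\<^sup>2))) \<le> B * exp (- (\<epsilon> * (norm \<xi>)\<^sup>2))"
    proof (rule AE_nonzero)
      fix \<xi> :: 'a assume "\<xi> \<noteq> 0"
      then have "\<bar>cos (x \<bullet> \<xi>)\<bar> * \<bar>Fk k \<xi>\<bar> \<le> 1 * B" using B by (intro mult_mono) auto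
      then show "norm (cos (x \<bullet> \<xi>) * Fk k \<xi> * exp (- (\<epsilon> * (norm \<xi>)\<^sup>2))) \<le> B * exp (- (\<epsilon> * (norm \<xi>)\<^sup>2))"
        by (simp add: abs_mult)
    qed
  qed measurable
  then show "0 \<le> (\<integral>\<xi>. cos (x \<bullet> \<xi>) * F \<xi> * exp (- (\<epsilon> * (norm \<xi>)\<^sup>2)) \<partial>lborel)"
    by (rule LIMSEQ_le_const) (use pos_fourierD(2)[OF Fk e] in auto)
qed fact

text \<open>For i \<ge> 1 the factors \<gamma> - i of the numerator are nonpositive; there are k of
  them, and (-1)^k absorbs their signs.\<close>

lemma gbinomial_sign:
  fixes \<gamma> :: real
  assumes "0 < \<gamma>" "\<gamma> \<le> 1"
  shows "0 \<le> (-1) ^ k * (\<gamma> gchoose Suc k)"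
proof -
  have "0 \<le> (-1) ^ k * (\<Prod>i=0..k. \<gamma> - real i)"
  proof (induction k)
    case (Suc k)
    have "(-1) ^ Suc k * (\<Prod>i=0..Suc k. \<gamma> - real i) = ((-1) ^ k * (\<Prod>i=0..k. \<gamma> - real i)) * (real (Suc k) - \<gamma>)"
      by (simp add: algebra_simps)
    moreover have "0 \<le> real (Suc k) - \<gamma>" using assms by simp
    ultimately show ?case using mult_nonneg_nonneg[OF Suc] by (simp only:)
  qed (use assms in simp)
  then have "0 \<le> ((-1) ^ k * (\<Prod>i=0..k. \<gamma> - real i)) / fact (Suc k)"
    by (intro divide_nonneg_nonneg fact_ge_zero)
  then show ?thesis unfolding gbinomial_Suc times_divide_eq_right .
qed

text \<open>The Taylor coefficients of \<open>1 - (1 - z) powr \<gamma>\<close> are nonnegative for \<open>0 < \<gamma> \<le> 1\<close>. Hence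
  \<open>exp (- c * (1 - exp (- h * \<lambda>)) powr \<gamma>)\<close> is a limit of nonnegative combinations of
  exponentials \<open>exp (- r * \<lambda>)\<close>.\<close>

lemma one_minus_powr_sums:
  fixes \<gamma> z :: real
  assumes "\<bar>z\<bar> < 1"
  shows "(\<lambda>k. (-1) ^ k * (\<gamma> gchoose Suc k) * z ^ Suc k) sums (1 - (1 - z) powr \<gamma>)"
proof -
  have "(\<lambda>k. (\<gamma> gchoose k) * (- z) ^ k) sums (1 + - z) powr \<gamma>"
    using assms by (intro gen_binomial_real) simp
  then have "(\<lambda>k. (\<gamma> gchoose Suc k) * (- z) ^ Suc k) sums ((1 - z) powr \<gamma> - 1)"
    by (subst sums_Suc_iff) simp
  then have "(\<lambda>k. - ((\<gamma> gchoose Suc k) * (- z) ^ Suc k)) sums (- ((1 - z) powr \<gamma> - 1))"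
    by (rule sums_minus)
  moreover have "- ((\<gamma> gchoose Suc k) * (- z) ^ Suc k) = (-1) ^ k * (\<gamma> gchoose Suc k) * z ^ Suc k" for k
    using power_minus[of z k] by simp
  ultimately show ?thesis by (simp only: minus_diff_eq)
qed

text \<open>Write (1 - z)^\<gamma> = 1 - q, where q is a power series in the Gaussian z with
  nonnegative coefficients. The function is then exp (- c) exp (c q). With q truncated, every
  partial sum of the outer exponential series is a nonnegative combination of 1 and Gaussians; the
  two truncations are removed one after the other.\<close>

lemma pos_fourier_exp_subordinated:
  fixes \<gamma> c h :: real
  assumes \<gamma>: "0 < \<gamma>" "\<gamma> \<le> 1" and c: "0 \<le> c" and h: "0 < h"
  shows "pos_fourier (\<lambda>\<xi>::'a::euclidean_space. exp (- (c * (1 - exp (- (h * (norm \<xi>)\<^sup>2))) powr \<gamma>)))"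
proof -
  let ?b = "\<lambda>k. (-1) ^ k * (\<gamma> gchoose Suc k)"
  let ?z = "\<lambda>\<xi>::'a. exp (- (h * (norm \<xi>)\<^sup>2))"
  define q where "q N \<xi> = (\<Sum>k<N. ?b k * ?z \<xi> ^ Suc k)" for N and \<xi> :: 'a
  have q_meas [measurable]: "q N \<in> borel_measurable borel" for N
    unfolding q_def[abs_def] by measurable
  have b: "0 \<le> ?b k" for k using gbinomial_sign[OF \<gamma>] .
  have z: "0 < ?z \<xi>" "?z \<xi> < 1" if "\<xi> \<noteq> 0" for \<xi> using that h by auto
  have sums: "(\<lambda>k. ?b k * ?z \<xi> ^ Suc k) sums (1 - (1 - ?z \<xi>) powr \<gamma>)" if "\<xi> \<noteq> 0" for \<xi>
    using z[OF that] by (intro one_minus_powr_sums) auto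
  have q_lim: "(\<lambda>N. q N \<xi>) \<longlonglongrightarrow> 1 - (1 - ?z \<xi>) powr \<gamma>" if "\<xi> \<noteq> 0" for \<xi>
    using sums[OF that] unfolding sums_def q_def .
  have q0: "0 \<le> q N \<xi>" for N \<xi>
    unfolding q_def by (intro sum_nonneg mult_nonneg_nonneg[OF b]) auto
  \<comment> \<open>All terms are nonnegative, so the truncation lies below the full sum, which is
    at most 1. This provides the uniform bounds exp c and 1 for the two limits.\<close>
  have q1: "q N \<xi> \<le> 1" if "\<xi> \<noteq> 0" for N \<xi>
  proof -
    have "q N \<xi> \<le> suminf (\<lambda>k. ?b k * ?z \<xi> ^ Suc k)"
      unfolding q_def using sums[OF that]
      by (intro sum_le_suminf ballI mult_nonneg_nonneg[OF b]) (auto simp: sums_iff)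
    also have "\<dots> = 1 - (1 - ?z \<xi>) powr \<gamma>" using sums[OF that] by (simp add: sums_iff)
    also have "\<dots> \<le> 1" by simp
    finally show ?thesis .
  qed
  \<comment> \<open>Each power of z is again a Gaussian, with parameter (k + 1) h, so
    \<open>q N\<close> acts by Gaussian factors.\<close>
  have mult: "pos_fourier (\<lambda>\<xi>. F \<xi> * q N \<xi>)" if F: "pos_fourier F" for F N
  proof -
    have "pos_fourier (\<lambda>\<xi>. \<Sum>k<N. ?b k * (F \<xi> * exp (- ((real (Suc k) * h) * (norm \<xi>)\<^sup>2))))"
      using h b by (intro pos_fourier_sum pos_fourier_cmult pos_fourier_mult_gaussian F) auto
    also have "(\<lambda>\<xi>. \<Sum>k<N. ?b k * (F \<xi> * exp (- ((real (Suc k) * h) * (norm \<xi>)\<^sup>2)))) = (\<lambda>\<xi>. F \<xi> * q N \<xi>)"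
    proof
      fix \<xi> :: 'a
      have "exp (- ((real (Suc k) * h) * (norm \<xi>)\<^sup>2)) = ?z \<xi> ^ Suc k" for k
        using exp_of_nat_mult[of "Suc k" "- (h * (norm \<xi>)\<^sup>2)"] by (simp add: mult.assoc del: of_nat_Suc power_Suc)
      then show "(\<Sum>k<N. ?b k * (F \<xi> * exp (- ((real (Suc k) * h) * (norm \<xi>)\<^sup>2)))) = F \<xi> * q N \<xi>"
        unfolding q_def by (simp only: sum_distrib_left mult_ac)
    qed
    finally show ?thesis .
  qed
  have pow: "pos_fourier (\<lambda>\<xi>. q N \<xi> ^ m)" for N m
    by (induction m) (use mult pos_fourier_one in \<open>auto simp: power_Suc2 simp del: power_Suc\<close>)
  have expq: "pos_fourier (\<lambda>\<xi>. exp (c * q N \<xi>))" for N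
  proof (rule pos_fourier_lim[where B = "exp c"])
    fix M
    show "pos_fourier (\<lambda>\<xi>. \<Sum>m<M. (c ^ m / fact m) * q N \<xi> ^ m)"
      using c by (intro pos_fourier_sum pos_fourier_cmult pow) auto
  next
    fix \<xi> :: 'a
    have s: "(\<lambda>m. (c ^ m / fact m) * q N \<xi> ^ m) sums exp (c * q N \<xi>)"
      using exp_converges[of "c * q N \<xi>"] by (simp add: power_mult_distrib field_simps)
    then show "(\<lambda>M. \<Sum>m<M. (c ^ m / fact m) * q N \<xi> ^ m) \<longlonglongrightarrow> exp (c * q N \<xi>)"
      by (simp add: sums_def)
    assume \<xi>: "\<xi> \<noteq> 0"
    fix M
    have "(\<Sum>m<M. (c ^ m / fact m) * q N \<xi> ^ m) \<le> suminf (\<lambda>m. (c ^ m / fact m) * q N \<xi> ^ m)"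
      using s c q0 by (intro sum_le_suminf) (auto simp: sums_iff)
    also have "\<dots> = exp (c * q N \<xi>)" using s by (simp add: sums_iff)
    also have "\<dots> \<le> exp c" using q1[OF \<xi>, of N] c by (simp add: mult_left_le)
    finally show "\<bar>\<Sum>m<M. (c ^ m / fact m) * q N \<xi> ^ m\<bar> \<le> exp c"
      using c q0 by (subst abs_of_nonneg) (auto intro!: sum_nonneg)
  qed measurable
  show ?thesis
  proof (rule pos_fourier_lim[where B = 1])
    fix N
    show "pos_fourier (\<lambda>\<xi>. exp (- c) * exp (c * q N \<xi>))"
      by (intro pos_fourier_cmult expq) simp
  next
    fix \<xi> :: 'a assume \<xi>: "\<xi> \<noteq> 0"
    have "(\<lambda>N. exp (- c) * exp (c * q N \<xi>)) \<longlonglongrightarrow> exp (- c) * exp (c * (1 - (1 - ?z \<xi>) powr \<gamma>))"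
      by (intro tendsto_intros q_lim \<xi>)
    then show "(\<lambda>N. exp (- c) * exp (c * q N \<xi>)) \<longlonglongrightarrow> exp (- (c * (1 - ?z \<xi>) powr \<gamma>))"
      by (simp add: exp_add[symmetric] algebra_simps)
    fix N
    have "c * q N \<xi> \<le> c" using q1[OF \<xi>] c by (simp add: mult_left_le)
    then show "\<bar>exp (- c) * exp (c * q N \<xi>)\<bar> \<le> 1"
      by (simp add: exp_add[symmetric])
  qed measurable
qed

text \<open>Take \<gamma> = \<beta> / 2, h = 1 / (k + 1) and c = t h^(- \<gamma>) in the
  subordinated family. Then c (1 - exp (- h |\<xi>|^2))^\<gamma> is t times the \<gamma>-th power of
  a difference quotient tending to |\<xi>|^2. The condition \<beta> \<le> 2 is exactly \<gamma>
  \<le> 1.\<close>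

lemma pos_fourier_exp_powr:
  assumes \<beta>: "0 < \<beta>" "\<beta> \<le> 2" and t: "0 < t"
  shows "pos_fourier (\<lambda>\<xi>::'a::euclidean_space. exp (- (t * norm \<xi> powr \<beta>)))"
proof (rule pos_fourier_lim[where B = 1])
  let ?h = "\<lambda>k. inverse (real (Suc k))"
  fix k
  show "pos_fourier (\<lambda>\<xi>::'a. exp (- ((t * ?h k powr (- (\<beta>/2))) * (1 - exp (- (?h k * (norm \<xi>)\<^sup>2))) powr (\<beta>/2))))"
    using \<beta> t by (intro pos_fourier_exp_subordinated) auto
next
  let ?h = "\<lambda>k. inverse (real (Suc k))"
  fix \<xi> :: 'a assume \<xi>: "\<xi> \<noteq> 0"
  show "\<bar>exp (- ((t * ?h k powr (- (\<beta>/2))) * (1 - exp (- (?h k * (norm \<xi>)\<^sup>2))) powr (\<beta>/2)))\<bar> \<le> 1" for k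
    using t by (auto intro!: mult_nonneg_nonneg)
  let ?l = "(norm \<xi>)\<^sup>2"
  have powr_div: "(a / b) powr g = b powr (- g) * a powr g" if "0 \<le> a" "0 < b" for a b g :: real
    using that by (simp add: powr_divide powr_minus_divide)
  have "((\<lambda>h. (1 - exp (- (h * ?l))) / h) \<longlongrightarrow> ?l) (at_right 0)"
    using \<xi> by real_asymp
  then have "(\<lambda>k. (1 - exp (- (?h k * ?l))) / ?h k) \<longlonglongrightarrow> ?l"
    by (rule filterlim_compose)
       (use LIMSEQ_inverse_real_of_nat in \<open>auto simp: filterlim_at simp del: of_nat_Suc\<close>)
  then have "(\<lambda>k. exp (- (t * ((1 - exp (- (?h k * ?l))) / ?h k) powr (\<beta>/2)))) \<longlonglongrightarrow> exp (- (t * ?l powr (\<beta>/2)))"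
    using \<xi> by (intro tendsto_intros) auto
  moreover have "t * ((1 - exp (- (?h k * ?l))) / ?h k) powr (\<beta>/2) = (t * ?h k powr (- (\<beta>/2))) * (1 - exp (- (?h k * ?l))) powr (\<beta>/2)" for k
    by (subst powr_div) (simp_all only: mult.assoc inverse_positive_iff_positive of_nat_0_less_iff zero_less_Suc
        diff_ge_0_iff_ge exp_le_one_iff neg_le_0_iff_le mult_nonneg_nonneg zero_le_power2 less_imp_le)
  moreover have "?l powr (\<beta>/2) = norm \<xi> powr \<beta>"
    by (subst powr_numeral[symmetric]) (auto simp only: powr_powr norm_ge_zero, simp)
  ultimately show "(\<lambda>k. exp (- ((t * ?h k powr (- (\<beta>/2))) * (1 - exp (- (?h k * ?l))) powr (\<beta>/2)))) \<longlonglongrightarrow> exp (- (t * norm \<xi> powr \<beta>))"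
    by (simp only:)
qed measurable

section \<open>The fractional heat kernel\<close>

lemma S_kernel_eq:
  fixes x :: "real^'n"
  assumes "0 < \<beta>" "0 < t"
  shows "S_kernel \<beta> x t = (\<integral>\<xi>. cos (x \<bullet> \<xi>) * exp (- (t * norm \<xi> powr \<beta>)) \<partial>lborel) / (2 * pi) ^ CARD('n)"
proof -
  let ?f = "\<lambda>\<xi>::real^'n. exp (\<i> * complex_of_real (x \<bullet> \<xi>) - complex_of_real (t * norm \<xi> powr \<beta>))"
  have int: "integrable lborel ?f"
    by (rule Bochner_Integration.integrable_bound[OF integrable_exp_powr_norm[OF assms(2,1)]]) auto
  have "Re (\<integral>\<xi>. ?f \<xi> \<partial>lborel) = (\<integral>\<xi>. Re (?f \<xi>) \<partial>lborel)"
    by (rule integral_Re[OF int, symmetric])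
  also have "\<dots> = (\<integral>\<xi>. cos (x \<bullet> \<xi>) * exp (- (t * norm \<xi> powr \<beta>)) \<partial>lborel)"
    by (simp add: Re_exp mult.commute)
  finally show ?thesis
    unfolding S_kernel_def by simp
qed

lemma S_kernel_measurable [measurable (raw)]:
  fixes f :: "'b \<Rightarrow> real^'n"
  assumes [measurable]: "f \<in> borel_measurable M" "g \<in> borel_measurable M"
  shows "(\<lambda>x. S_kernel \<beta> (f x) (g x)) \<in> borel_measurable M"
  unfolding S_kernel_def by measurable

lemma integrable_cos_exp_powr:
  fixes x :: "'a::euclidean_space"
  assumes "0 < \<beta>" "0 < t"
  shows "integrable lborel (\<lambda>\<xi>. cos (x \<bullet> \<xi>) * exp (- (t * norm \<xi> powr \<beta>)))"
  by (rule Bochner_Integration.integrable_bound[OF integrable_exp_powr_norm[OF assms(2,1)]])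
     (auto simp: abs_mult mult_left_le_one_le)

lemma S_kernel_minus: "S_kernel \<beta> (- x) t = S_kernel \<beta> x t" if "0 < \<beta>" "0 < t"
  using that by (simp add: S_kernel_eq)

text \<open>The Gaussian cut-off of \<open>pos_fourier\<close> can be removed here, since exp (- t
  |\<xi>|^\<beta>) is itself integrable and dominates.\<close>

lemma S_kernel_nonneg:
  fixes x :: "real^'n"
  assumes \<beta>: "0 < \<beta>" "\<beta> \<le> 2" and t: "0 < t"
  shows "0 \<le> S_kernel \<beta> x t"
proof -
  let ?e = "\<lambda>k. inverse (real (Suc k))"
  let ?\<phi> = "\<lambda>\<xi>::real^'n. exp (- (t * norm \<xi> powr \<beta>))"
  have lim: "(\<lambda>k. \<integral>\<xi>. cos (x \<bullet> \<xi>) * ?\<phi> \<xi> * exp (- (?e k * (norm \<xi>)\<^sup>2)) \<partial>lborel)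
      \<longlonglongrightarrow> (\<integral>\<xi>. cos (x \<bullet> \<xi>) * ?\<phi> \<xi> \<partial>lborel)"
  proof (rule integral_dominated_convergence[where w = ?\<phi>])
    show "AE \<xi> in lborel. (\<lambda>k. cos (x \<bullet> \<xi>) * ?\<phi> \<xi> * exp (- (?e k * (norm \<xi>)\<^sup>2))) \<longlonglongrightarrow> cos (x \<bullet> \<xi>) * ?\<phi> \<xi>"
    proof (rule AE_I2)
      fix \<xi> :: "real^'n"
      have "(\<lambda>k. cos (x \<bullet> \<xi>) * ?\<phi> \<xi> * exp (- (?e k * (norm \<xi>)\<^sup>2))) \<longlonglongrightarrow> cos (x \<bullet> \<xi>) * ?\<phi> \<xi> * exp (- (0 * (norm \<xi>)\<^sup>2))"
        by (intro tendsto_intros LIMSEQ_inverse_real_of_nat)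
      then show "(\<lambda>k. cos (x \<bullet> \<xi>) * ?\<phi> \<xi> * exp (- (?e k * (norm \<xi>)\<^sup>2))) \<longlonglongrightarrow> cos (x \<bullet> \<xi>) * ?\<phi> \<xi>"
        by (simp del: of_nat_Suc)
    qed
    fix k
    have "\<bar>cos (x \<bullet> \<xi>)\<bar> * ?\<phi> \<xi> * exp (- (?e k * (norm \<xi>)\<^sup>2)) \<le> 1 * ?\<phi> \<xi> * 1" for \<xi>
      by (intro mult_mono) (auto simp del: of_nat_Suc)
    then show "AE \<xi> in lborel. norm (cos (x \<bullet> \<xi>) * ?\<phi> \<xi> * exp (- (?e k * (norm \<xi>)\<^sup>2))) \<le> ?\<phi> \<xi>"
      by (simp add: abs_mult del: of_nat_Suc)
  qed (use \<beta> t in \<open>auto intro: integrable_exp_powr_norm\<close>)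
  have "0 \<le> (\<integral>\<xi>. cos (x \<bullet> \<xi>) * ?\<phi> \<xi> * exp (- (?e k * (norm \<xi>)\<^sup>2)) \<partial>lborel)" for k
    by (rule pos_fourierD(2)[OF pos_fourier_exp_powr[OF \<beta> t]]) simp
  then have "0 \<le> (\<integral>\<xi>. cos (x \<bullet> \<xi>) * ?\<phi> \<xi> \<partial>lborel)"
    by (intro LIMSEQ_le_const[OF lim]) blast
  then show ?thesis using \<beta> t by (simp add: S_kernel_eq)
qed

lemma integrable_product:
  fixes f :: "'a::euclidean_space \<Rightarrow> real" and g :: "'b::euclidean_space \<Rightarrow> real"
  assumes f: "integrable lborel f" and g: "integrable lborel g"
  shows "integrable (lborel \<Otimes>\<^sub>M lborel) (\<lambda>(x, y). f x * g y)"
proof (rule lborel_pair.Fubini_integrable)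
  have [measurable]: "f \<in> borel_measurable borel" "g \<in> borel_measurable borel" using f g by auto
  show "(\<lambda>(x, y). f x * g y) \<in> borel_measurable (lborel \<Otimes>\<^sub>M lborel)" by measurable
  show "integrable lborel (\<lambda>x. \<integral>y. norm (case (x, y) of (x, y) \<Rightarrow> f x * g y) \<partial>lborel)"
    using f by (simp add: abs_mult)
  show "AE x in lborel. integrable lborel (\<lambda>y. case (x, y) of (x, y) \<Rightarrow> f x * g y)"
    using g by simp
qed

text \<open>A product of cosines is half the sum of the cosines at a - b and a + b. The formula
  evaluates the inner integral after Fubini in the regularised Fourier inversion.\<close>

lemma gaussian_fourier_product:
  fixes a b :: "'a::euclidean_space"
  assumes e: "0 < \<epsilon>"
  shows "(\<integral>x. cos (x \<bullet> a) * cos (x \<bullet> b) * exp (- (\<epsilon> * (norm x)\<^sup>2)) \<partial>lborel)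
    = sqrt (pi / \<epsilon>) ^ DIM('a) * ((exp (- (norm (a - b))\<^sup>2 / (4 * \<epsilon>)) + exp (- (norm (a + b))\<^sup>2 / (4 * \<epsilon>))) / 2)"
proof -
  have int: "integrable lborel (\<lambda>x. cos (c \<bullet> x) * exp (- (\<epsilon> * (norm x)\<^sup>2)))" for c :: 'a
    using pos_fourier_integrable[OF pos_fourier_one e] by simp
  have "(\<integral>x. cos (x \<bullet> a) * cos (x \<bullet> b) * exp (- (\<epsilon> * (norm x)\<^sup>2)) \<partial>lborel)
    = (\<integral>x. (cos ((a - b) \<bullet> x) * exp (- (\<epsilon> * (norm x)\<^sup>2)) + cos ((a + b) \<bullet> x) * exp (- (\<epsilon> * (norm x)\<^sup>2))) / 2 \<partial>lborel)"
    by (intro Bochner_Integration.integral_cong)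
       (auto simp: inner_diff_left inner_diff_right inner_add_left inner_add_right cos_diff cos_add inner_commute field_simps)
  also have "\<dots> = (sqrt (pi / \<epsilon>) ^ DIM('a) * exp (- (norm (a - b))\<^sup>2 / (4 * \<epsilon>))
      + sqrt (pi / \<epsilon>) ^ DIM('a) * exp (- (norm (a + b))\<^sup>2 / (4 * \<epsilon>))) / 2"
    using int by (simp add: gaussian_fourier[OF e])
  finally show ?thesis by (simp add: field_simps)
qed

text \<open>An approximate identity in rescaled variables: the shrinking width sits in
  \<open>c k\<close> inside F, so that one fixed Gaussian dominates.\<close>

lemma gaussian_average_tendsto:
  fixes F :: "'a::euclidean_space \<Rightarrow> real"
  assumes cont: "continuous_on UNIV F" and B: "\<And>\<xi>. \<bar>F \<xi>\<bar> \<le> B" and c: "c \<longlonglongrightarrow> 0"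
  shows "(\<lambda>k. \<integral>w. F (\<eta> + c k *\<^sub>R w) * exp (- (norm w)\<^sup>2) \<partial>lborel) \<longlonglongrightarrow> F \<eta> * sqrt pi ^ DIM('a)"
proof -
  have [measurable]: "F \<in> borel_measurable borel" using cont by (rule borel_measurable_continuous_onI)
  have "(\<lambda>k. \<integral>w. F (\<eta> + c k *\<^sub>R w) * exp (- (norm w)\<^sup>2) \<partial>lborel) \<longlonglongrightarrow> (\<integral>(w::'a). F \<eta> * exp (- (norm w)\<^sup>2) \<partial>lborel)"
  proof (rule integral_dominated_convergence[where w = "\<lambda>w::'a. B * exp (- (norm w)\<^sup>2)"])
    show "integrable lborel (\<lambda>w::'a. B * exp (- (norm w)\<^sup>2))"
      using integrable_mult_right[OF integrable_gaussian[of 1], of B] by simp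
    show "AE w in lborel. (\<lambda>k. F (\<eta> + c k *\<^sub>R w) * exp (- (norm w)\<^sup>2)) \<longlonglongrightarrow> F \<eta> * exp (- (norm w)\<^sup>2)"
    proof (rule AE_I2)
      fix w :: 'a
      have "(\<lambda>k. \<eta> + c k *\<^sub>R w) \<longlonglongrightarrow> \<eta> + 0 *\<^sub>R w" by (intro tendsto_intros c)
      then have "(\<lambda>k. \<eta> + c k *\<^sub>R w) \<longlonglongrightarrow> \<eta>" by simp
      then have "(\<lambda>k. F (\<eta> + c k *\<^sub>R w)) \<longlonglongrightarrow> F \<eta>"
        using cont by (intro isCont_tendsto_compose[of \<eta> F]) (simp_all add: continuous_on_eq_continuous_at)
      then show "(\<lambda>k. F (\<eta> + c k *\<^sub>R w) * exp (- (norm w)\<^sup>2)) \<longlonglongrightarrow> F \<eta> * exp (- (norm w)\<^sup>2)"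
        by (intro tendsto_intros)
    qed
    show "AE w in lborel. norm (F (\<eta> + c k *\<^sub>R w) * exp (- (norm w)\<^sup>2)) \<le> B * exp (- (norm w)\<^sup>2)" for k
      using B by (auto simp: abs_mult intro!: mult_right_mono)
  qed measurable
  moreover have "(\<integral>(w::'a). exp (- (norm w)\<^sup>2) \<partial>lborel) = sqrt pi ^ DIM('a)"
    using gaussian_fourier[of 1 "0::'a"] by simp
  ultimately show ?thesis by simp
qed

lemma continuous_exp_powr:
  assumes "0 < \<beta>" "0 < t"
  shows "continuous_on UNIV (\<lambda>\<xi>::'a::euclidean_space. exp (- (t * norm \<xi> powr \<beta>)))"
  using assms by (intro continuous_intros continuous_on_powr') auto

text \<open>Integrability of the kernel is part of the claim, so Fourier inversion starts from a
  Gaussian cut-off in x. It makes Fubini available and turns the integral into averages of exp (- t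
  |.|^\<beta>) around \<eta> and - \<eta>. At \<eta> = 0 the limit is finite, and nonnegativity with
  monotone convergence yields integrability; dominated convergence then gives all cosine
  integrals.\<close>

lemma S_kernel_fourier:
  fixes \<eta> :: "real^'n"
  assumes \<beta>: "0 < \<beta>" "\<beta> \<le> 2" and t: "0 < t"
  shows S_kernel_integrable: "integrable lborel (\<lambda>x::real^'n. S_kernel \<beta> x t)"
    and S_kernel_cos_integral: "(\<integral>x. S_kernel \<beta> x t * cos (x \<bullet> \<eta>) \<partial>lborel) = exp (- (t * norm \<eta> powr \<beta>))"
    and S_kernel_integral: "(\<integral>(x::real^'n). S_kernel \<beta> x t \<partial>lborel) = 1"
proof -
  let ?\<phi> = "\<lambda>\<xi>::real^'n. exp (- (t * norm \<xi> powr \<beta>))"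
  let ?n = "CARD('n)"
  let ?e = "\<lambda>k. inverse (real (Suc k))"
  let ?G = "\<lambda>\<epsilon> x::real^'n. exp (- (\<epsilon> * (norm x)\<^sup>2))"
  \<comment> \<open>The Gaussian average of the symbol around \<eta> at scale 2 sqrt \<epsilon>; it
    tends to the symbol at \<eta> times sqrt pi ^ n.\<close>
  define A where "A \<epsilon> \<eta> = (\<integral>(w::real^'n). ?\<phi> (\<eta> + (2 * sqrt \<epsilon>) *\<^sub>R w) * exp (- (norm w)\<^sup>2) \<partial>lborel)" for \<epsilon> \<eta>
  have \<phi>_int: "integrable lborel ?\<phi>" by (rule integrable_exp_powr_norm[OF t \<beta>(1)])
  \<comment> \<open>Only cosines occur, so both frequencies \<eta> and - \<eta> appear; the symbol
    is even, and the two halves agree in the limit.\<close>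
  have reg: "(\<integral>x. S_kernel \<beta> x t * cos (x \<bullet> \<eta>) * ?G \<epsilon> x \<partial>lborel) = (A \<epsilon> \<eta> + A \<epsilon> (- \<eta>)) / 2 / sqrt pi ^ ?n"
    if e: "0 < \<epsilon>" for \<epsilon> and \<eta> :: "real^'n"
  proof -
    let ?h = "\<lambda>x \<xi>. cos (x \<bullet> \<eta>) * ?G \<epsilon> x * (cos (x \<bullet> \<xi>) * ?\<phi> \<xi>)"
    have shift: "(\<integral>\<xi>. ?\<phi> \<xi> * exp (- (norm (\<xi> - \<zeta>))\<^sup>2 / (4 * \<epsilon>)) \<partial>lborel) = (2 * sqrt \<epsilon>) ^ ?n * A \<epsilon> \<zeta>" for \<zeta> :: "real^'n"
    proof -
      have "exp (- (norm ((\<zeta> + (2 * sqrt \<epsilon>) *\<^sub>R w) - \<zeta>))\<^sup>2 / (4 * \<epsilon>)) = exp (- (norm w)\<^sup>2)" for w :: "real^'n"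
        using e by (simp add: power_mult_distrib)
      then show ?thesis
        unfolding A_def using e by (subst integral_affine[where c = "2 * sqrt \<epsilon>" and t = \<zeta>]) simp_all
    qed
    have shift_int: "integrable lborel (\<lambda>\<xi>. ?\<phi> \<xi> * exp (- (norm (\<xi> - \<zeta>))\<^sup>2 / (4 * \<epsilon>)))" for \<zeta> :: "real^'n"
      by (rule Bochner_Integration.integrable_bound[OF \<phi>_int]) (use e in \<open>auto simp: mult_left_le\<close>)
    have pair: "integrable (lborel \<Otimes>\<^sub>M lborel) (\<lambda>(x, \<xi>). ?h x \<xi>)"
    proof (rule Bochner_Integration.integrable_bound[OF integrable_product[OF integrable_gaussian[OF e] \<phi>_int]])
      have "\<bar>cos (x \<bullet> \<eta>)\<bar> * ?G \<epsilon> x * (\<bar>cos (x \<bullet> \<xi>)\<bar> * ?\<phi> \<xi>) \<le> 1 * ?G \<epsilon> x * (1 * ?\<phi> \<xi>)" for x \<xi>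
        by (intro mult_mono) auto
      then show "AE z in lborel \<Otimes>\<^sub>M lborel. norm (case z of (x, \<xi>) \<Rightarrow> ?h x \<xi>) \<le> norm (case z of (x, \<xi>) \<Rightarrow> ?G \<epsilon> x * ?\<phi> \<xi>)"
        by (auto simp: abs_mult)
    qed measurable
    have "(\<integral>x. S_kernel \<beta> x t * cos (x \<bullet> \<eta>) * ?G \<epsilon> x \<partial>lborel) = (\<integral>x. (\<integral>\<xi>. ?h x \<xi> \<partial>lborel) \<partial>lborel) / (2 * pi) ^ ?n"
    proof -
      have "S_kernel \<beta> x t * cos (x \<bullet> \<eta>) * ?G \<epsilon> x = (\<integral>\<xi>. ?h x \<xi> \<partial>lborel) / (2 * pi) ^ ?n" for x
        unfolding S_kernel_eq[OF \<beta>(1) t] integral_mult_right_zero by (simp add: mult_ac)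
      then show ?thesis by simp
    qed
    also have "(\<integral>x. (\<integral>\<xi>. ?h x \<xi> \<partial>lborel) \<partial>lborel) = (\<integral>\<xi>. (\<integral>x. ?h x \<xi> \<partial>lborel) \<partial>lborel)"
      by (rule lborel_pair.Fubini_integral[OF pair, symmetric])
    also have "\<dots> = (\<integral>\<xi>. sqrt (pi / \<epsilon>) ^ ?n / 2 * (?\<phi> \<xi> * exp (- (norm (\<xi> - \<eta>))\<^sup>2 / (4 * \<epsilon>)) + ?\<phi> \<xi> * exp (- (norm (\<xi> - (- \<eta>)))\<^sup>2 / (4 * \<epsilon>))) \<partial>lborel)"
    proof (intro Bochner_Integration.integral_cong refl)
      fix \<xi> :: "real^'n"
      have "(\<integral>x. ?h x \<xi> \<partial>lborel) = (\<integral>x. cos (x \<bullet> \<xi>) * cos (x \<bullet> \<eta>) * ?G \<epsilon> x \<partial>lborel) * ?\<phi> \<xi>"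
        by (subst integral_mult_left_zero[symmetric]) (simp add: mult_ac)
      then show "(\<integral>x. ?h x \<xi> \<partial>lborel) = sqrt (pi / \<epsilon>) ^ ?n / 2 * (?\<phi> \<xi> * exp (- (norm (\<xi> - \<eta>))\<^sup>2 / (4 * \<epsilon>)) + ?\<phi> \<xi> * exp (- (norm (\<xi> - (- \<eta>)))\<^sup>2 / (4 * \<epsilon>)))"
        by (simp only: gaussian_fourier_product[OF e] diff_minus_eq_add) (simp add: algebra_simps)
    qed
    also have "\<dots> = sqrt (pi / \<epsilon>) ^ ?n / 2 * ((2 * sqrt \<epsilon>) ^ ?n * A \<epsilon> \<eta> + (2 * sqrt \<epsilon>) ^ ?n * A \<epsilon> (- \<eta>))"
      by (subst integral_mult_right_zero, subst Bochner_Integration.integral_add[OF shift_int shift_int]) (simp only: shift)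
    also have "\<dots> / (2 * pi) ^ ?n = (sqrt (pi / \<epsilon>) * (2 * sqrt \<epsilon>) / (2 * pi)) ^ ?n * ((A \<epsilon> \<eta> + A \<epsilon> (- \<eta>)) / 2)"
      by (simp add: power_mult_distrib power_divide algebra_simps add_divide_distrib)
    also have "sqrt (pi / \<epsilon>) * (2 * sqrt \<epsilon>) / (2 * pi) = 1 / sqrt pi"
      using e by (simp add: real_sqrt_divide field_simps)
    finally show ?thesis by (simp add: power_divide)
  qed
  have A_lim: "(\<lambda>k. A (?e k) \<zeta>) \<longlonglongrightarrow> ?\<phi> \<zeta> * sqrt pi ^ ?n" for \<zeta> :: "real^'n"
  proof -
    have "(\<lambda>k. 2 * sqrt (?e k)) \<longlonglongrightarrow> 2 * sqrt 0"
      by (intro tendsto_intros LIMSEQ_inverse_real_of_nat)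
    then have "(\<lambda>k. 2 * sqrt (?e k)) \<longlonglongrightarrow> 0" by simp
    from gaussian_average_tendsto[OF continuous_exp_powr[OF \<beta>(1) t] _ this, of 1 \<zeta>] t
    show ?thesis unfolding A_def by simp
  qed
  have reg_lim: "(\<lambda>k. \<integral>x. S_kernel \<beta> x t * cos (x \<bullet> \<eta>) * ?G (?e k) x \<partial>lborel) \<longlonglongrightarrow> ?\<phi> \<eta>" for \<eta> :: "real^'n"
  proof -
    have "(\<lambda>k. (A (?e k) \<eta> + A (?e k) (- \<eta>)) / 2 / sqrt pi ^ ?n) \<longlonglongrightarrow> (?\<phi> \<eta> * sqrt pi ^ ?n + ?\<phi> (- \<eta>) * sqrt pi ^ ?n) / 2 / sqrt pi ^ ?n"
      by (intro tendsto_intros A_lim) auto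
    moreover have "(?\<phi> \<eta> * sqrt pi ^ ?n + ?\<phi> (- \<eta>) * sqrt pi ^ ?n) / 2 / sqrt pi ^ ?n = ?\<phi> \<eta>"
      by simp
    moreover have "(\<integral>x. S_kernel \<beta> x t * cos (x \<bullet> \<eta>) * ?G (?e k) x \<partial>lborel) = (A (?e k) \<eta> + A (?e k) (- \<eta>)) / 2 / sqrt pi ^ ?n" for k
      by (rule reg) simp
    ultimately show ?thesis by (simp only:)
  qed
  \<comment> \<open>Boundedness makes the kernel times a Gaussian integrable before integrability of
    the kernel itself is known.\<close>
  have bdd: "\<bar>S_kernel \<beta> x t\<bar> \<le> (\<integral>\<xi>. ?\<phi> \<xi> \<partial>lborel) / (2 * pi) ^ ?n" for x :: "real^'n"
  proof -
    have "\<bar>\<integral>\<xi>. cos (x \<bullet> \<xi>) * ?\<phi> \<xi> \<partial>lborel\<bar> \<le> (\<integral>\<xi>. \<bar>cos (x \<bullet> \<xi>) * ?\<phi> \<xi>\<bar> \<partial>lborel)"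
      by (rule integral_abs_bound)
    also have "\<dots> \<le> (\<integral>\<xi>. ?\<phi> \<xi> \<partial>lborel)"
      by (intro integral_mono integrable_abs integrable_cos_exp_powr \<phi>_int \<beta> t) (auto simp: abs_mult mult_left_le_one_le)
    finally show ?thesis
      using \<beta> t by (simp add: S_kernel_eq divide_right_mono)
  qed
  have nonneg: "0 \<le> S_kernel \<beta> x t" for x :: "real^'n" using S_kernel_nonneg[OF \<beta> t] .
  have reg_int: "integrable lborel (\<lambda>x. S_kernel \<beta> x t * ?G (?e k) x)" for k
  proof -
    have "integrable lborel (\<lambda>x. cos (0 \<bullet> x) * S_kernel \<beta> x t * ?G (?e k) x)"
      using bdd by (intro integrable_mult_gaussian) auto
    then show ?thesis by simp
  qed
  have G_lim: "(\<lambda>k. a * ?G (?e k) x) \<longlonglongrightarrow> a" for a and x :: "real^'n"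
  proof -
    have "(\<lambda>k. a * ?G (?e k) x) \<longlonglongrightarrow> a * exp (- (0 * (norm x)\<^sup>2))"
      by (intro tendsto_intros LIMSEQ_inverse_real_of_nat)
    then show ?thesis by simp
  qed
  have lim0: "(\<lambda>k. \<integral>x. S_kernel \<beta> x t * ?G (?e k) x \<partial>lborel) \<longlonglongrightarrow> 1"
    using reg_lim[of 0] \<beta> by (simp del: of_nat_Suc)
  \<comment> \<open>The cut-off parameter decreases in k, so for a nonnegative kernel the
    regularised integrands increase.\<close>
  have mono: "AE x in lborel. mono (\<lambda>k. S_kernel \<beta> x t * ?G (?e k) x)"
  proof (rule AE_I2, rule monoI)
    fix x :: "real^'n" and k m :: nat assume "k \<le> m"
    then have "?e m * (norm x)\<^sup>2 \<le> ?e k * (norm x)\<^sup>2"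
      by (intro mult_right_mono le_imp_inverse_le) auto
    then show "S_kernel \<beta> x t * ?G (?e k) x \<le> S_kernel \<beta> x t * ?G (?e m) x"
      using nonneg by (intro mult_left_mono) auto
  qed
  show int: "integrable lborel (\<lambda>x::real^'n. S_kernel \<beta> x t)"
    by (rule integrable_monotone_convergence[OF reg_int mono AE_I2[OF G_lim] lim0]) measurable
  show cosint: "(\<integral>x. S_kernel \<beta> x t * cos (x \<bullet> \<eta>) \<partial>lborel) = ?\<phi> \<eta>" for \<eta> :: "real^'n"
  proof (rule LIMSEQ_unique[OF _ reg_lim])
    show "(\<lambda>k. \<integral>x. S_kernel \<beta> x t * cos (x \<bullet> \<eta>) * ?G (?e k) x \<partial>lborel) \<longlonglongrightarrow> (\<integral>x. S_kernel \<beta> x t * cos (x \<bullet> \<eta>) \<partial>lborel)"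
    proof (rule integral_dominated_convergence[OF _ _ int AE_I2[OF G_lim]])
      fix k
      have "\<bar>S_kernel \<beta> x t\<bar> * \<bar>cos (x \<bullet> \<eta>)\<bar> * ?G (?e k) x \<le> S_kernel \<beta> x t * 1 * 1" for x
        using nonneg by (intro mult_mono) (auto simp del: of_nat_Suc)
      then show "AE x in lborel. norm (S_kernel \<beta> x t * cos (x \<bullet> \<eta>) * ?G (?e k) x) \<le> S_kernel \<beta> x t"
        by (simp add: abs_mult del: of_nat_Suc)
    qed measurable
  qed
  show "(\<integral>(x::real^'n). S_kernel \<beta> x t \<partial>lborel) = 1" using cosint[of 0] \<beta> by simp
qed

lemma S_kernel_sin_integral:
  fixes \<eta> :: "real^'n"
  assumes \<beta>: "0 < \<beta>" and t: "0 < t"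
  shows "(\<integral>x. S_kernel \<beta> x t * sin (x \<bullet> \<eta>) \<partial>lborel) = 0"
proof -
  let ?f = "\<lambda>x. S_kernel \<beta> x t * sin (x \<bullet> \<eta>)"
  have "(\<integral>x. ?f x \<partial>lborel) = (\<integral>x. ?f (0 - x) \<partial>lborel)"
    by (rule integral_reflect[symmetric]) measurable
  also have "\<dots> = - (\<integral>x. ?f x \<partial>lborel)"
    using assms by (simp add: S_kernel_minus)
  finally show ?thesis by simp
qed

text \<open>Only one factor is replaced by its Fourier integral. Fubini and the addition theorem of
  the cosine leave the cosine and sine integrals of the other kernel: the sine integral vanishes and
  the cosine integral contributes exp (- s |\<xi>|^\<beta>).\<close>

lemma S_kernel_convolution:
  fixes x :: "real^'n"
  assumes \<beta>: "0 < \<beta>" "\<beta> \<le> 2" and s: "0 < s" and t: "0 < t"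
  shows "(\<integral>y. S_kernel \<beta> (x - y) t * S_kernel \<beta> y s \<partial>lborel) = S_kernel \<beta> x (t + s)"
proof -
  let ?\<phi> = "\<lambda>t \<xi>::real^'n. exp (- (t * norm \<xi> powr \<beta>))"
  let ?h = "\<lambda>y \<xi>. S_kernel \<beta> y s * (cos ((x - y) \<bullet> \<xi>) * ?\<phi> t \<xi>)"
  have K_int: "integrable lborel (\<lambda>y::real^'n. S_kernel \<beta> y s)"
    by (rule S_kernel_integrable[OF \<beta> s])
  have trig_int: "integrable lborel (\<lambda>y::real^'n. S_kernel \<beta> y s * cos (y \<bullet> \<xi>))"
      "integrable lborel (\<lambda>y::real^'n. S_kernel \<beta> y s * sin (y \<bullet> \<xi>))" for \<xi>
    by (rule Bochner_Integration.integrable_bound[OF K_int]; auto simp: abs_mult mult_left_le)+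
  have pair: "integrable (lborel \<Otimes>\<^sub>M lborel) (\<lambda>(y, \<xi>). ?h y \<xi>)"
  proof (rule Bochner_Integration.integrable_bound[OF integrable_product[OF K_int integrable_exp_powr_norm[OF t \<beta>(1)]]])
    show "AE z in lborel \<Otimes>\<^sub>M lborel. norm (case z of (y, \<xi>) \<Rightarrow> ?h y \<xi>)
        \<le> norm (case z of (y, \<xi>) \<Rightarrow> S_kernel \<beta> y s * ?\<phi> t \<xi>)"
      unfolding split_beta real_norm_def abs_mult
      by (intro AE_I2 mult_left_mono mult_left_le_one_le) auto
  qed measurable
  have "(\<integral>y. S_kernel \<beta> (x - y) t * S_kernel \<beta> y s \<partial>lborel) = (\<integral>y. (\<integral>\<xi>. ?h y \<xi> \<partial>lborel) / (2 * pi) ^ CARD('n) \<partial>lborel)"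
    unfolding S_kernel_eq[OF \<beta>(1) t] integral_mult_right_zero by (simp add: mult.commute)
  also have "\<dots> = (\<integral>y. (\<integral>\<xi>. ?h y \<xi> \<partial>lborel) \<partial>lborel) / (2 * pi) ^ CARD('n)"
    by (rule integral_divide_zero)
  also have "(\<integral>y. (\<integral>\<xi>. ?h y \<xi> \<partial>lborel) \<partial>lborel) = (\<integral>\<xi>. (\<integral>y. ?h y \<xi> \<partial>lborel) \<partial>lborel)"
    by (rule lborel_pair.Fubini_integral[OF pair, symmetric])
  also have "\<dots> = (\<integral>\<xi>. cos (x \<bullet> \<xi>) * ?\<phi> (t + s) \<xi> \<partial>lborel)"
  proof (intro Bochner_Integration.integral_cong refl)
    fix \<xi> :: "real^'n"
    have "(\<integral>y. ?h y \<xi> \<partial>lborel) = (\<integral>y. (cos (x \<bullet> \<xi>) * ?\<phi> t \<xi>) * (S_kernel \<beta> y s * cos (y \<bullet> \<xi>))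
        + (sin (x \<bullet> \<xi>) * ?\<phi> t \<xi>) * (S_kernel \<beta> y s * sin (y \<bullet> \<xi>)) \<partial>lborel)"
      by (intro Bochner_Integration.integral_cong) (simp_all add: inner_diff_left cos_diff algebra_simps)
    also have "\<dots> = (cos (x \<bullet> \<xi>) * ?\<phi> t \<xi>) * ?\<phi> s \<xi>"
      by (subst Bochner_Integration.integral_add[OF integrable_mult_right[OF trig_int(1)] integrable_mult_right[OF trig_int(2)]])
         (simp add: S_kernel_cos_integral[OF \<beta> s] S_kernel_sin_integral[OF \<beta>(1) s])
    also have "\<dots> = cos (x \<bullet> \<xi>) * ?\<phi> (t + s) \<xi>"
      by (simp add: exp_add[symmetric] algebra_simps)
    finally show "(\<integral>y. ?h y \<xi> \<partial>lborel) = cos (x \<bullet> \<xi>) * ?\<phi> (t + s) \<xi>" .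
  qed
  finally show ?thesis using \<beta> s t by (simp add: S_kernel_eq)
qed

text \<open>Substituting c \<xi> for \<xi> removes the time from the exponent, as t c^\<beta> = 1.
  This later moves the limit t -> 0 from the kernel into the argument of a modulus of
  continuity.\<close>

lemma S_kernel_scaling:
  fixes x :: "real^'n"
  assumes \<beta>: "0 < \<beta>" and t: "0 < t"
  defines "c \<equiv> t powr (- (1 / \<beta>))"
  shows "S_kernel \<beta> x t = c ^ CARD('n) * S_kernel \<beta> (c *\<^sub>R x) 1"
proof -
  have c: "0 < c" using t by (simp add: c_def)
  have tc: "t * c powr \<beta> = 1"
  proof -
    have "- (1 / \<beta>) * \<beta> = - 1" using \<beta> by simp
    then have "c powr \<beta> = inverse t"
      unfolding c_def powr_powr using t by (simp only: powr_minus powr_one)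
    then show ?thesis using t by simp
  qed
  have "(\<integral>\<xi>. cos (x \<bullet> \<xi>) * exp (- (t * norm \<xi> powr \<beta>)) \<partial>lborel)
      = c ^ CARD('n) * (\<integral>\<xi>. cos (x \<bullet> (0 + c *\<^sub>R \<xi>)) * exp (- (t * norm (0 + c *\<^sub>R \<xi>) powr \<beta>)) \<partial>lborel)"
    using c integral_affine[of "\<lambda>\<xi>. cos (x \<bullet> \<xi>) * exp (- (t * norm \<xi> powr \<beta>))" c 0] by simp
  moreover have "t * norm (0 + c *\<^sub>R \<xi>) powr \<beta> = 1 * norm \<xi> powr \<beta>" for \<xi> :: "real^'n"
    using c tc by (simp add: powr_mult mult.assoc[symmetric])
  ultimately show ?thesis
    using \<beta> t by (simp add: S_kernel_eq)
qed

lemma S_kernel_nn_integral: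
  assumes "0 < \<beta>" "\<beta> \<le> 2" "0 < t"
  shows "(\<integral>\<^sup>+x. ennreal (S_kernel \<beta> (x::real^'n) t) \<partial>lborel) = 1"
  using assms by (subst nn_integral_eq_integral)
    (auto simp: S_kernel_integral S_kernel_nonneg intro: S_kernel_integrable)

text \<open>The lower bound t / 2 on the times supplies a common dominating function on the Fourier
  side.\<close>

lemma S_kernel_continuous_time:
  fixes x :: "real^'n"
  assumes \<beta>: "0 < \<beta>" and t: "0 < t" and r: "r \<longlonglongrightarrow> t" "\<And>k. t / 2 < r k"
  shows "(\<lambda>k. S_kernel \<beta> x (r k)) \<longlonglongrightarrow> S_kernel \<beta> x t"
proof -
  have r0: "0 < r k" for k using r(2)[of k] t by simp
  have "(\<lambda>k. \<integral>\<xi>. cos (x \<bullet> \<xi>) * exp (- (r k * norm \<xi> powr \<beta>)) \<partial>lborel)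
      \<longlonglongrightarrow> (\<integral>\<xi>. cos (x \<bullet> \<xi>) * exp (- (t * norm \<xi> powr \<beta>)) \<partial>lborel)"
  proof (rule integral_dominated_convergence[where w = "\<lambda>\<xi>. exp (- (t / 2 * norm \<xi> powr \<beta>))"])
    show "integrable lborel (\<lambda>\<xi>::real^'n. exp (- (t / 2 * norm \<xi> powr \<beta>)))"
      using t by (intro integrable_exp_powr_norm \<beta>) simp
    show "AE \<xi> in lborel. (\<lambda>k. cos (x \<bullet> \<xi>) * exp (- (r k * norm \<xi> powr \<beta>)))
        \<longlonglongrightarrow> cos (x \<bullet> \<xi>) * exp (- (t * norm \<xi> powr \<beta>))"
      by (intro AE_I2 tendsto_intros r)
    fix k
    have "\<bar>cos (x \<bullet> \<xi>)\<bar> * exp (- (r k * norm \<xi> powr \<beta>)) \<le> 1 * exp (- (t / 2 * norm \<xi> powr \<beta>))" for \<xi>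
    proof (intro mult_mono)
      have "t / 2 * norm \<xi> powr \<beta> \<le> r k * norm \<xi> powr \<beta>"
        by (rule mult_right_mono[OF less_imp_le[OF r(2)]]) simp
      then show "exp (- (r k * norm \<xi> powr \<beta>)) \<le> exp (- (t / 2 * norm \<xi> powr \<beta>))"
        by (simp only: exp_le_cancel_iff neg_le_iff_le)
    qed auto
    then show "AE \<xi> in lborel. norm (cos (x \<bullet> \<xi>) * exp (- (r k * norm \<xi> powr \<beta>))) \<le> exp (- (t / 2 * norm \<xi> powr \<beta>))"
      by (simp add: abs_mult)
  qed measurable
  then show ?thesis
    unfolding S_kernel_eq[OF \<beta> t] S_kernel_eq[OF \<beta> r0] by (intro tendsto_intros) auto
qed

lemma S_kernel_diff_integrable:
  assumes "0 < \<beta>" "\<beta> \<le> 2" "0 < r" "0 < t"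
  shows "integrable lborel (\<lambda>x::real^'n. S_kernel \<beta> x r - S_kernel \<beta> x t)"
  using assms by (intro Bochner_Integration.integrable_diff S_kernel_integrable)

text \<open>Scheffe's lemma: the kernels converge pointwise and all have mass one. Restriction to
  times above t / 2 does not change the filter at t.\<close>

lemma S_kernel_L1_continuous:
  assumes \<beta>: "0 < \<beta>" "\<beta> \<le> 2" and t: "0 < t"
  shows "((\<lambda>r. \<integral>(x::real^'n). \<bar>S_kernel \<beta> x r - S_kernel \<beta> x t\<bar> \<partial>lborel) \<longlongrightarrow> 0) (at t)"
proof -
  have "((\<lambda>r. \<integral>(x::real^'n). \<bar>S_kernel \<beta> x r - S_kernel \<beta> x t\<bar> \<partial>lborel) \<longlongrightarrow> 0) (at t within {t/2<..})"
    unfolding tendsto_at_iff_sequentially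
  proof (intro allI impI)
    fix r assume r: "\<forall>k. r k \<in> {t/2<..} - {t}" "r \<longlonglongrightarrow> t"
    then have r2: "t / 2 < r k" for k by auto
    have r0: "0 < r k" for k using r2[of k] t by simp
    have "(\<lambda>k. \<integral>\<^sup>+(x::real^'n). norm (S_kernel \<beta> x (r k) - S_kernel \<beta> x t) \<partial>lborel) \<longlonglongrightarrow> 0"
    proof (rule Scheffe_lemma2)
      show "AE x in lborel. (\<lambda>k. S_kernel \<beta> x (r k)) \<longlonglongrightarrow> S_kernel \<beta> (x::real^'n) t"
        by (intro AE_I2 S_kernel_continuous_time \<beta> t r r2)
      show "(\<integral>\<^sup>+(x::real^'n). norm (S_kernel \<beta> x (r k)) \<partial>lborel) \<le> (\<integral>\<^sup>+(x::real^'n). norm (S_kernel \<beta> x t) \<partial>lborel)" for k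
        using \<beta> t r0[of k] by (simp add: S_kernel_nn_integral S_kernel_nonneg)
    qed (use \<beta> t in \<open>auto intro: S_kernel_integrable\<close>)
    moreover have "(\<integral>\<^sup>+(x::real^'n). norm (S_kernel \<beta> x (r k) - S_kernel \<beta> x t) \<partial>lborel)
        = ennreal (\<integral>(x::real^'n). \<bar>S_kernel \<beta> x (r k) - S_kernel \<beta> x t\<bar> \<partial>lborel)" for k
      using S_kernel_diff_integrable[OF \<beta> r0[of k] t, where 'n = 'n]
      by (subst nn_integral_eq_integral) (auto intro: integrable_abs)
    ultimately have "(\<lambda>k. ennreal (\<integral>(x::real^'n). \<bar>S_kernel \<beta> x (r k) - S_kernel \<beta> x t\<bar> \<partial>lborel)) \<longlonglongrightarrow> ennreal 0"
      by simp
    then show "((\<lambda>r. \<integral>(x::real^'n). \<bar>S_kernel \<beta> x r - S_kernel \<beta> x t\<bar> \<partial>lborel) \<circ> r) \<longlonglongrightarrow> 0"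
      unfolding o_def by (rule tendsto_ennrealD) auto
  qed
  moreover have "at t within {t/2<..} = at t" using t by (intro at_within_open) auto
  ultimately show ?thesis by simp
qed

section \<open>Jensen's inequality and L^s bounds for convolutions and time integrals\<close>

lemma powr_tangent:
  fixes x c s :: real
  assumes s: "1 < s" and "0 \<le> x" "0 \<le> c"
  shows "c powr s + s * c powr (s - 1) * (x - c) \<le> x powr s"
proof -
  have q: "s / (s - 1) > 1" "1 / s + 1 / (s / (s - 1)) = 1" using s by (auto simp: field_simps)
  \<comment> \<open>Young's inequality with the exponents s and s / (s - 1) is the tangent-line
    inequality of the convex function x^s at c.\<close>
  have "x * c powr (s - 1) \<le> x powr s / s + (c powr (s - 1)) powr (s / (s - 1)) / (s / (s - 1))"
    using assms q by (intro Youngs_inequality) auto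
  also have "(c powr (s - 1)) powr (s / (s - 1)) = c powr s"
    using s by (simp add: powr_powr)
  finally have "s * (x * c powr (s - 1)) \<le> s * (x powr s / s + c powr s / (s / (s - 1)))"
    using s by (intro mult_left_mono) auto
  also have "\<dots> = x powr s + (s - 1) * c powr s" using s by (simp add: field_simps)
  finally have "s * x * c powr (s - 1) \<le> x powr s + (s - 1) * c powr s" by (simp add: mult.assoc)
  moreover have "c * c powr (s - 1) = c powr s"
    using assms by (cases "c = 0") (simp_all add: powr_diff)
  ultimately show ?thesis by (simp add: algebra_simps)
qed

text \<open>The tangent-line inequality at the weighted mean c is integrated against w; the linear
  term cancels by the choice of c. The mass of w is arbitrary, whence its power s - 1. As weights
  serve a kernel, the indicator of a time interval, and \<open>riesz_weight\<close>.\<close>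

lemma jensen_powr:
  fixes f w :: "'a \<Rightarrow> real"
  assumes s: "1 < s" and w: "integrable M w" "\<And>x. 0 \<le> w x"
    and f [measurable]: "f \<in> borel_measurable M" and f0: "\<And>x. 0 \<le> f x"
    and fw: "integrable M (\<lambda>x. f x powr s * w x)"
  shows "integrable M (\<lambda>x. f x * w x)"
    and "(\<integral>x. f x * w x \<partial>M) powr s \<le> (\<integral>x. w x \<partial>M) powr (s - 1) * (\<integral>x. f x powr s * w x \<partial>M)"
proof -
  have [measurable]: "w \<in> borel_measurable M" using w by auto
  show int: "integrable M (\<lambda>x. f x * w x)"
  proof (rule Bochner_Integration.integrable_bound[OF Bochner_Integration.integrable_add[OF w(1) fw]])
    have "f x * w x \<le> w x + f x powr s * w x" for x
    proof (cases "f x \<le> 1")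
      case True
      then have "f x * w x \<le> 1 * w x" using w(2) by (intro mult_right_mono) auto
      moreover have "0 \<le> f x powr s * w x" using w(2) by simp
      ultimately show ?thesis by linarith
    next
      case False
      then have "f x powr 1 \<le> f x powr s" using s by (intro powr_mono) auto
      then have "f x * w x \<le> f x powr s * w x" using False w(2) by (intro mult_right_mono) auto
      then show ?thesis using w(2)[of x] by linarith
    qed
    then show "AE x in M. norm (f x * w x) \<le> norm (w x + f x powr s * w x)"
      using f0 w(2) by (simp add: abs_mult)
  qed measurable
  let ?W = "\<integral>x. w x \<partial>M" and ?F = "\<integral>x. f x * w x \<partial>M" and ?S = "\<integral>x. f x powr s * w x \<partial>M"
  have W0: "0 \<le> ?W" using w by simp
  have F0: "0 \<le> ?F" using f0 w by simp
  show "?F powr s \<le> ?W powr (s - 1) * ?S"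
  proof (cases "?W = 0")
    case True
    then have "AE x in M. w x = 0" using integral_nonneg_eq_0_iff_AE[OF w(1)] w(2) by auto
    then have "?F = 0" by (subst integral_eq_zero_AE) auto
    then show ?thesis using True by simp
  next
    case False
    then have W: "0 < ?W" using W0 by simp
    define c where "c = ?F / ?W"
    have c: "0 \<le> c" "c * ?W = ?F" using W F0 by (auto simp: c_def)
    have "c powr s * ?W + s * c powr (s - 1) * (?F - c * ?W)
        = (\<integral>x. c powr s * w x + s * c powr (s - 1) * (f x * w x - c * w x) \<partial>M)"
      using w int by simp
    also have "\<dots> \<le> ?S"
    proof (rule integral_mono[OF _ fw])
      show "integrable M (\<lambda>x. c powr s * w x + s * c powr (s - 1) * (f x * w x - c * w x))"
        using w int by simp
      fix x
      have "(c powr s + s * c powr (s - 1) * (f x - c)) * w x \<le> f x powr s * w x"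
        using powr_tangent[OF s f0 c(1)] w(2) by (intro mult_right_mono)
      then show "c powr s * w x + s * c powr (s - 1) * (f x * w x - c * w x) \<le> f x powr s * w x"
        by (simp add: algebra_simps)
    qed
    finally have "c powr s * ?W \<le> ?S" using c by simp
    then have "?W powr (s - 1) * (c powr s * ?W) \<le> ?W powr (s - 1) * ?S"
      by (intro mult_left_mono) auto
    moreover have "?W powr (s - 1) * (c powr s * ?W) = ?F powr s"
    proof -
      have "?W powr (s - 1) * ?W = ?W powr s" using W by (simp add: powr_diff)
      then have "?W powr (s - 1) * (c powr s * ?W) = c powr s * ?W powr s" by (simp add: mult_ac)
      also have "\<dots> = ?F powr s" using c W by (simp add: powr_mult[symmetric])
      finally show ?thesis .
    qed
    ultimately show ?thesis by simp
  qed
qed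

text \<open>The s-th power of the L^s norm with values in ennreal: bounds can be chained without
  integrability side conditions, and Tonelli applies directly.\<close>

definition Lp_mass :: "real \<Rightarrow> ('a::euclidean_space \<Rightarrow> real) \<Rightarrow> ennreal" where
  "Lp_mass s f = (\<integral>\<^sup>+x. ennreal (\<bar>f x\<bar> powr s) \<partial>lborel)"

lemma convolution_bounded:
  fixes J v :: "'a::euclidean_space \<Rightarrow> real"
  assumes J: "integrable lborel J" and v [measurable]: "v \<in> borel_measurable borel"
    and B: "AE y in lborel. \<bar>v y\<bar> \<le> B"
  shows "integrable lborel (\<lambda>y. J (x - y) * v y)"
    and "\<bar>\<integral>y. J (x - y) * v y \<partial>lborel\<bar> \<le> (\<integral>y. \<bar>J y\<bar> \<partial>lborel) * B"
proof -
  have [measurable]: "J \<in> borel_measurable borel" using J by auto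
  have JB: "integrable lborel (\<lambda>y. \<bar>J (x - y)\<bar> * B)"
    using J by (intro integrable_mult_left integrable_abs integrable_reflect)
  have le: "AE y in lborel. \<bar>J (x - y) * v y\<bar> \<le> \<bar>J (x - y)\<bar> * B"
    using B by eventually_elim (auto simp: abs_mult intro: mult_left_mono)
  show int: "integrable lborel (\<lambda>y. J (x - y) * v y)"
  proof (rule Bochner_Integration.integrable_bound[OF JB])
    show "AE y in lborel. norm (J (x - y) * v y) \<le> norm (\<bar>J (x - y)\<bar> * B)"
      using le by eventually_elim auto
  qed measurable
  have "\<bar>\<integral>y. J (x - y) * v y \<partial>lborel\<bar> \<le> (\<integral>y. \<bar>J (x - y) * v y\<bar> \<partial>lborel)"
    by (rule integral_abs_bound)
  also have "\<dots> \<le> (\<integral>y. \<bar>J (x - y)\<bar> * B \<partial>lborel)"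
    by (rule integral_mono_AE[OF integrable_abs[OF int] JB le])
  also have "\<dots> = (\<integral>y. \<bar>J y\<bar> \<partial>lborel) * B"
    using integral_reflect[of "\<lambda>y. \<bar>J y\<bar>" x] by simp
  finally show "\<bar>\<integral>y. J (x - y) * v y \<partial>lborel\<bar> \<le> (\<integral>y. \<bar>J y\<bar> \<partial>lborel) * B" .
qed

text \<open>Jensen in y with weight |J (x - y)|, whose mass does not depend on x. The sup bound on v
  secures integrability; its size does not enter the estimate.\<close>

lemma convolution_powr_le:
  fixes J v :: "'a::euclidean_space \<Rightarrow> real"
  assumes s: "1 < s" and J: "integrable lborel J" and v [measurable]: "v \<in> borel_measurable borel"
    and B: "AE y in lborel. \<bar>v y\<bar> \<le> B"
  shows "ennreal (\<bar>\<integral>y. J (x - y) * v y \<partial>lborel\<bar> powr s)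
    \<le> ennreal ((\<integral>y. \<bar>J y\<bar> \<partial>lborel) powr (s - 1)) * (\<integral>\<^sup>+y. ennreal (\<bar>v y\<bar> powr s) * ennreal \<bar>J (x - y)\<bar> \<partial>lborel)"
proof -
  have [measurable]: "J \<in> borel_measurable borel" using J by auto
  have Jx: "integrable lborel (\<lambda>y. \<bar>J (x - y)\<bar>)"
    using J by (intro integrable_abs integrable_reflect)
  have vJ: "integrable lborel (\<lambda>y. \<bar>v y\<bar> powr s * \<bar>J (x - y)\<bar>)"
  proof (rule Bochner_Integration.integrable_bound[OF integrable_mult_right[OF Jx, of "B powr s"]])
    show "AE y in lborel. norm (\<bar>v y\<bar> powr s * \<bar>J (x - y)\<bar>) \<le> norm (B powr s * \<bar>J (x - y)\<bar>)"
      using B by eventually_elim (use s in \<open>auto simp: abs_mult intro!: mult_right_mono powr_mono2\<close>)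
  qed measurable
  note j = jensen_powr[OF s Jx abs_ge_zero _ abs_ge_zero vJ]
  have "\<bar>\<integral>y. J (x - y) * v y \<partial>lborel\<bar> powr s \<le> (\<integral>y. \<bar>v y\<bar> * \<bar>J (x - y)\<bar> \<partial>lborel) powr s"
    using integral_abs_bound[of lborel "\<lambda>y. J (x - y) * v y"] s
    by (intro powr_mono2) (auto simp: abs_mult mult.commute)
  also have "\<dots> \<le> (\<integral>y. \<bar>J (x - y)\<bar> \<partial>lborel) powr (s - 1) * (\<integral>y. \<bar>v y\<bar> powr s * \<bar>J (x - y)\<bar> \<partial>lborel)"
    by (rule j(2)) measurable
  also have "(\<integral>y. \<bar>J (x - y)\<bar> \<partial>lborel) = (\<integral>y. \<bar>J y\<bar> \<partial>lborel)"
    using integral_reflect[of "\<lambda>y. \<bar>J y\<bar>" x] by simp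
  finally have "ennreal (\<bar>\<integral>y. J (x - y) * v y \<partial>lborel\<bar> powr s)
      \<le> ennreal ((\<integral>y. \<bar>J y\<bar> \<partial>lborel) powr (s - 1)) * ennreal (\<integral>y. \<bar>v y\<bar> powr s * \<bar>J (x - y)\<bar> \<partial>lborel)"
    by (simp add: ennreal_mult[symmetric] ennreal_leI)
  also have "ennreal (\<integral>y. \<bar>v y\<bar> powr s * \<bar>J (x - y)\<bar> \<partial>lborel) = (\<integral>\<^sup>+y. ennreal (\<bar>v y\<bar> powr s * \<bar>J (x - y)\<bar>) \<partial>lborel)"
    by (rule nn_integral_eq_integral[OF vJ, symmetric]) simp
  finally show ?thesis by (simp add: ennreal_mult)
qed

text \<open>Young's inequality for L^1 and L^s: the pointwise Jensen bound is integrated in x and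
  the integrals are exchanged.\<close>

lemma Lp_mass_convolution:
  fixes J v :: "'a::euclidean_space \<Rightarrow> real"
  assumes s: "1 < s" and J: "integrable lborel J" and v [measurable]: "v \<in> borel_measurable borel"
    and B: "AE y in lborel. \<bar>v y\<bar> \<le> B"
  shows "Lp_mass s (\<lambda>x. \<integral>y. J (x - y) * v y \<partial>lborel) \<le> ennreal ((\<integral>y. \<bar>J y\<bar> \<partial>lborel) powr s) * Lp_mass s v"
proof -
  have [measurable]: "J \<in> borel_measurable borel" using J by auto
  let ?C = "\<integral>y. \<bar>J y\<bar> \<partial>lborel"
  have C: "0 \<le> ?C" by simp
  have "Lp_mass s (\<lambda>x. \<integral>y. J (x - y) * v y \<partial>lborel)
      \<le> (\<integral>\<^sup>+x. ennreal (?C powr (s - 1)) * (\<integral>\<^sup>+y. ennreal (\<bar>v y\<bar> powr s) * ennreal \<bar>J (x - y)\<bar> \<partial>lborel) \<partial>lborel)"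
    unfolding Lp_mass_def by (intro nn_integral_mono convolution_powr_le[OF assms])
  also have "\<dots> = ennreal (?C powr (s - 1)) * (\<integral>\<^sup>+x. (\<integral>\<^sup>+y. ennreal (\<bar>v y\<bar> powr s) * ennreal \<bar>J (x - y)\<bar> \<partial>lborel) \<partial>lborel)"
    by (rule nn_integral_cmult) measurable
  also have "(\<integral>\<^sup>+x. (\<integral>\<^sup>+y. ennreal (\<bar>v y\<bar> powr s) * ennreal \<bar>J (x - y)\<bar> \<partial>lborel) \<partial>lborel)
      = (\<integral>\<^sup>+y. (\<integral>\<^sup>+x. ennreal (\<bar>v y\<bar> powr s) * ennreal \<bar>J (x - y)\<bar> \<partial>lborel) \<partial>lborel)"
    by (rule lborel_pair.Fubini'[symmetric]) measurable
  also have "\<dots> = (\<integral>\<^sup>+y. ennreal (\<bar>v y\<bar> powr s) * ennreal ?C \<partial>lborel)"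
  proof (intro nn_integral_cong)
    fix y
    have "(\<integral>\<^sup>+x. ennreal (\<bar>v y\<bar> powr s) * ennreal \<bar>J (x - y)\<bar> \<partial>lborel) = ennreal (\<bar>v y\<bar> powr s) * (\<integral>\<^sup>+x. ennreal \<bar>J (x - y)\<bar> \<partial>lborel)"
      by (rule nn_integral_cmult) measurable
    also have "(\<integral>\<^sup>+x. ennreal \<bar>J (x - y)\<bar> \<partial>lborel) = (\<integral>\<^sup>+x. ennreal \<bar>J x\<bar> \<partial>lborel)"
      using nn_integral_translate[of "\<lambda>x. ennreal \<bar>J x\<bar>" y] by simp
    also have "\<dots> = ennreal ?C"
      using J by (intro nn_integral_eq_integral) auto
    finally show "(\<integral>\<^sup>+x. ennreal (\<bar>v y\<bar> powr s) * ennreal \<bar>J (x - y)\<bar> \<partial>lborel) = ennreal (\<bar>v y\<bar> powr s) * ennreal ?C" .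
  qed
  also have "\<dots> = Lp_mass s v * ennreal ?C"
    unfolding Lp_mass_def by (rule nn_integral_multc) measurable
  also have "ennreal (?C powr (s - 1)) * (Lp_mass s v * ennreal ?C) = ennreal (?C powr (s - 1) * ?C) * Lp_mass s v"
    using C by (simp add: ennreal_mult mult_ac)
  also have "?C powr (s - 1) * ?C = ?C powr s"
    using C by (cases "?C = 0") (simp_all add: powr_diff)
  finally show ?thesis .
qed

text \<open>The substitute for Minkowski's integral inequality: Jensen in time, with the indicator
  of the interval as weight, then Tonelli.\<close>

lemma Lp_mass_time_integral:
  fixes G :: "real \<Rightarrow> 'a::euclidean_space \<Rightarrow> real"
  assumes s: "1 < s" and ab: "a \<le> b"
    and G [measurable]: "case_prod G \<in> borel_measurable (borel \<Otimes>\<^sub>M borel)"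
    and B: "\<And>\<tau> x. \<tau> \<in> {a..b} \<Longrightarrow> \<bar>G \<tau> x\<bar> \<le> B"
    and C: "\<And>\<tau>. \<tau> \<in> {a..b} \<Longrightarrow> Lp_mass s (G \<tau>) \<le> C"
  shows "Lp_mass s (\<lambda>x. LINT \<tau>:{a..b}|lborel. G \<tau> x) \<le> ennreal ((b - a) powr s) * C"
proof -
  let ?i = "indicator {a..b} :: real \<Rightarrow> real"
  have i: "integrable lborel ?i" "(\<integral>\<tau>. ?i \<tau> \<partial>lborel) = b - a" using ab by auto
  have pt: "ennreal (\<bar>LINT \<tau>:{a..b}|lborel. G \<tau> x\<bar> powr s)
      \<le> ennreal ((b - a) powr (s - 1)) * (\<integral>\<^sup>+\<tau>. ennreal (\<bar>G \<tau> x\<bar> powr s) * indicator {a..b} \<tau> \<partial>lborel)" for x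
  proof -
    have Gi: "integrable lborel (\<lambda>\<tau>. \<bar>G \<tau> x\<bar> powr s * ?i \<tau>)"
    proof (rule Bochner_Integration.integrable_bound[OF integrable_mult_right[OF i(1), of "B powr s"]])
      show "AE \<tau> in lborel. norm (\<bar>G \<tau> x\<bar> powr s * ?i \<tau>) \<le> norm (B powr s * ?i \<tau>)"
        using s B by (auto intro!: AE_I2 powr_mono2 split: split_indicator)
    qed measurable
    have i0: "0 \<le> ?i \<tau>" for \<tau> by simp
    have meas: "(\<lambda>\<tau>. \<bar>G \<tau> x\<bar>) \<in> borel_measurable lborel" by measurable
    have "\<bar>LINT \<tau>:{a..b}|lborel. G \<tau> x\<bar> powr s \<le> (\<integral>\<tau>. \<bar>G \<tau> x\<bar> * ?i \<tau> \<partial>lborel) powr s"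
      unfolding set_lebesgue_integral_def
      using integral_abs_bound[of lborel "\<lambda>\<tau>. ?i \<tau> *\<^sub>R G \<tau> x"] s
      by (intro powr_mono2) (auto simp: abs_mult mult.commute)
    also have "\<dots> \<le> (b - a) powr (s - 1) * (\<integral>\<tau>. \<bar>G \<tau> x\<bar> powr s * ?i \<tau> \<partial>lborel)"
      using jensen_powr(2)[OF s i(1) i0 meas abs_ge_zero Gi] i(2) by simp
    finally have "ennreal (\<bar>LINT \<tau>:{a..b}|lborel. G \<tau> x\<bar> powr s)
        \<le> ennreal ((b - a) powr (s - 1)) * ennreal (\<integral>\<tau>. \<bar>G \<tau> x\<bar> powr s * ?i \<tau> \<partial>lborel)"
      by (simp add: ennreal_mult[symmetric] ennreal_leI)
    also have "ennreal (\<integral>\<tau>. \<bar>G \<tau> x\<bar> powr s * ?i \<tau> \<partial>lborel) = (\<integral>\<^sup>+\<tau>. ennreal (\<bar>G \<tau> x\<bar> powr s * ?i \<tau>) \<partial>lborel)"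
      by (rule nn_integral_eq_integral[OF Gi, symmetric]) simp
    also have "\<dots> = (\<integral>\<^sup>+\<tau>. ennreal (\<bar>G \<tau> x\<bar> powr s) * indicator {a..b} \<tau> \<partial>lborel)"
      by (intro nn_integral_cong) (auto split: split_indicator)
    finally show ?thesis .
  qed
  have "Lp_mass s (\<lambda>x. LINT \<tau>:{a..b}|lborel. G \<tau> x)
      \<le> (\<integral>\<^sup>+x. ennreal ((b - a) powr (s - 1)) * (\<integral>\<^sup>+\<tau>. ennreal (\<bar>G \<tau> x\<bar> powr s) * indicator {a..b} \<tau> \<partial>lborel) \<partial>lborel)"
    unfolding Lp_mass_def by (intro nn_integral_mono pt)
  also have "\<dots> = ennreal ((b - a) powr (s - 1)) * (\<integral>\<^sup>+x. (\<integral>\<^sup>+\<tau>. ennreal (\<bar>G \<tau> x\<bar> powr s) * indicator {a..b} \<tau> \<partial>lborel) \<partial>lborel)"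
    by (rule nn_integral_cmult) measurable
  also have "(\<integral>\<^sup>+x. (\<integral>\<^sup>+\<tau>. ennreal (\<bar>G \<tau> x\<bar> powr s) * indicator {a..b} \<tau> \<partial>lborel) \<partial>lborel)
      = (\<integral>\<^sup>+\<tau>. (\<integral>\<^sup>+x. ennreal (\<bar>G \<tau> x\<bar> powr s) * indicator {a..b} \<tau> \<partial>lborel) \<partial>lborel)"
    by (rule lborel_pair.Fubini'[symmetric]) measurable
  also have "\<dots> = (\<integral>\<^sup>+\<tau>. Lp_mass s (G \<tau>) * indicator {a..b} \<tau> \<partial>lborel)"
    unfolding Lp_mass_def by (intro nn_integral_cong nn_integral_multc) measurable
  also have "ennreal ((b - a) powr (s - 1)) * \<dots> \<le> ennreal ((b - a) powr (s - 1)) * (C * ennreal (b - a))"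
  proof (rule mult_left_mono)
    have "(\<integral>\<^sup>+\<tau>. Lp_mass s (G \<tau>) * indicator {a..b} \<tau> \<partial>lborel) \<le> (\<integral>\<^sup>+\<tau>. C * indicator {a..b} \<tau> \<partial>lborel)"
      using C by (intro nn_integral_mono) (auto split: split_indicator)
    also have "\<dots> = C * ennreal (b - a)"
      using ab by (subst nn_integral_cmult_indicator) auto
    finally show "(\<integral>\<^sup>+\<tau>. Lp_mass s (G \<tau>) * indicator {a..b} \<tau> \<partial>lborel) \<le> C * ennreal (b - a)" .
  qed simp
  also have "\<dots> = ennreal ((b - a) powr (s - 1) * (b - a)) * C"
    using ab by (simp add: ennreal_mult mult_ac)
  also have "(b - a) powr (s - 1) * (b - a) = (b - a) powr s"
    using ab by (cases "b = a") (simp_all add: powr_diff)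
  finally show ?thesis .
qed

section \<open>Continuity at the initial time\<close>

definition L1_modulus :: "('a::euclidean_space \<Rightarrow> real) \<Rightarrow> 'a \<Rightarrow> real" where
  "L1_modulus g y = (\<integral>x. \<bar>g (x - y) - g x\<bar> \<partial>lborel)"

lemma integrable_translate:
  fixes g :: "'a::euclidean_space \<Rightarrow> real"
  assumes "integrable lborel g"
  shows "integrable lborel (\<lambda>x. g (x - y))"
  using integrable_affine[OF assms, of 1 "- y"] by simp

lemma integral_translate:
  fixes g :: "'a::euclidean_space \<Rightarrow> real"
  assumes "g \<in> borel_measurable borel"
  shows "(\<integral>x. g (x - y) \<partial>lborel) = (\<integral>x. g x \<partial>lborel)"
  using integral_affine[OF assms, of 1 "- y"] by simp

lemma L1_modulus_integrable:
  fixes g :: "'a::euclidean_space \<Rightarrow> real"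
  assumes "integrable lborel g"
  shows "integrable lborel (\<lambda>x. \<bar>g (x - y) - g x\<bar>)"
  using assms by (intro integrable_abs Bochner_Integration.integrable_diff integrable_translate)

lemma L1_modulus_nonneg: "0 \<le> L1_modulus g y"
  by (simp add: L1_modulus_def)

lemma L1_modulus_perturb:
  assumes f: "integrable lborel f" and g: "integrable lborel g"
  shows "L1_modulus f y \<le> L1_modulus g y + 2 * (\<integral>x. \<bar>f x - g x\<bar> \<partial>lborel)"
proof -
  have fg: "integrable lborel (\<lambda>x. \<bar>f x - g x\<bar>)" using f g by auto
  then have [measurable]: "(\<lambda>x. \<bar>f x - g x\<bar>) \<in> borel_measurable borel" by auto
  have fgt: "integrable lborel (\<lambda>x. \<bar>f (x - y) - g (x - y)\<bar>)" using integrable_translate[OF fg] .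
  have "L1_modulus f y \<le> (\<integral>x. \<bar>g (x - y) - g x\<bar> + (\<bar>f (x - y) - g (x - y)\<bar> + \<bar>f x - g x\<bar>) \<partial>lborel)"
    unfolding L1_modulus_def
    by (intro integral_mono L1_modulus_integrable f Bochner_Integration.integrable_add g fg fgt) linarith
  also have "\<dots> = L1_modulus g y + ((\<integral>x. \<bar>f (x - y) - g (x - y)\<bar> \<partial>lborel) + (\<integral>x. \<bar>f x - g x\<bar> \<partial>lborel))"
    unfolding L1_modulus_def
    by (subst Bochner_Integration.integral_add[OF L1_modulus_integrable[OF g] Bochner_Integration.integrable_add[OF fgt fg]])
       (subst Bochner_Integration.integral_add[OF fgt fg], rule refl)
  also have "(\<integral>x. \<bar>f (x - y) - g (x - y)\<bar> \<partial>lborel) = (\<integral>x. \<bar>f x - g x\<bar> \<partial>lborel)"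
    by (rule integral_translate[of "\<lambda>x. \<bar>f x - g x\<bar>"]) measurable
  finally show ?thesis by simp
qed

text \<open>An L^1 perturbation changes the modulus by at most twice its size, uniformly in the
  shift, so a vanishing limit at 0 survives approximation.\<close>

lemma L1_modulus_closure:
  fixes f :: "'a::euclidean_space \<Rightarrow> real"
  assumes f: "integrable lborel f"
    and approx: "\<And>e. 0 < e \<Longrightarrow> \<exists>g. integrable lborel g \<and> (L1_modulus g \<longlongrightarrow> 0) (at 0) \<and> (\<integral>x. \<bar>f x - g x\<bar> \<partial>lborel) < e"
  shows "(L1_modulus f \<longlongrightarrow> 0) (at 0)"
proof (rule tendstoI)
  fix e :: real assume "0 < e"
  then obtain g where g: "integrable lborel g" "(L1_modulus g \<longlongrightarrow> 0) (at 0)" "(\<integral>x. \<bar>f x - g x\<bar> \<partial>lborel) < e / 4"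
    using approx[of "e / 4"] by auto
  have "eventually (\<lambda>y. L1_modulus g y < e / 2) (at 0)"
    using order_tendstoD(2)[OF g(2), of "e / 2"] \<open>0 < e\<close> by simp
  then show "eventually (\<lambda>y. dist (L1_modulus f y) 0 < e) (at 0)"
  proof eventually_elim
    case (elim y)
    then show ?case
      using L1_modulus_perturb[OF f g(1), of y] g(3) L1_modulus_nonneg[of f y] by simp
  qed
qed

lemma L1_modulus_open:
  fixes U :: "'a::euclidean_space set"
  assumes U: "open U" "emeasure lborel U < \<infinity>"
  shows "(L1_modulus (indicator U) \<longlongrightarrow> 0) (at 0)"
  unfolding tendsto_at_iff_sequentially
proof (intro allI impI)
  have [measurable]: "U \<in> sets borel" using U by auto
  have int: "integrable lborel (indicator U :: 'a \<Rightarrow> real)" using U by simp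
  fix y :: "nat \<Rightarrow> 'a" assume "\<forall>i. y i \<in> UNIV - {0}" "y \<longlonglongrightarrow> 0"
  note y = \<open>y \<longlonglongrightarrow> 0\<close>
  \<comment> \<open>\<open>d z x\<close> is 1 exactly when x lies in U and x - z does not. Openness
    makes it vanish at each x once z is small, and the integrand of the modulus at z is d z x + d (-
    z) (x - z).\<close>
  define d where "d z x = (indicator U x :: real) * (1 - indicator U (x - z))" for z x :: 'a
  have d_meas [measurable]: "d z \<in> borel_measurable borel" for z unfolding d_def[abs_def] by measurable
  have d_bd: "norm (d z x) \<le> indicator U x" for z x by (auto simp: d_def split: split_indicator)
  have d_int: "integrable lborel (d z)" for z
    by (rule Bochner_Integration.integrable_bound[OF int]) (auto simp: d_def split: split_indicator)
  have d_lim: "(\<lambda>i. \<integral>x. d (z i) x \<partial>lborel) \<longlonglongrightarrow> 0" if z: "z \<longlonglongrightarrow> 0" for z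
  proof -
    have "(\<lambda>i. \<integral>x. d (z i) x \<partial>lborel) \<longlonglongrightarrow> (\<integral>(x::'a). 0 \<partial>lborel)"
    proof (rule integral_dominated_convergence[OF _ _ int])
      show "AE x in lborel. (\<lambda>i. d (z i) x) \<longlonglongrightarrow> 0"
      proof (rule AE_I2)
        fix x
        show "(\<lambda>i. d (z i) x) \<longlonglongrightarrow> 0"
        proof (cases "x \<in> U")
          case True
          have "(\<lambda>i. x - z i) \<longlonglongrightarrow> x - 0" by (intro tendsto_intros z)
          then have "eventually (\<lambda>i. x - z i \<in> U) sequentially"
            using topological_tendstoD[OF _ U(1)] True by auto
          then have "eventually (\<lambda>i. d (z i) x = 0) sequentially"
            by eventually_elim (simp add: d_def)
          then show ?thesis by (rule tendsto_eventually)
        qed (simp add: d_def)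
      qed
    qed (auto intro: d_bd[simplified])
    then show ?thesis by simp
  qed
  have eq: "L1_modulus (indicator U) z = (\<integral>x. d z x \<partial>lborel) + (\<integral>x. d (- z) x \<partial>lborel)" for z
  proof -
    have "L1_modulus (indicator U) z = (\<integral>x. d z x + d (- z) (x - z) \<partial>lborel)"
      unfolding L1_modulus_def by (intro Bochner_Integration.integral_cong) (auto simp: d_def split: split_indicator)
    also have "\<dots> = (\<integral>x. d z x \<partial>lborel) + (\<integral>x. d (- z) (x - z) \<partial>lborel)"
      by (intro Bochner_Integration.integral_add d_int integrable_translate)
    also have "(\<integral>x. d (- z) (x - z) \<partial>lborel) = (\<integral>x. d (- z) x \<partial>lborel)"
      by (rule integral_translate) measurable
    finally show ?thesis .
  qed
  have "(\<lambda>i. - y i) \<longlonglongrightarrow> 0" using tendsto_minus[OF y] by simp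
  from tendsto_add[OF d_lim[OF y] d_lim[OF this]]
  show "(L1_modulus (indicator U) \<circ> y) \<longlonglongrightarrow> 0" by (simp add: o_def eq)
qed

text \<open>Induction over integrable functions: indicators are approximated from outside by open
  sets of nearly the same measure, sums use subadditivity of the modulus, and limits use closure
  under L^1 approximation.\<close>

lemma L1_modulus_tendsto_0:
  fixes g :: "'a::euclidean_space \<Rightarrow> real"
  assumes "integrable lborel g"
  shows "(L1_modulus g \<longlongrightarrow> 0) (at 0)"
  using assms
proof (induction rule: integrable_induct)
  case (base A c)
  have A [measurable]: "A \<in> sets borel" "emeasure lborel A < \<infinity>" using base by auto
  have Aint: "integrable lborel (indicator A :: 'a \<Rightarrow> real)" using A by simp
  have "(L1_modulus (indicator A) \<longlongrightarrow> 0) (at 0)"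
  proof (rule L1_modulus_closure[OF Aint])
    fix e :: real assume e: "0 < e"
    from outer_regular_lborel[OF A(1) e] obtain U where U: "open U" "A \<subseteq> U" "emeasure lborel (U - A) < ennreal e" .
    have [measurable]: "U \<in> sets borel" using U by auto
    have "emeasure lborel U = emeasure lborel A + emeasure lborel (U - A)"
      using U(2) plus_emeasure[of A lborel "U - A"] by (simp add: Un_absorb1)
    also have "\<dots> < \<infinity>" using A(2) order.strict_trans[OF U(3) ennreal_less_top] by (simp add: less_top[symmetric])
    finally have Ufin: "emeasure lborel U < \<infinity>" .
    have "(\<integral>x. \<bar>indicator A x - indicator U x\<bar> \<partial>lborel) = (\<integral>x. (indicator (U - A) x :: real) \<partial>lborel)"
      using U(2) by (intro Bochner_Integration.integral_cong) (auto split: split_indicator)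
    also have "\<dots> = measure lborel (U - A)" by simp
    also have "\<dots> < e"
    proof -
      have "emeasure lborel (U - A) = ennreal (measure lborel (U - A))"
        using order.strict_trans[OF U(3) ennreal_less_top] by (intro emeasure_eq_ennreal_measure) simp
      then show ?thesis using U(3) e by (simp add: ennreal_less_iff)
    qed
    finally show "\<exists>g. integrable lborel g \<and> (L1_modulus g \<longlongrightarrow> 0) (at 0) \<and> (\<integral>x. \<bar>indicator A x - g x\<bar> \<partial>lborel) < e"
      using Ufin by (intro exI[of _ "indicator U"] conjI L1_modulus_open U(1)) auto
  qed
  then have "((\<lambda>y. \<bar>c\<bar> * L1_modulus (indicator A) y) \<longlongrightarrow> \<bar>c\<bar> * 0) (at 0)" by (intro tendsto_intros)
  moreover have "L1_modulus (\<lambda>x. indicator A x *\<^sub>R c) = (\<lambda>y. \<bar>c\<bar> * L1_modulus (indicator A) y)"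
  proof
    fix y
    have "L1_modulus (\<lambda>x. indicator A x *\<^sub>R c) y = (\<integral>x. \<bar>c\<bar> * \<bar>indicator A (x - y) - indicator A x\<bar> \<partial>lborel)"
      unfolding L1_modulus_def by (intro Bochner_Integration.integral_cong) (auto split: split_indicator)
    then show "L1_modulus (\<lambda>x. indicator A x *\<^sub>R c) y = \<bar>c\<bar> * L1_modulus (indicator A) y"
      by (simp add: L1_modulus_def)
  qed
  ultimately show ?case by (simp only: mult_zero_right)
next
  case (add f g)
  have f: "integrable lborel f" and g: "integrable lborel g" by fact+
  have lim_fg: "(L1_modulus f \<longlongrightarrow> 0) (at 0)" "(L1_modulus g \<longlongrightarrow> 0) (at 0)" by fact+
  have "L1_modulus (\<lambda>x. f x + g x) y \<le> L1_modulus f y + L1_modulus g y" for y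
  proof -
    have "L1_modulus (\<lambda>x. f x + g x) y \<le> (\<integral>x. \<bar>f (x - y) - f x\<bar> + \<bar>g (x - y) - g x\<bar> \<partial>lborel)"
      unfolding L1_modulus_def
      by (intro integral_mono L1_modulus_integrable[OF Bochner_Integration.integrable_add[OF f g]]
          Bochner_Integration.integrable_add[OF L1_modulus_integrable[OF f] L1_modulus_integrable[OF g]]) linarith
    also have "\<dots> = L1_modulus f y + L1_modulus g y"
      unfolding L1_modulus_def
      by (rule Bochner_Integration.integral_add[OF L1_modulus_integrable[OF f] L1_modulus_integrable[OF g]])
    finally show ?thesis .
  qed
  note le = this
  have "((\<lambda>y. L1_modulus f y + L1_modulus g y) \<longlongrightarrow> 0) (at 0)"
    using tendsto_add[OF lim_fg] by simp
  with tendsto_const show ?case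
    by (rule tendsto_sandwich[rotated 2]) (simp_all add: L1_modulus_nonneg le)
next
  case (lim f s)
  have f: "integrable lborel f" and s: "integrable lborel (s i)" and s_lim: "(L1_modulus (s i) \<longlongrightarrow> 0) (at 0)" for i
    by fact+
  have conv: "(\<lambda>i. s i x) \<longlonglongrightarrow> f x" and bd: "norm (s i x) \<le> 2 * norm (f x)" for i x
    using lim by simp_all
  show ?case
  proof (rule L1_modulus_closure[OF f])
    fix e :: real assume e: "0 < e"
    have fm [measurable]: "f \<in> borel_measurable borel" and sm [measurable]: "s i \<in> borel_measurable borel" for i
      using f s by auto
    have "(\<lambda>i. \<integral>x. \<bar>f x - s i x\<bar> \<partial>lborel) \<longlonglongrightarrow> (\<integral>(x::'a). 0 \<partial>lborel)"
    \<comment> \<open>The approximating sequence satisfies |s i| \<le> 2 |f|, hence the factor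
      3.\<close>
    proof (rule integral_dominated_convergence[where w = "\<lambda>x. 3 * \<bar>f x\<bar>"])
      show "AE x in lborel. (\<lambda>i. \<bar>f x - s i x\<bar>) \<longlonglongrightarrow> 0"
      proof (rule AE_I2)
        fix x
        have "(\<lambda>i. \<bar>f x - s i x\<bar>) \<longlonglongrightarrow> \<bar>f x - f x\<bar>" by (intro tendsto_intros conv)
        then show "(\<lambda>i. \<bar>f x - s i x\<bar>) \<longlonglongrightarrow> 0" by simp
      qed
      show "AE x in lborel. norm \<bar>f x - s i x\<bar> \<le> 3 * \<bar>f x\<bar>" for i
      proof (rule AE_I2)
        fix x show "norm \<bar>f x - s i x\<bar> \<le> 3 * \<bar>f x\<bar>" using bd[of i x] by simp
      qed
    qed (use f in auto)
    then have "eventually (\<lambda>i. (\<integral>x. \<bar>f x - s i x\<bar> \<partial>lborel) < e) sequentially"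
      using e by (intro order_tendstoD(2)[where y = 0]) auto
    then obtain i where "(\<integral>x. \<bar>f x - s i x\<bar> \<partial>lborel) < e" by (auto simp: eventually_sequentially)
    then show "\<exists>g. integrable lborel g \<and> (L1_modulus g \<longlongrightarrow> 0) (at 0) \<and> (\<integral>x. \<bar>f x - g x\<bar> \<partial>lborel) < e"
      using s s_lim by blast
  qed
qed

section \<open>From L^1 to L^s moduli of translation, and strong continuity at time zero\<close>

lemma powr_add_le:
  fixes a b s :: real
  assumes s: "0 < s" and "0 \<le> a" "0 \<le> b"
  shows "(a + b) powr s \<le> 2 powr s * (a powr s + b powr s)"
proof -
  have "(a + b) powr s \<le> (2 * max a b) powr s" using assms by (intro powr_mono2) auto
  also have "\<dots> = 2 powr s * max a b powr s" using assms by (simp add: powr_mult)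
  also have "\<dots> \<le> 2 powr s * (a powr s + b powr s)" by (intro mult_left_mono) (auto simp: max_def)
  finally show ?thesis .
qed

lemma powr_superadditive:
  fixes a b s :: real
  assumes s: "1 \<le> s" and ab: "0 \<le> a" "0 \<le> b"
  shows "a powr s + b powr s \<le> (a + b) powr s"
proof -
  have split: "x powr s = x * x powr (s - 1)" if "0 \<le> x" for x :: real
    using that by (cases "x = 0") (simp_all add: powr_diff)
  have "a * a powr (s - 1) \<le> a * (a + b) powr (s - 1)" "b * b powr (s - 1) \<le> b * (a + b) powr (s - 1)"
    using assms by (auto intro!: mult_left_mono powr_mono2)
  then have "a powr s + b powr s \<le> (a + b) * (a + b) powr (s - 1)"
    using ab by (simp add: split algebra_simps)
  then show ?thesis using ab by (simp add: split[of "a + b"])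
qed

text \<open>The signed power sgn a |a|^s carries L^s into L^1, and this inequality bounds L^s
  differences by L^1 differences of the images. For equal signs it is superadditivity of the power;
  for opposite signs it is the quasi-triangle inequality, the origin of 2^s.\<close>

lemma abs_diff_powr_le_signed_powr:
  fixes a b s :: real
  assumes s: "1 \<le> s"
  shows "\<bar>a - b\<bar> powr s \<le> 2 powr s * \<bar>sgn a * \<bar>a\<bar> powr s - sgn b * \<bar>b\<bar> powr s\<bar>"
proof -
  have two: "1 \<le> 2 powr s" using s ge_one_powr_ge_zero[of 2 s] by simp
  have same: "\<bar>a - b\<bar> powr s \<le> 2 powr s * \<bar>a powr s - b powr s\<bar>" if "0 \<le> b" "b \<le> a" for a b :: real
  proof -
    have "b powr s + (a - b) powr s \<le> a powr s" using powr_superadditive[OF s that(1), of "a - b"] that by simp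
    then have "\<bar>a - b\<bar> powr s \<le> 1 * \<bar>a powr s - b powr s\<bar>" using that by simp
    also have "\<dots> \<le> 2 powr s * \<bar>a powr s - b powr s\<bar>" using two by (intro mult_right_mono) auto
    finally show ?thesis .
  qed
  have same': "\<bar>a - b\<bar> powr s \<le> 2 powr s * \<bar>a powr s - b powr s\<bar>" if "0 \<le> a" "0 \<le> b" for a b :: real
    using same[of b a] same[of a b] that by (cases "b \<le> a") (auto simp: abs_minus_commute)
  have opp: "\<bar>a + b\<bar> powr s \<le> 2 powr s * \<bar>a powr s + b powr s\<bar>" if "0 \<le> a" "0 \<le> b" for a b :: real
    using powr_add_le[of s a b] that s by simp
  have sg: "sgn x * \<bar>x\<bar> powr s = (if 0 \<le> x then x powr s else - ((- x) powr s))" for x :: real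
    by (auto simp: sgn_if)
  consider "0 \<le> a" "0 \<le> b" | "a < 0" "b < 0" | "0 \<le> a" "b < 0" | "a < 0" "0 \<le> b" by linarith
  then show ?thesis
  proof cases
    case 1 then show ?thesis unfolding sg using same'[of a b] by simp
  next
    case 2 then show ?thesis unfolding sg using same'[of "- a" "- b"] by (simp add: abs_minus_commute)
  next
    case 3 then show ?thesis unfolding sg using opp[of a "- b"] by simp
  next
    case 4 then show ?thesis unfolding sg using opp[of "- a" b] by (simp add: abs_minus_commute add.commute)
  qed
qed

lemma S_semigroup_eq: "0 < t \<Longrightarrow> S_semigroup \<beta> t v = (\<lambda>x. \<integral>y. S_kernel \<beta> (x - y) t * v y \<partial>lborel)"
  by (simp add: S_semigroup_def)

text \<open>Continuity of translations in L^s is inherited from L^1 through the signed power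
  g.\<close>

lemma Lp_mass_translate_diff_le:
  fixes f :: "'a::euclidean_space \<Rightarrow> real"
  assumes s: "1 < s" and f [measurable]: "f \<in> borel_measurable borel" and fin: "Lp_mass s f < \<infinity>"
  defines "g \<equiv> \<lambda>x. sgn (f x) * \<bar>f x\<bar> powr s"
  shows "integrable lborel g"
    and "Lp_mass s (\<lambda>x. f (x - z) - f x) \<le> ennreal (2 powr s * L1_modulus g z)"
proof -
  have [measurable]: "g \<in> borel_measurable borel" unfolding g_def by measurable
  have ng: "\<bar>g x\<bar> = \<bar>f x\<bar> powr s" for x using s by (auto simp: g_def abs_mult sgn_if)
  show g: "integrable lborel g"
    using fin by (intro integrableI_bounded) (auto simp: ng Lp_mass_def)
  have "Lp_mass s (\<lambda>x. f (x - z) - f x) \<le> (\<integral>\<^sup>+x. ennreal (2 powr s * \<bar>g (x - z) - g x\<bar>) \<partial>lborel)"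
    unfolding Lp_mass_def g_def using s by (intro nn_integral_mono ennreal_leI abs_diff_powr_le_signed_powr) simp
  also have "\<dots> = ennreal (\<integral>x. 2 powr s * \<bar>g (x - z) - g x\<bar> \<partial>lborel)"
    by (intro nn_integral_eq_integral integrable_mult_right L1_modulus_integrable g) auto
  also have "\<dots> = ennreal (2 powr s * L1_modulus g z)" by (simp add: L1_modulus_def)
  finally show "Lp_mass s (\<lambda>x. f (x - z) - f x) \<le> ennreal (2 powr s * L1_modulus g z)" .
qed

text \<open>The kernel has mass one, so S(t) f - f at x is the average of f y - f x against the
  kernel. Jensen, a reflection and Tonelli give the bound.\<close>

lemma Lp_mass_S_semigroup_diff_le:
  fixes f :: "real^'n \<Rightarrow> real"
  assumes \<beta>: "0 < \<beta>" "\<beta> \<le> 2" and t: "0 < t" and s: "1 < s"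
    and f [measurable]: "f \<in> borel_measurable borel" and B: "AE x in lborel. \<bar>f x\<bar> \<le> B"
  shows "Lp_mass s (\<lambda>x. S_semigroup \<beta> t f x - f x)
    \<le> (\<integral>\<^sup>+z. ennreal (S_kernel \<beta> z t) * Lp_mass s (\<lambda>x. f (x - z) - f x) \<partial>lborel)"
proof -
  have K: "integrable lborel (\<lambda>x::real^'n. S_kernel \<beta> x t)" by (rule S_kernel_integrable[OF \<beta> t])
  have K0: "0 \<le> S_kernel \<beta> x t" for x :: "real^'n" by (rule S_kernel_nonneg[OF \<beta> t])
  have K1: "(\<integral>(x::real^'n). \<bar>S_kernel \<beta> x t\<bar> \<partial>lborel) = 1" using K0 S_kernel_integral[OF \<beta> t] by simp
  have pt: "ennreal (\<bar>S_semigroup \<beta> t f x - f x\<bar> powr s)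
      \<le> (\<integral>\<^sup>+z. ennreal (\<bar>f (x - z) - f x\<bar> powr s) * ennreal (S_kernel \<beta> z t) \<partial>lborel)" for x
  proof -
    \<comment> \<open>Jensen is applied at a fixed x, so the sup bound may depend on f x.\<close>
    have bd: "AE y in lborel. \<bar>f y - f x\<bar> \<le> B + \<bar>f x\<bar>" using B by eventually_elim linarith
    have "(\<integral>y. S_kernel \<beta> (x - y) t * (f y - f x) \<partial>lborel) = (\<integral>y. S_kernel \<beta> (x - y) t * f y - S_kernel \<beta> (x - y) t * f x \<partial>lborel)"
      by (simp add: algebra_simps)
    also have "\<dots> = S_semigroup \<beta> t f x - (\<integral>y. S_kernel \<beta> (x - y) t * f x \<partial>lborel)"
      unfolding S_semigroup_eq[OF t]
      by (intro Bochner_Integration.integral_diff convolution_bounded(1)[OF K f B] integrable_mult_left integrable_reflect K)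
    also have "(\<integral>y. S_kernel \<beta> (x - y) t * f x \<partial>lborel) = f x"
      using integral_reflect[of "\<lambda>y. S_kernel \<beta> y t" x] S_kernel_integral[OF \<beta> t, where 'n = 'n] by simp
    finally have eq: "S_semigroup \<beta> t f x - f x = (\<integral>y. S_kernel \<beta> (x - y) t * (f y - f x) \<partial>lborel)" by simp
    have "ennreal (\<bar>S_semigroup \<beta> t f x - f x\<bar> powr s)
        \<le> (\<integral>\<^sup>+y. ennreal (\<bar>f y - f x\<bar> powr s) * ennreal (S_kernel \<beta> (x - y) t) \<partial>lborel)"
      unfolding eq using convolution_powr_le[OF s K _ bd, of x] K1 K0 by simp
    also have "\<dots> = (\<integral>\<^sup>+z. ennreal (\<bar>f (x - z) - f x\<bar> powr s) * ennreal (S_kernel \<beta> z t) \<partial>lborel)"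
      using nn_integral_reflect[of "\<lambda>z. ennreal (\<bar>f (x - z) - f x\<bar> powr s) * ennreal (S_kernel \<beta> z t)" x] by simp
    finally show ?thesis .
  qed
  have "Lp_mass s (\<lambda>x. S_semigroup \<beta> t f x - f x)
      \<le> (\<integral>\<^sup>+x. (\<integral>\<^sup>+z. ennreal (\<bar>f (x - z) - f x\<bar> powr s) * ennreal (S_kernel \<beta> z t) \<partial>lborel) \<partial>lborel)"
    unfolding Lp_mass_def by (intro nn_integral_mono pt)
  also have "\<dots> = (\<integral>\<^sup>+z. (\<integral>\<^sup>+x. ennreal (\<bar>f (x - z) - f x\<bar> powr s) * ennreal (S_kernel \<beta> z t) \<partial>lborel) \<partial>lborel)"
    by (rule lborel_pair.Fubini'[symmetric]) measurable
  also have "\<dots> = (\<integral>\<^sup>+z. ennreal (S_kernel \<beta> z t) * Lp_mass s (\<lambda>x. f (x - z) - f x) \<partial>lborel)"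
    unfolding Lp_mass_def by (intro nn_integral_cong) (simp add: nn_integral_cmult mult.commute)
  finally show ?thesis .
qed

text \<open>After rescaling, the bound is the integral of the time-one kernel against the modulus at
  t^(1/\<beta>) w. The modulus is at most twice the L^1 norm of g and tends to 0 at 0, so dominated
  convergence applies.\<close>

lemma S_semigroup_tendsto_initial:
  fixes f :: "real^'n \<Rightarrow> real"
  assumes \<beta>: "0 < \<beta>" "\<beta> \<le> 2" and s: "1 < s"
    and f [measurable]: "f \<in> borel_measurable borel" and B: "AE x in lborel. \<bar>f x\<bar> \<le> B"
    and fin: "Lp_mass s f < \<infinity>"
  shows "((\<lambda>t. Lp_mass s (\<lambda>x. S_semigroup \<beta> t f x - f x)) \<longlongrightarrow> 0) (at_right 0)"
proof -
  define g where "g x = sgn (f x) * \<bar>f x\<bar> powr s" for x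
  note tr = Lp_mass_translate_diff_le[OF s f fin, folded g_def]
  have [measurable]: "g \<in> borel_measurable borel" unfolding g_def[abs_def] by measurable
  have m_meas [measurable]: "L1_modulus g \<in> borel_measurable borel"
    unfolding L1_modulus_def[abs_def] by measurable
  have m_bd: "L1_modulus g z \<le> 2 * (\<integral>x. \<bar>g x\<bar> \<partial>lborel)" for z
    using L1_modulus_perturb[OF tr(1), of "\<lambda>x. 0" z] by (simp add: L1_modulus_def)
  have m_lim: "(L1_modulus g \<longlongrightarrow> 0) (at 0)"
    using L1_modulus_tendsto_0[OF tr(1)] .
  have m_0: "L1_modulus g 0 = 0" by (simp add: L1_modulus_def)
  have m_cont: "isCont (L1_modulus g) 0" using m_lim m_0 by (simp add: isCont_def)
  define K where "K z = S_kernel \<beta> z 1" for z :: "real^'n"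
  have K_int: "integrable lborel K" unfolding K_def[abs_def] by (rule S_kernel_integrable[OF \<beta>]) simp
  have [measurable]: "K \<in> borel_measurable borel" using K_int by auto
  have K0: "0 \<le> K z" for z unfolding K_def by (rule S_kernel_nonneg[OF \<beta>]) simp
  have bound: "Lp_mass s (\<lambda>x. S_semigroup \<beta> t f x - f x)
      \<le> ennreal (2 powr s * (\<integral>w. K w * L1_modulus g (t powr (1 / \<beta>) *\<^sub>R w) \<partial>lborel))" if t: "0 < t" for t
  proof -
    define c where "c = t powr (- (1 / \<beta>))"
    have c: "0 < c" using t by (simp add: c_def)
    have ci: "t powr (1 / \<beta>) = 1 / c" by (simp add: c_def powr_minus_divide)
    have int: "integrable lborel (\<lambda>w. K w * L1_modulus g (t powr (1 / \<beta>) *\<^sub>R w))"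
    proof (rule Bochner_Integration.integrable_bound[OF integrable_mult_left[OF K_int, of "2 * (\<integral>x. \<bar>g x\<bar> \<partial>lborel)"]])
      show "AE w in lborel. norm (K w * L1_modulus g (t powr (1 / \<beta>) *\<^sub>R w)) \<le> norm (K w * (2 * (\<integral>x. \<bar>g x\<bar> \<partial>lborel)))"
        using m_bd K0 L1_modulus_nonneg[of g] by (auto simp: abs_mult intro!: mult_left_mono)
    qed measurable
    have "Lp_mass s (\<lambda>x. S_semigroup \<beta> t f x - f x)
        \<le> (\<integral>\<^sup>+z. ennreal (S_kernel \<beta> z t) * Lp_mass s (\<lambda>x. f (x - z) - f x) \<partial>lborel)"
      by (rule Lp_mass_S_semigroup_diff_le[OF \<beta> t s f B])
    also have "\<dots> \<le> (\<integral>\<^sup>+z. ennreal (S_kernel \<beta> z t) * ennreal (2 powr s * L1_modulus g z) \<partial>lborel)"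
      by (intro nn_integral_mono mult_left_mono tr(2)) auto
    also have "\<dots> = (\<integral>\<^sup>+z. ennreal (2 powr s * (c ^ CARD('n) * K (c *\<^sub>R z)) * L1_modulus g z) \<partial>lborel)"
    proof (intro nn_integral_cong)
      fix z :: "real^'n"
      have sc: "S_kernel \<beta> z t = c ^ CARD('n) * K (c *\<^sub>R z)"
        unfolding K_def c_def by (rule S_kernel_scaling[OF \<beta>(1) t])
      show "ennreal (S_kernel \<beta> z t) * ennreal (2 powr s * L1_modulus g z) = ennreal (2 powr s * (c ^ CARD('n) * K (c *\<^sub>R z)) * L1_modulus g z)"
        unfolding sc[symmetric] using S_kernel_nonneg[OF \<beta> t, of z] L1_modulus_nonneg[of g z]
        by (subst ennreal_mult[symmetric]) (simp_all add: mult_ac)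
    qed
    also have "\<dots> = ennreal (\<bar>1 / c\<bar> ^ CARD('n)) * (\<integral>\<^sup>+w. ennreal (2 powr s * (c ^ CARD('n) * K (c *\<^sub>R (0 + (1 / c) *\<^sub>R w))) * L1_modulus g (0 + (1 / c) *\<^sub>R w)) \<partial>lborel)"
      using c by (subst nn_integral_affine[where c = "1 / c" and t = 0]) (simp_all add: ennreal_power)
    also have "\<dots> = (\<integral>\<^sup>+w. ennreal (2 powr s * (K w * L1_modulus g (t powr (1 / \<beta>) *\<^sub>R w))) \<partial>lborel)"
      using c by (subst nn_integral_cmult[symmetric])
        (auto simp: ennreal_mult'[symmetric] ci power_divide mult_ac intro!: nn_integral_cong)
    also have "\<dots> = ennreal (2 powr s * (\<integral>w. K w * L1_modulus g (t powr (1 / \<beta>) *\<^sub>R w) \<partial>lborel))"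
      using int K0 L1_modulus_nonneg[of g] by (subst nn_integral_eq_integral) auto
    finally show ?thesis .
  qed
  have "((\<lambda>t. \<integral>w. K w * L1_modulus g (t powr (1 / \<beta>) *\<^sub>R w) \<partial>lborel) \<longlongrightarrow> 0) (at_right 0)"
    unfolding tendsto_at_iff_sequentially
  proof (intro allI impI)
    fix t :: "nat \<Rightarrow> real" assume t: "\<forall>i. t i \<in> {0<..} - {0}" "t \<longlonglongrightarrow> 0"
    have "(\<lambda>i. t i powr (1 / \<beta>)) \<longlonglongrightarrow> 0 powr (1 / \<beta>)"
      using t \<beta> by (intro tendsto_powr') (auto intro!: always_eventually less_imp_le)
    then have t0: "(\<lambda>i. t i powr (1 / \<beta>)) \<longlonglongrightarrow> 0" by simp
    have "(\<lambda>i. \<integral>w. K w * L1_modulus g (t i powr (1 / \<beta>) *\<^sub>R w) \<partial>lborel) \<longlonglongrightarrow> (\<integral>(w::real^'n). 0 \<partial>lborel)"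
    proof (rule integral_dominated_convergence[where w = "\<lambda>w. K w * (2 * (\<integral>x. \<bar>g x\<bar> \<partial>lborel))"])
      show "AE w in lborel. (\<lambda>i. K w * L1_modulus g (t i powr (1 / \<beta>) *\<^sub>R w)) \<longlonglongrightarrow> 0"
      proof (rule AE_I2)
        fix w :: "real^'n"
        have "(\<lambda>i. t i powr (1 / \<beta>) *\<^sub>R w) \<longlonglongrightarrow> 0 *\<^sub>R w" by (intro tendsto_intros t0)
        then have "(\<lambda>i. t i powr (1 / \<beta>) *\<^sub>R w) \<longlonglongrightarrow> 0" by simp
        from tendsto_mult_left[OF isCont_tendsto_compose[OF m_cont this], of "K w"]
        show "(\<lambda>i. K w * L1_modulus g (t i powr (1 / \<beta>) *\<^sub>R w)) \<longlonglongrightarrow> 0" by (simp add: m_0)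
      qed
      show "AE w in lborel. norm (K w * L1_modulus g (t i powr (1 / \<beta>) *\<^sub>R w)) \<le> K w * (2 * (\<integral>x. \<bar>g x\<bar> \<partial>lborel))" for i
        using m_bd K0 L1_modulus_nonneg[of g] by (auto simp: abs_mult intro!: mult_left_mono)
    qed (use K_int in auto)
    then show "((\<lambda>t. \<integral>w. K w * L1_modulus g (t powr (1 / \<beta>) *\<^sub>R w) \<partial>lborel) \<circ> t) \<longlonglongrightarrow> 0"
      by (simp add: o_def)
  qed
  then have "((\<lambda>t. ennreal (2 powr s * (\<integral>w. K w * L1_modulus g (t powr (1 / \<beta>) *\<^sub>R w) \<partial>lborel))) \<longlongrightarrow> ennreal (2 powr s * 0)) (at_right 0)"
    by (intro tendsto_intros)
  then have lim: "((\<lambda>t. ennreal (2 powr s * (\<integral>w. K w * L1_modulus g (t powr (1 / \<beta>) *\<^sub>R w) \<partial>lborel))) \<longlongrightarrow> 0) (at_right 0)"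
    by simp
  show ?thesis
    by (rule tendsto_sandwich[OF _ _ tendsto_const lim])
       (auto simp: eventually_at_right_less intro: bound eventually_mono[OF eventually_at_right_less])
qed

section \<open>The Riesz potential\<close>

lemma weighted_geometric_le:
  fixes x y \<mu> \<theta> :: real
  assumes "0 \<le> x" "0 \<le> y" "0 \<le> \<mu>" "0 \<le> \<theta>"
  shows "x powr \<mu> * y powr \<theta> \<le> (x + y) powr (\<mu> + \<theta>)"
  unfolding powr_add using assms by (intro mult_mono powr_mono2) auto

text \<open>Lebesgue measure is not zero. The lemma reads off the signs of bounds that are known
  only through almost-everywhere inequalities.\<close>

lemma AE_lborel_const: "AE (y::'a::euclidean_space) in lborel. P \<Longrightarrow> P"
  by (simp add: eventually_const_iff ae_filter_eq_bot_iff)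

text \<open>For a < n the kernel |z|^(- a) fails to be integrable only at infinity; there the
  exponent is enlarged to a / (1 - \<theta>), which exceeds the dimension when n (1 - \<theta>) <
  a.\<close>

definition riesz_majorant :: "real \<Rightarrow> real \<Rightarrow> 'a::euclidean_space \<Rightarrow> real" where
  "riesz_majorant a \<theta> z = (if norm z \<le> 1 then norm z powr - a else 0) + (if norm z \<le> 1 then 0 else norm z powr - (a / (1 - \<theta>)))"

lemma riesz_majorant_measurable [measurable]: "riesz_majorant a \<theta> \<in> borel_measurable borel"
  unfolding riesz_majorant_def[abs_def] by measurable

lemma riesz_majorant_nonneg: "0 \<le> riesz_majorant a \<theta> z"
  by (simp add: riesz_majorant_def)

lemma riesz_majorant_integrable:
  assumes "0 \<le> a" "a < real DIM('a)" "\<theta> < 1" "real DIM('a) * (1 - \<theta>) < a"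
  shows "integrable lborel (riesz_majorant a \<theta> :: 'a::euclidean_space \<Rightarrow> real)"
  unfolding riesz_majorant_def[abs_def] using assms
  by (intro Bochner_Integration.integrable_add integrable_powr_inside_ball integrable_powr_outside_ball)
     (auto simp: field_simps)

text \<open>Near the origin the factor \<open>g\<close> is bounded by \<open>A\<close>; far from it, the kernel equals
  \<open>riesz_majorant a \<theta> z powr (1 - \<theta>)\<close> and the decay is completed by the integrability of
  \<open>g powr (1 / \<theta>)\<close>. The case \<open>\<sigma> = 0\<close> gives sup bounds, \<open>\<sigma> = 1 / s\<close> gives \<open>L\<^sup>s\<close> bounds.\<close>

lemma riesz_kernel_mult_le:
  fixes z :: "'a::euclidean_space"
  assumes \<theta>: "0 < \<theta>" "\<theta> < 1" and \<sigma>: "0 \<le> \<sigma>" "\<sigma> + \<theta> \<le> 1" "\<sigma> < 1"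
    and g: "0 \<le> g" "g \<le> A"
  shows "norm z powr - a * g \<le> riesz_majorant a \<theta> z powr \<sigma> *
    ((A + 1) powr (1 / (1 - \<sigma>)) * riesz_majorant a \<theta> z + g powr (1 / \<theta>)) powr (1 - \<sigma>)"
proof -
  let ?j = "riesz_majorant a \<theta> z"
  let ?A = "(A + 1) powr (1 / (1 - \<sigma>))"
  have j0: "0 \<le> ?j" by (rule riesz_majorant_nonneg)
  have A0: "0 \<le> A" using g by simp
  have A1: "1 \<le> ?A" using \<sigma> A0 by (intro ge_one_powr_ge_zero) auto
  have Apow: "?A powr (1 - \<sigma>) = A + 1" using \<sigma> A0 by (simp add: powr_powr)
  have split: "?j = ?j powr \<sigma> * ?j powr (1 - \<sigma>)"
    using j0 by (cases "?j = 0") (simp_all add: powr_add[symmetric])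
  show ?thesis
  proof (cases "norm z \<le> 1")
    case True
    then have "norm z powr - a * g = ?j * g" by (simp add: riesz_majorant_def)
    also have "\<dots> \<le> ?j * (A + 1)" using j0 g by (intro mult_left_mono) auto
    also have "\<dots> = ?j powr \<sigma> * (?A * ?j) powr (1 - \<sigma>)"
      using A1 j0 Apow by (subst split) (simp add: powr_mult)
    also have "\<dots> \<le> ?j powr \<sigma> * (?A * ?j + g powr (1 / \<theta>)) powr (1 - \<sigma>)"
      using A1 j0 \<sigma> by (intro mult_left_mono powr_mono2) auto
    finally show ?thesis .
  next
    case False
    have k: "norm z powr - a = ?j powr (1 - \<theta>)"
      using False \<theta> by (simp add: riesz_majorant_def powr_powr)
    have gp: "g = (g powr (1 / \<theta>)) powr \<theta>" using g \<theta> by (cases "g = 0") (simp_all add: powr_powr)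
    have "norm z powr - a * g = ?j powr \<sigma> * (?j powr (1 - \<theta> - \<sigma>) * (g powr (1 / \<theta>)) powr \<theta>)"
      unfolding k using gp by (simp add: mult.assoc[symmetric] powr_add[symmetric])
    also have "\<dots> \<le> ?j powr \<sigma> * (?j + g powr (1 / \<theta>)) powr (1 - \<theta> - \<sigma> + \<theta>)"
      using j0 \<theta> \<sigma> by (intro mult_left_mono weighted_geometric_le) auto
    also have "1 - \<theta> - \<sigma> + \<theta> = 1 - \<sigma>" by simp
    also have "?j powr \<sigma> * (?j + g powr (1 / \<theta>)) powr (1 - \<sigma>) \<le> ?j powr \<sigma> * (?A * ?j + g powr (1 / \<theta>)) powr (1 - \<sigma>)"
      using A1 j0 \<sigma> by (intro mult_left_mono powr_mono2) (auto intro!: add_mono mult_left_mono simp: mult_le_cancel_right1)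
    finally show ?thesis .
  qed
qed

context
  fixes a \<theta> A B :: real and g :: "'a::euclidean_space \<Rightarrow> real"
  assumes a: "0 \<le> a" "a < real DIM('a)" and \<theta>: "0 < \<theta>" "\<theta> < 1" "real DIM('a) * (1 - \<theta>) < a"
    and g [measurable]: "g \<in> borel_measurable borel" and g0: "\<And>y. 0 \<le> g y" and gA: "AE y in lborel. g y \<le> A"
    and gm: "integrable lborel (\<lambda>y. g y powr (1 / \<theta>))" "(\<integral>y. g y powr (1 / \<theta>) \<partial>lborel) \<le> B"
begin

text \<open>In this context g is the bounded factor of the source with an integrable power 1 /
  \<theta>, and the factor h is to be estimated. The weight dominates kernel times g up to a power
  of the majorant, and its total mass is bounded uniformly in x.\<close>

definition riesz_weight :: "real \<Rightarrow> 'a \<Rightarrow> 'a \<Rightarrow> real" where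
  "riesz_weight \<sigma> x y = (A + 1) powr (1 / (1 - \<sigma>)) * riesz_majorant a \<theta> (x - y) + g y powr (1 / \<theta>)"

lemma riesz_weight_measurable [measurable]: "riesz_weight \<sigma> x \<in> borel_measurable borel"
  unfolding riesz_weight_def[abs_def] by measurable

lemma riesz_weight_nonneg: "0 \<le> riesz_weight \<sigma> x y"
  unfolding riesz_weight_def by (intro add_nonneg_nonneg mult_nonneg_nonneg riesz_majorant_nonneg) auto

lemma riesz_weight_integrable: "integrable lborel (riesz_weight \<sigma> x)"
  unfolding riesz_weight_def[abs_def]
  by (intro Bochner_Integration.integrable_add integrable_mult_right integrable_reflect riesz_majorant_integrable a \<theta> gm)

lemma riesz_weight_integral:
  "(\<integral>y. riesz_weight \<sigma> x y \<partial>lborel) \<le> (A + 1) powr (1 / (1 - \<sigma>)) * (\<integral>(z::'a). riesz_majorant a \<theta> z \<partial>lborel) + B"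
proof -
  have j: "integrable lborel (riesz_majorant a \<theta> :: 'a \<Rightarrow> real)" by (intro riesz_majorant_integrable a \<theta>)
  have "(\<integral>y. riesz_weight \<sigma> x y \<partial>lborel) = (A + 1) powr (1 / (1 - \<sigma>)) * (\<integral>y. riesz_majorant a \<theta> (x - y) \<partial>lborel) + (\<integral>y. g y powr (1 / \<theta>) \<partial>lborel)"
    unfolding riesz_weight_def
    by (subst Bochner_Integration.integral_add[OF integrable_mult_right[OF integrable_reflect[OF j]] gm(1)]) simp
  then show ?thesis using gm(2) integral_reflect[of "riesz_majorant a \<theta> :: 'a \<Rightarrow> real" x] by simp
qed

text \<open>For \<sigma> = 0 the power of the majorant disappears and the weight alone dominates
  kernel times g.\<close>

lemma riesz_sup_bound:
  assumes h [measurable]: "h \<in> borel_measurable borel" and H: "AE y in lborel. \<bar>h y\<bar> \<le> H"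
  shows "integrable lborel (\<lambda>y. g y * h y / norm (x - y) powr a)"
    and "\<bar>\<integral>y. g y * h y / norm (x - y) powr a \<partial>lborel\<bar> \<le> ((A + 1) * (\<integral>(z::'a). riesz_majorant a \<theta> z \<partial>lborel) + B) * H"
proof -
  have wH: "integrable lborel (\<lambda>y. riesz_weight 0 x y * H)"
    by (intro integrable_mult_left riesz_weight_integrable)
  have le: "AE y in lborel. \<bar>g y * h y / norm (x - y) powr a\<bar> \<le> riesz_weight 0 x y * H"
    using gA H
  proof eventually_elim
    case (elim y)
    have "norm (x - y) powr - a * g y \<le> riesz_majorant a \<theta> (x - y) powr 0 * (riesz_weight 0 x y) powr (1 - 0)"
      unfolding riesz_weight_def using \<theta> g0 elim by (intro riesz_kernel_mult_le) auto
    also have "\<dots> \<le> riesz_weight 0 x y" using riesz_weight_nonneg by simp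
    finally have "norm (x - y) powr - a * g y * \<bar>h y\<bar> \<le> riesz_weight 0 x y * H"
      using elim g0 riesz_weight_nonneg by (intro mult_mono) auto
    then show ?case using g0[of y] by (simp add: abs_mult powr_minus_divide mult_ac)
  qed
  show int: "integrable lborel (\<lambda>y. g y * h y / norm (x - y) powr a)"
  proof (rule Bochner_Integration.integrable_bound[OF wH])
    show "AE y in lborel. norm (g y * h y / norm (x - y) powr a) \<le> norm (riesz_weight 0 x y * H)"
      using le by eventually_elim auto
  qed measurable
  have "AE (y::'a) in lborel. 0 \<le> H" using H by eventually_elim auto
  then have H0: "0 \<le> H" by (rule AE_lborel_const)
  have "\<bar>\<integral>y. g y * h y / norm (x - y) powr a \<partial>lborel\<bar> \<le> (\<integral>y. \<bar>g y * h y / norm (x - y) powr a\<bar> \<partial>lborel)"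
    by (rule integral_abs_bound)
  also have "\<dots> \<le> (\<integral>y. riesz_weight 0 x y * H \<partial>lborel)"
    by (rule integral_mono_AE[OF integrable_abs[OF int] wH le])
  also have "\<dots> = (\<integral>y. riesz_weight 0 x y \<partial>lborel) * H" by simp
  also have "\<dots> \<le> ((A + 1) powr (1 / (1 - 0)) * (\<integral>(z::'a). riesz_majorant a \<theta> z \<partial>lborel) + B) * H"
    by (intro mult_right_mono riesz_weight_integral H0)
  also have "(A + 1) powr (1 / (1 - 0)) = A + 1"
  proof -
    have "AE (y::'a) in lborel. 0 \<le> A" using gA by eventually_elim (use g0 order_trans in blast)
    then have "0 \<le> A" by (rule AE_lborel_const)
    then show ?thesis by simp
  qed
  finally show "\<bar>\<integral>y. g y * h y / norm (x - y) powr a \<partial>lborel\<bar> \<le> ((A + 1) * (\<integral>(z::'a). riesz_majorant a \<theta> z \<partial>lborel) + B) * H" .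
qed

text \<open>For \<sigma> = 1 / s, kernel times g is at most j^(1/s) w^(1 - 1/s), where j is the
  majorant and w the weight. Jensen with weight w turns the s-th power into the integral of h^s j, a
  convolution with an integrable function, at the cost of W^(s - 1).\<close>

lemma riesz_Lp_bound:
  assumes s: "1 < s" "\<theta> \<le> 1 - 1 / s"
    and h [measurable]: "h \<in> borel_measurable borel" and h0: "\<And>y. 0 \<le> h y" and H: "AE y in lborel. h y \<le> H"
  defines "W \<equiv> (A + 1) powr (1 / (1 - 1 / s)) * (\<integral>(z::'a). riesz_majorant a \<theta> z \<partial>lborel) + B"
  shows "Lp_mass s (\<lambda>x. \<integral>y. g y * h y / norm (x - y) powr a \<partial>lborel)
    \<le> ennreal (W powr (s - 1) * (\<integral>(z::'a). riesz_majorant a \<theta> z \<partial>lborel)) * Lp_mass s h"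
proof -
  let ?j = "riesz_majorant a \<theta> :: 'a \<Rightarrow> real"
  let ?w = "\<lambda>x. riesz_weight (1 / s) x"
  have j: "integrable lborel ?j" by (intro riesz_majorant_integrable a \<theta>)
  have jx: "integrable lborel (\<lambda>y. ?j (x - y))" for x using integrable_reflect[OF j] .
  have w0: "0 \<le> ?w x y" for x y by (rule riesz_weight_nonneg)
  have Ws: "(\<integral>y. ?w x y \<partial>lborel) \<le> W" for x unfolding W_def by (rule riesz_weight_integral)
  have s1: "0 < 1 - 1 / s" "0 < 1 / s" "1 / s < 1" using s by auto
  have jw: "?j (x - y) \<le> ?w x y" if "0 \<le> A" for x y
  proof -
    have "1 \<le> (A + 1) powr (1 / (1 - 1 / s))" using s1 that by (intro ge_one_powr_ge_zero) auto
    then have "1 * ?j (x - y) \<le> (A + 1) powr (1 / (1 - 1 / s)) * ?j (x - y)"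
      by (intro mult_right_mono riesz_majorant_nonneg)
    then show ?thesis unfolding riesz_weight_def by (simp add: add_increasing2)
  qed
  have "AE (y::'a) in lborel. 0 \<le> A" using gA by eventually_elim (use g0 order_trans in blast)
  then have A0: "0 \<le> A" by (rule AE_lborel_const)
  have pt: "ennreal (\<bar>\<integral>y. g y * h y / norm (x - y) powr a \<partial>lborel\<bar> powr s)
      \<le> ennreal (W powr (s - 1)) * (\<integral>\<^sup>+y. ennreal (h y powr s) * ennreal (?j (x - y)) \<partial>lborel)" for x
  proof -
    \<comment> \<open>Chosen so that f^s w = h^s j, while f w still dominates the integrand.\<close>
    define f where "f y = h y * (?j (x - y) / ?w x y) powr (1 / s)" for y
    have [measurable]: "f \<in> borel_measurable borel" unfolding f_def[abs_def] by measurable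
    have f0: "0 \<le> f y" for y unfolding f_def using h0 by simp
    have fs: "f y powr s * ?w x y = h y powr s * ?j (x - y)" for y
    \<comment> \<open>Division by zero is harmless: 0 \<le> j \<le> w, so j vanishes together with
      w.\<close>
    proof (cases "?w x y = 0")
      case True
      then have "?j (x - y) = 0" using jw[OF A0, of x y] riesz_majorant_nonneg[of a \<theta> "x - y"] by simp
      then show ?thesis using True by simp
    next
      case False
      have "0 \<le> ?j (x - y) / ?w x y" using w0 riesz_majorant_nonneg by (intro divide_nonneg_nonneg)
      then have "f y powr s = h y powr s * (?j (x - y) / ?w x y)"
        unfolding f_def using h0 s by (simp add: powr_mult powr_powr abs_of_nonneg[OF w0] abs_of_nonneg[OF riesz_majorant_nonneg])
      then show ?thesis using False by simp
    qed
    have hj: "integrable lborel (\<lambda>y. h y powr s * ?j (x - y))"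
    proof (rule Bochner_Integration.integrable_bound[OF integrable_mult_right[OF jx, of "H powr s" x]])
      show "AE y in lborel. norm (h y powr s * ?j (x - y)) \<le> norm (H powr s * ?j (x - y))"
        using H
      proof eventually_elim
        case (elim y)
        then show ?case using s h0[of y] riesz_majorant_nonneg[of a \<theta> "x - y"]
          by (auto simp: abs_mult intro!: mult_right_mono powr_mono2)
      qed
    qed measurable
    then have fsw: "integrable lborel (\<lambda>y. f y powr s * ?w x y)" by (simp only: fs)
    note J = jensen_powr[OF s(1) riesz_weight_integrable w0 _ f0 fsw]
    have fw: "integrable lborel (\<lambda>y. f y * ?w x y)" by (rule J(1)) measurable
    have le: "AE y in lborel. g y * h y / norm (x - y) powr a \<le> f y * ?w x y"
      using gA
    proof eventually_elim
      case (elim y)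
      have "norm (x - y) powr - a * g y \<le> ?j (x - y) powr (1 / s) * (?w x y) powr (1 - 1 / s)"
        unfolding riesz_weight_def
        by (intro riesz_kernel_mult_le \<theta>(1,2) g0 elim) (use s s1 in auto)
      also have "\<dots> = (?j (x - y) / ?w x y) powr (1 / s) * ?w x y"
      proof (cases "?w x y = 0")
        case False
        then show ?thesis
          using w0[of x y] by (simp add: powr_divide riesz_majorant_nonneg powr_diff)
      qed (use s1 in simp)
      finally have "norm (x - y) powr - a * g y * h y \<le> (?j (x - y) / ?w x y) powr (1 / s) * ?w x y * h y"
        using h0 by (intro mult_right_mono)
      then show ?case by (simp add: f_def powr_minus_divide mult_ac)
    qed
    have nonneg: "0 \<le> (\<integral>y. g y * h y / norm (x - y) powr a \<partial>lborel)"
      using g0 h0 by (intro Bochner_Integration.integral_nonneg) simp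
    have "(\<integral>y. g y * h y / norm (x - y) powr a \<partial>lborel) \<le> (\<integral>y. f y * ?w x y \<partial>lborel)"
    proof (rule integral_mono_AE[OF riesz_sup_bound(1)[OF h] fw le])
      show "AE y in lborel. \<bar>h y\<bar> \<le> H" using H by eventually_elim (use h0 in simp)
    qed
    then have "\<bar>\<integral>y. g y * h y / norm (x - y) powr a \<partial>lborel\<bar> powr s \<le> (\<integral>y. f y * ?w x y \<partial>lborel) powr s"
      using nonneg s by (intro powr_mono2) auto
    also have "\<dots> \<le> (\<integral>y. ?w x y \<partial>lborel) powr (s - 1) * (\<integral>y. f y powr s * ?w x y \<partial>lborel)"
      by (rule J(2)) measurable
    also have "\<dots> \<le> W powr (s - 1) * (\<integral>y. f y powr s * ?w x y \<partial>lborel)"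
      using s Ws w0 by (intro mult_right_mono powr_mono2 Bochner_Integration.integral_nonneg) auto
    finally have "ennreal (\<bar>\<integral>y. g y * h y / norm (x - y) powr a \<partial>lborel\<bar> powr s)
        \<le> ennreal (W powr (s - 1)) * ennreal (\<integral>y. h y powr s * ?j (x - y) \<partial>lborel)"
      by (simp add: ennreal_mult'[symmetric] ennreal_leI fs)
    also have "ennreal (\<integral>y. h y powr s * ?j (x - y) \<partial>lborel) = (\<integral>\<^sup>+y. ennreal (h y powr s * ?j (x - y)) \<partial>lborel)"
      by (rule nn_integral_eq_integral[OF hj, symmetric]) (simp add: riesz_majorant_nonneg)
    finally show ?thesis by (simp add: ennreal_mult' )
  qed
  have "Lp_mass s (\<lambda>x. \<integral>y. g y * h y / norm (x - y) powr a \<partial>lborel)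
      \<le> (\<integral>\<^sup>+x. ennreal (W powr (s - 1)) * (\<integral>\<^sup>+y. ennreal (h y powr s) * ennreal (?j (x - y)) \<partial>lborel) \<partial>lborel)"
    unfolding Lp_mass_def by (intro nn_integral_mono pt)
  also have "\<dots> = ennreal (W powr (s - 1)) * (\<integral>\<^sup>+x. (\<integral>\<^sup>+y. ennreal (h y powr s) * ennreal (?j (x - y)) \<partial>lborel) \<partial>lborel)"
    by (rule nn_integral_cmult) measurable
  also have "(\<integral>\<^sup>+x. (\<integral>\<^sup>+y. ennreal (h y powr s) * ennreal (?j (x - y)) \<partial>lborel) \<partial>lborel)
      = (\<integral>\<^sup>+y. (\<integral>\<^sup>+x. ennreal (h y powr s) * ennreal (?j (x - y)) \<partial>lborel) \<partial>lborel)"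
    by (rule lborel_pair.Fubini'[symmetric]) measurable
  also have "\<dots> = (\<integral>\<^sup>+y. ennreal (h y powr s) * ennreal (\<integral>z. ?j z \<partial>lborel) \<partial>lborel)"
  proof (intro nn_integral_cong)
    fix y
    have "(\<integral>\<^sup>+x. ennreal (h y powr s) * ennreal (?j (x - y)) \<partial>lborel) = ennreal (h y powr s) * (\<integral>\<^sup>+x. ennreal (?j (x - y)) \<partial>lborel)"
      by (rule nn_integral_cmult) measurable
    also have "(\<integral>\<^sup>+x. ennreal (?j (x - y)) \<partial>lborel) = (\<integral>\<^sup>+x. ennreal (?j x) \<partial>lborel)"
      using nn_integral_translate[of "\<lambda>x. ennreal (?j x)" y] by simp
    also have "\<dots> = ennreal (\<integral>z. ?j z \<partial>lborel)"
      by (rule nn_integral_eq_integral[OF j]) (simp add: riesz_majorant_nonneg)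
    finally show "(\<integral>\<^sup>+x. ennreal (h y powr s) * ennreal (?j (x - y)) \<partial>lborel) = ennreal (h y powr s) * ennreal (\<integral>z. ?j z \<partial>lborel)" .
  qed
  also have "\<dots> = Lp_mass s h * ennreal (\<integral>z. ?j z \<partial>lborel)"
    unfolding Lp_mass_def using h0 by (subst nn_integral_multc[symmetric]) auto
  also have "ennreal (W powr (s - 1)) * (Lp_mass s h * ennreal (\<integral>z. ?j z \<partial>lborel))
      = ennreal (W powr (s - 1) * (\<integral>z. ?j z \<partial>lborel)) * Lp_mass s h"
    by (subst ennreal_mult') (simp_all add: mult_ac)
  finally show ?thesis .
qed

end

section \<open>The nonlinear source term\<close>

text \<open>For b \<le> a the tangent of x^p at a gives the factor p a^(p - 1), enlarged to the
  symmetric p (a + b)^(p - 1).\<close>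

lemma abs_powr_diff_le:
  fixes a b p :: real
  assumes p: "1 < p" and ab: "0 \<le> a" "0 \<le> b"
  shows "\<bar>a powr p - b powr p\<bar> \<le> p * (a + b) powr (p - 1) * \<bar>a - b\<bar>"
proof -
  have *: "\<bar>a powr p - b powr p\<bar> \<le> p * (a + b) powr (p - 1) * \<bar>a - b\<bar>" if "0 \<le> b" "b \<le> a" for a b :: real
  proof -
    have "b powr p \<le> a powr p" using that p by (intro powr_mono2) auto
    then have "\<bar>a powr p - b powr p\<bar> = a powr p - b powr p" by simp
    also have "\<dots> \<le> p * a powr (p - 1) * (a - b)"
      using powr_tangent[OF p, of b a] that by (simp add: algebra_simps)
    also have "\<dots> \<le> p * (a + b) powr (p - 1) * (a - b)"
      using that p by (intro mult_right_mono mult_left_mono powr_mono2) auto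
    finally show ?thesis using that by simp
  qed
  show ?thesis
  proof (cases "b \<le> a")
    case False
    then show ?thesis using *[of a b] ab by (simp add: abs_minus_commute add.commute)
  qed (use * ab in auto)
qed

text \<open>One number M bounds both the sup norm and the s-th power of the L^s norm, so that
  existence times depend on a single size parameter.\<close>

definition data_ball :: "real \<Rightarrow> real \<Rightarrow> ('a::euclidean_space \<Rightarrow> real) \<Rightarrow> bool" where
  "data_ball s M u \<longleftrightarrow> u \<in> borel_measurable borel \<and> (AE x in lborel. \<bar>u x\<bar> \<le> M) \<and> Lp_mass s u \<le> ennreal M"

lemma data_ballD:
  assumes "data_ball s M u"
  shows "u \<in> borel_measurable borel" "AE x in lborel. \<bar>u x\<bar> \<le> M" "Lp_mass s u \<le> ennreal M"
  using assms by (auto simp: data_ball_def)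

lemma data_ball_nonneg: "data_ball s M (u :: 'a::euclidean_space \<Rightarrow> real) \<Longrightarrow> 0 \<le> M"
proof -
  assume "data_ball s M u"
  then have "AE x in lborel. \<bar>u x\<bar> \<le> M" by (rule data_ballD)
  then have "AE (x::'a) in lborel. 0 \<le> M" by eventually_elim simp
  then show ?thesis by (rule AE_lborel_const)
qed

lemma Lp_mass_zero: "Lp_mass s (\<lambda>x. 0) = 0"
  by (simp add: Lp_mass_def)

lemma data_ball_zero: "0 \<le> M \<Longrightarrow> data_ball s M (\<lambda>x. 0)"
  by (simp add: data_ball_def Lp_mass_zero)

lemma data_ball_mono: "data_ball s M u \<Longrightarrow> M \<le> M' \<Longrightarrow> data_ball s M' u"
  unfolding data_ball_def by (auto elim: eventually_mono intro: order_trans ennreal_leI)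

lemma Lp_mass_cmult: "f \<in> borel_measurable borel \<Longrightarrow> Lp_mass s (\<lambda>x. c * f x) = ennreal (\<bar>c\<bar> powr s) * Lp_mass s f"
  unfolding Lp_mass_def by (subst nn_integral_cmult[symmetric]) (auto simp: abs_mult powr_mult ennreal_mult)

lemma Lp_mass_mono_AE:
  assumes "0 < s" "AE x in lborel. \<bar>f x\<bar> \<le> \<bar>g x\<bar>"
  shows "Lp_mass s f \<le> Lp_mass s g"
  unfolding Lp_mass_def using assms(2)
  by (intro nn_integral_mono_AE) (auto elim!: eventually_mono intro!: ennreal_leI powr_mono2 simp: less_imp_le[OF assms(1)])

lemma Lp_mass_add_le:
  assumes [measurable]: "f \<in> borel_measurable borel" "g \<in> borel_measurable borel" and s: "0 < s"
  shows "Lp_mass s (\<lambda>x. f x + g x) \<le> ennreal (2 powr s) * (Lp_mass s f + Lp_mass s g)"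
proof -
  have "\<bar>f x + g x\<bar> powr s \<le> 2 powr s * (\<bar>f x\<bar> powr s + \<bar>g x\<bar> powr s)" for x
  proof -
    have "\<bar>f x + g x\<bar> powr s \<le> (\<bar>f x\<bar> + \<bar>g x\<bar>) powr s" using s by (intro powr_mono2) auto
    also have "\<dots> \<le> 2 powr s * (\<bar>f x\<bar> powr s + \<bar>g x\<bar> powr s)" using s by (intro powr_add_le) auto
    finally show ?thesis .
  qed
  then have "Lp_mass s (\<lambda>x. f x + g x) \<le> (\<integral>\<^sup>+x. ennreal (2 powr s) * (ennreal (\<bar>f x\<bar> powr s) + ennreal (\<bar>g x\<bar> powr s)) \<partial>lborel)"
    unfolding Lp_mass_def
    by (intro nn_integral_mono) (simp add: ennreal_mult[symmetric] ennreal_plus[symmetric] ennreal_leI del: ennreal_plus)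
  also have "\<dots> = ennreal (2 powr s) * (Lp_mass s f + Lp_mass s g)"
    unfolding Lp_mass_def by (simp add: nn_integral_cmult nn_integral_add)
  finally show ?thesis .
qed

locale fractional_problem =
  fixes \<alpha> \<beta> p s :: real and dim :: "'n::finite itself"
  assumes \<beta>: "0 < \<beta>" "\<beta> \<le> 2"
    and \<alpha>: "0 < \<alpha>" "\<alpha> < real CARD('n)"
    and p_gt: "p > real CARD('n) / (real CARD('n) - \<alpha>)"
    and s_gt: "real CARD('n) / (real CARD('n) - \<alpha>) < s"
    and s_lt: "s < real CARD('n) * (p - 1) / \<alpha>"
begin

lemma crit_gt_1: "1 < real CARD('n) / (real CARD('n) - \<alpha>)"
  using \<alpha> by (simp add: field_simps)

lemma p_gt_1: "1 < p" and s_gt_1: "1 < s"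
  using crit_gt_1 p_gt s_gt by linarith+

text \<open>The first entry lets (|u| + |v|)^((p - 1) / \<theta>) be controlled by the L^s mass and
  the sup bound; the second is the condition \<sigma> + \<theta> \<le> 1 for \<sigma> = 1 / s. The
  majorant requires \<theta> > \<alpha> / n: the upper bound on s puts the first entry above
  \<alpha> / n, the lower bound on s the second.\<close>

definition \<theta> :: real where "\<theta> = min ((p - 1) / s) (1 - 1 / s)"

lemma \<theta>_props: "0 < \<theta>" "\<theta> < 1" "\<theta> \<le> 1 - 1 / s" "s \<le> (p - 1) / \<theta>"
    "real DIM(real^'n) * (1 - \<theta>) < real CARD('n) - \<alpha>"
proof -
  show "0 < \<theta>" "\<theta> < 1" "\<theta> \<le> 1 - 1 / s" using p_gt_1 s_gt_1 by (auto simp: \<theta>_def min_less_iff_disj)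
  have "\<theta> \<le> (p - 1) / s" by (simp add: \<theta>_def)
  then show "s \<le> (p - 1) / \<theta>" using \<open>0 < \<theta>\<close> s_gt_1 by (simp add: field_simps)
  have "\<alpha> < real CARD('n) * ((p - 1) / s)" using s_lt \<alpha> s_gt_1 by (simp add: field_simps)
  moreover have "\<alpha> < real CARD('n) * (1 - 1 / s)" using s_gt \<alpha> s_gt_1 by (simp add: field_simps)
  ultimately have "\<alpha> < real CARD('n) * \<theta>" by (auto simp: \<theta>_def min_def)
  then show "real DIM(real^'n) * (1 - \<theta>) < real CARD('n) - \<alpha>" by (simp add: algebra_simps)
qed

definition source :: "(real^'n \<Rightarrow> real) \<Rightarrow> real^'n \<Rightarrow> real" where
  "source u = riesz_potential \<alpha> (\<lambda>y. \<bar>u y\<bar> powr p)"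

lemma riesz_const_pos: "0 < riesz_const CARD('n) \<alpha>"
  unfolding riesz_const_def using \<alpha> by (intro divide_pos_pos mult_pos_pos Gamma_real_pos) auto

lemma source_eq: "source u x = riesz_const CARD('n) \<alpha> * (\<integral>y. \<bar>u y\<bar> powr p / norm (x - y) powr (real CARD('n) - \<alpha>) \<partial>lborel)"
  by (simp add: source_def riesz_potential_def)

lemma source_cong_AE: "AE y in lborel. u y = v y \<Longrightarrow> u \<in> borel_measurable borel \<Longrightarrow> v \<in> borel_measurable borel \<Longrightarrow> source u = source v"
  unfolding source_eq fun_eq_iff by (intro allI arg_cong2[where f="(*)"] refl integral_cong_AE) (auto elim: eventually_mono)

lemma source_nonneg: "0 \<le> source u x"
  unfolding source_eq using riesz_const_pos by (intro mult_nonneg_nonneg Bochner_Integration.integral_nonneg) auto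

lemma source_measurable [measurable (raw)]:
  assumes [measurable]: "case_prod u \<in> borel_measurable (N \<Otimes>\<^sub>M borel)" "h \<in> N \<rightarrow>\<^sub>M borel"
  shows "(\<lambda>z. source (u z) (h z)) \<in> borel_measurable N"
  unfolding source_eq by measurable

text \<open>These are the hypotheses of the kernel bounds for the factorisation of |u|^p - |v|^p as
  g h. The power 1 / \<theta> of g has exponent (p - 1) / \<theta>, split into s, controlled by the
  masses, and a nonnegative remainder, controlled by the sup bound 2 M.\<close>

lemma difference_quotient:
  fixes u v :: "real^'n \<Rightarrow> real"
  assumes u: "data_ball s M u" and v: "data_ball s M v"
  defines "g \<equiv> \<lambda>y. (\<bar>u y\<bar> + \<bar>v y\<bar>) powr (p - 1)"
  defines "h \<equiv> \<lambda>y. (\<bar>u y\<bar> powr p - \<bar>v y\<bar> powr p) / g y"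
  shows "g \<in> borel_measurable borel" "h \<in> borel_measurable borel" "0 \<le> g y"
    "AE y in lborel. g y \<le> (2 * M) powr (p - 1)"
    "integrable lborel (\<lambda>y. g y powr (1 / \<theta>))"
    "(\<integral>y. g y powr (1 / \<theta>) \<partial>lborel) \<le> (2 * M) powr ((p - 1) / \<theta> - s) * 2 powr s * (2 * M)"
    "\<bar>h y\<bar> \<le> p * \<bar>u y - v y\<bar>"
    "g y * h y = \<bar>u y\<bar> powr p - \<bar>v y\<bar> powr p"
proof -
  have M: "0 \<le> M" using data_ball_nonneg[OF u] .
  have [measurable]: "u \<in> borel_measurable borel" "v \<in> borel_measurable borel" using data_ballD u v by auto
  show g_meas [measurable]: "g \<in> borel_measurable borel" unfolding g_def by measurable
  show [measurable]: "h \<in> borel_measurable borel" unfolding h_def by measurable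
  show "0 \<le> g y" by (simp add: g_def)
  have w: "AE y in lborel. \<bar>u y\<bar> + \<bar>v y\<bar> \<le> 2 * M"
    using data_ballD(2)[OF u] data_ballD(2)[OF v] by eventually_elim simp
  then show "AE y in lborel. g y \<le> (2 * M) powr (p - 1)"
    by eventually_elim (auto simp: g_def intro!: powr_mono2 less_imp_le[OF p_gt_1])
  \<comment> \<open>Where g vanishes both functions vanish, so the factorisation survives the
    convention that division by zero gives 0.\<close>
  have zero: "u y = 0 \<and> v y = 0" if "g y = 0" for y
    using that by (auto simp: g_def)
  show "g y * h y = \<bar>u y\<bar> powr p - \<bar>v y\<bar> powr p"
    using zero[of y] by (cases "g y = 0") (auto simp: h_def)
  show "\<bar>h y\<bar> \<le> p * \<bar>u y - v y\<bar>"
  proof (cases "g y = 0")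
    case False
    then have g: "0 < g y" by (simp add: g_def)
    have "\<bar>\<bar>u y\<bar> powr p - \<bar>v y\<bar> powr p\<bar> \<le> p * g y * \<bar>\<bar>u y\<bar> - \<bar>v y\<bar>\<bar>"
      unfolding g_def using p_gt_1 by (intro abs_powr_diff_le) auto
    also have "\<dots> \<le> p * g y * \<bar>u y - v y\<bar>"
      using p_gt_1 g by (intro mult_left_mono) auto
    finally show ?thesis using g by (simp add: h_def field_simps)
  qed (use p_gt_1 in \<open>simp add: h_def\<close>)
  let ?e = "(p - 1) / \<theta> - s"
  have "(\<integral>\<^sup>+y. ennreal (g y powr (1 / \<theta>)) \<partial>lborel)
      \<le> (\<integral>\<^sup>+y. ennreal ((2 * M) powr ?e) * ennreal (\<bar>\<bar>u y\<bar> + \<bar>v y\<bar>\<bar> powr s) \<partial>lborel)"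
  proof (rule nn_integral_mono_AE)
    show "AE y in lborel. ennreal (g y powr (1 / \<theta>)) \<le> ennreal ((2 * M) powr ?e) * ennreal (\<bar>\<bar>u y\<bar> + \<bar>v y\<bar>\<bar> powr s)"
      using w
    proof eventually_elim
      case (elim y)
      have "g y powr (1 / \<theta>) = (\<bar>u y\<bar> + \<bar>v y\<bar>) powr (?e + s)"
        unfolding g_def by (simp add: powr_powr)
      also have "\<dots> = (\<bar>u y\<bar> + \<bar>v y\<bar>) powr ?e * (\<bar>u y\<bar> + \<bar>v y\<bar>) powr s"
        by (rule powr_add)
      also have "\<dots> \<le> (2 * M) powr ?e * (\<bar>u y\<bar> + \<bar>v y\<bar>) powr s"
        using elim \<theta>_props(4) by (intro mult_right_mono powr_mono2) auto
      finally show ?case by (simp add: ennreal_mult[symmetric] ennreal_leI)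
    qed
  qed
  also have "\<dots> = ennreal ((2 * M) powr ?e) * Lp_mass s (\<lambda>y. \<bar>u y\<bar> + \<bar>v y\<bar>)"
    unfolding Lp_mass_def by (rule nn_integral_cmult) measurable
  also have "\<dots> \<le> ennreal ((2 * M) powr ?e) * (ennreal (2 powr s) * (ennreal M + ennreal M))"
  proof (intro mult_left_mono)
    have "Lp_mass s (\<lambda>y. \<bar>u y\<bar> + \<bar>v y\<bar>) \<le> ennreal (2 powr s) * (Lp_mass s (\<lambda>y. \<bar>u y\<bar>) + Lp_mass s (\<lambda>y. \<bar>v y\<bar>))"
      using s_gt_1 by (intro Lp_mass_add_le) auto
    also have "\<dots> \<le> ennreal (2 powr s) * (ennreal M + ennreal M)"
      using data_ballD(3)[OF u] data_ballD(3)[OF v] by (intro mult_left_mono add_mono) (auto simp: Lp_mass_def)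
    finally show "Lp_mass s (\<lambda>y. \<bar>u y\<bar> + \<bar>v y\<bar>) \<le> ennreal (2 powr s) * (ennreal M + ennreal M)" .
  qed simp
  also have "\<dots> = ennreal ((2 * M) powr ?e * 2 powr s * (2 * M))"
    using M by (simp add: ennreal_mult[symmetric] ennreal_plus[symmetric] mult.assoc del: ennreal_plus)
  finally have le: "(\<integral>\<^sup>+y. ennreal (g y powr (1 / \<theta>)) \<partial>lborel) \<le> ennreal ((2 * M) powr ?e * 2 powr s * (2 * M))" .
  show int: "integrable lborel (\<lambda>y. g y powr (1 / \<theta>))"
    using le by (intro integrableI_bounded) (auto simp: less_top[symmetric] top_unique)
  show "(\<integral>y. g y powr (1 / \<theta>) \<partial>lborel) \<le> (2 * M) powr ?e * 2 powr s * (2 * M)"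
    using le M by (subst (asm) nn_integral_eq_integral[OF int]) auto
qed

definition source_bound :: "real \<Rightarrow> real \<Rightarrow> bool" where
  "source_bound M C \<longleftrightarrow> 0 \<le> C \<and> (\<forall>u x. data_ball s M u \<longrightarrow> source u x \<le> C) \<and>
     (\<forall>u. data_ball s M u \<longrightarrow> Lp_mass s (source u) \<le> ennreal C) \<and>
     (\<forall>u v H x. data_ball s M u \<longrightarrow> data_ball s M v \<longrightarrow> (AE y in lborel. \<bar>u y - v y\<bar> \<le> H) \<longrightarrow>
       \<bar>source u x - source v x\<bar> \<le> C * H)"

lemma source_boundD:
  assumes "source_bound M C"
  shows "0 \<le> C"
    and "data_ball s M u \<Longrightarrow> source u x \<le> C"
    and "data_ball s M u \<Longrightarrow> Lp_mass s (source u) \<le> ennreal C"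
    and "data_ball s M u \<Longrightarrow> data_ball s M v \<Longrightarrow> AE y in lborel. \<bar>u y - v y\<bar> \<le> H
      \<Longrightarrow> \<bar>source u x - source v x\<bar> \<le> C * H"
  using assms by (simp_all add: source_bound_def)

text \<open>The size estimate is the difference estimate with v = 0. The L^s estimate uses the same
  factorisation with v = 0 and the Jensen form of the kernel bound.\<close>

lemma source_bounds:
  assumes M: "0 \<le> M"
  obtains C where "source_bound M C"
proof -
  let ?a = "real CARD('n) - \<alpha>"
  let ?c = "riesz_const CARD('n) \<alpha>"
  let ?J = "\<integral>(z::real^'n). riesz_majorant ?a \<theta> z \<partial>lborel"
  define A where "A = (2 * M) powr (p - 1)"
  define B where "B = (2 * M) powr ((p - 1) / \<theta> - s) * 2 powr s * (2 * M)"
  define L where "L = ?c * ((A + 1) * ?J + B) * p"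
  define W where "W = (A + 1) powr (1 / (1 - 1 / s)) * ?J + B"
  define D where "D = ?c powr s * (W powr (s - 1) * ?J * (p powr s * M))"
  have a: "0 \<le> ?a" "?a < real DIM(real^'n)" using \<alpha> by auto
  have c: "0 < ?c" by (rule riesz_const_pos)
  have J: "0 \<le> ?J" by (simp add: riesz_majorant_nonneg)
  have AB: "0 \<le> A" "0 \<le> B" using M by (auto simp: A_def B_def)
  have L0: "0 \<le> L" unfolding L_def using AB c J p_gt_1 by (intro mult_nonneg_nonneg add_nonneg_nonneg) auto
  have diff: "integrable lborel (\<lambda>y. (\<bar>u y\<bar> powr p - \<bar>v y\<bar> powr p) / norm (x - y) powr ?a)"
     "?c * \<bar>\<integral>y. (\<bar>u y\<bar> powr p - \<bar>v y\<bar> powr p) / norm (x - y) powr ?a \<partial>lborel\<bar> \<le> L * H"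
    if u: "data_ball s M u" and v: "data_ball s M v" and H: "AE y in lborel. \<bar>u y - v y\<bar> \<le> H" for u v H and x :: "real^'n"
  proof -
    note dq = difference_quotient[OF u v]
    have hH: "AE y in lborel. \<bar>(\<bar>u y\<bar> powr p - \<bar>v y\<bar> powr p) / (\<bar>u y\<bar> + \<bar>v y\<bar>) powr (p - 1)\<bar> \<le> p * H"
      using H
    proof eventually_elim
      case (elim y)
      have "p * \<bar>u y - v y\<bar> \<le> p * H" using elim p_gt_1 by (intro mult_left_mono) auto
      then show ?case using dq(7)[of y] by linarith
    qed
    note rb = riesz_sup_bound[OF a \<theta>_props(1,2,5) dq(1) dq(3,4,5,6) dq(2) hH, unfolded dq(8)]
    show "integrable lborel (\<lambda>y. (\<bar>u y\<bar> powr p - \<bar>v y\<bar> powr p) / norm (x - y) powr ?a)"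
      by (rule rb(1))
    have "\<bar>\<integral>y. (\<bar>u y\<bar> powr p - \<bar>v y\<bar> powr p) / norm (x - y) powr ?a \<partial>lborel\<bar> \<le> ((A + 1) * ?J + B) * (p * H)"
      unfolding A_def B_def by (rule rb(2))
    from mult_left_mono[OF this less_imp_le[OF c]]
    show "?c * \<bar>\<integral>y. (\<bar>u y\<bar> powr p - \<bar>v y\<bar> powr p) / norm (x - y) powr ?a \<partial>lborel\<bar> \<le> L * H"
      by (simp add: L_def mult_ac)
  qed
  note z = data_ball_zero[OF M]
  have single: "integrable lborel (\<lambda>y. \<bar>u y\<bar> powr p / norm (x - y) powr ?a)"
    if u: "data_ball s M u" for u and x :: "real^'n"
    using diff(1)[OF u z, of M x] data_ballD(2)[OF u] p_gt_1 by simp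
  have "source_bound M (max (L * M) (max L D))"
    unfolding source_bound_def
  proof (intro conjI allI impI)
    show "0 \<le> max (L * M) (max L D)" using L0 by simp
  next
    fix u :: "real^'n \<Rightarrow> real" and x assume u: "data_ball s M u"
    have "source u x \<le> L * M"
      unfolding source_eq using diff(2)[OF u z, of M x] data_ballD(2)[OF u] p_gt_1 c
      by (simp add: abs_of_nonneg)
    then show "source u x \<le> max (L * M) (max L D)" by simp
  next
    fix u v :: "real^'n \<Rightarrow> real" and H x assume u: "data_ball s M u" and v: "data_ball s M v" and H: "AE y in lborel. \<bar>u y - v y\<bar> \<le> H"
    have "source u x - source v x = ?c * ((\<integral>y. \<bar>u y\<bar> powr p / norm (x - y) powr ?a \<partial>lborel) - (\<integral>y. \<bar>v y\<bar> powr p / norm (x - y) powr ?a \<partial>lborel))"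
      unfolding source_eq by (simp add: algebra_simps)
    also have "\<dots> = ?c * (\<integral>y. (\<bar>u y\<bar> powr p - \<bar>v y\<bar> powr p) / norm (x - y) powr ?a \<partial>lborel)"
      by (subst Bochner_Integration.integral_diff[symmetric, OF single[OF u] single[OF v]]) (simp add: diff_divide_distrib)
    finally have "\<bar>source u x - source v x\<bar> \<le> L * H"
      using diff(2)[OF u v H, of x] c by (simp add: abs_mult)
    moreover have "0 \<le> H"
    proof -
      have "AE (y::real^'n) in lborel. 0 \<le> H" using H by eventually_elim simp
      then show ?thesis by (rule AE_lborel_const)
    qed
    ultimately show "\<bar>source u x - source v x\<bar> \<le> max (L * M) (max L D) * H"
      by (meson max.cobounded1 max.cobounded2 mult_right_mono order_trans)
  next
    fix u :: "real^'n \<Rightarrow> real" assume u: "data_ball s M u"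
    have [measurable]: "u \<in> borel_measurable borel" using u by (rule data_ballD)
    define g where "g y = (\<bar>u y\<bar> + \<bar>0\<bar>) powr (p - 1)" for y
    define h where "h y = (\<bar>u y\<bar> powr p - \<bar>0\<bar> powr p) / g y" for y
    note dq = difference_quotient[OF u z, folded g_def, folded h_def]
    have h0: "0 \<le> h y" for y using p_gt_1 by (simp add: h_def g_def)
    have hu: "h y \<le> p * \<bar>u y\<bar>" for y using dq(7)[of y] h0[of y] by simp
    have hM: "AE y in lborel. h y \<le> p * M"
      using data_ballD(2)[OF u]
    proof eventually_elim
      case (elim y)
      then have "p * \<bar>u y\<bar> \<le> p * M" using p_gt_1 by (intro mult_left_mono) auto
      then show ?case using hu[of y] by linarith
    qed
    have gh: "g y * h y = \<bar>u y\<bar> powr p" for y using dq(8)[of y] p_gt_1 by simp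
    have "Lp_mass s (source u) = ennreal (?c powr s) * Lp_mass s (\<lambda>x. \<integral>y. g y * h y / norm (x - y) powr ?a \<partial>lborel)"
      unfolding source_eq[abs_def] gh using c by (subst Lp_mass_cmult) auto
    also have "\<dots> \<le> ennreal (?c powr s) * (ennreal (W powr (s - 1) * ?J) * Lp_mass s h)"
      unfolding W_def A_def B_def
      by (intro mult_left_mono riesz_Lp_bound[OF a \<theta>_props(1,2,5) dq(1) dq(3,4,5,6) s_gt_1 \<theta>_props(3) dq(2) h0 hM]) simp
    also have "\<dots> \<le> ennreal (?c powr s) * (ennreal (W powr (s - 1) * ?J) * ennreal (p powr s * M))"
    proof (intro mult_left_mono)
      have "Lp_mass s h \<le> Lp_mass s (\<lambda>y. p * u y)"
        using s_gt_1 hu h0 p_gt_1 by (intro Lp_mass_mono_AE) (auto simp: abs_mult)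
      also have "\<dots> = ennreal (p powr s) * Lp_mass s u" using p_gt_1 by (subst Lp_mass_cmult) auto
      also have "\<dots> \<le> ennreal (p powr s) * ennreal M"
        by (intro mult_left_mono data_ballD(3)[OF u]) simp
      finally show "Lp_mass s h \<le> ennreal (p powr s * M)" using M by (simp add: ennreal_mult)
    qed simp_all
    also have "\<dots> = ennreal D" unfolding D_def using M J by (simp add: ennreal_mult)
    also have "\<dots> \<le> ennreal (max (L * M) (max L D))" by (intro ennreal_leI) simp
    finally show "Lp_mass s (source u) \<le> ennreal (max (L * M) (max L D))" .
  qed
  then show thesis by (rule that)
qed

end

section \<open>The semigroup and the Picard map\<close>

lemma S_semigroup_apply:
  "S_semigroup \<beta> t v x = (if t = 0 then v x else (\<integral>y. S_kernel \<beta> (x - y) t * v y \<partial>lborel))"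
  by (simp add: S_semigroup_def)

lemma S_semigroup_measurable [measurable (raw)]:
  fixes h :: "'b \<Rightarrow> real^'n"
  assumes [measurable]: "f \<in> borel_measurable N" "case_prod v \<in> borel_measurable (N \<Otimes>\<^sub>M borel)" "h \<in> borel_measurable N"
  shows "(\<lambda>z. S_semigroup \<beta> (f z) (v z) (h z)) \<in> borel_measurable N"
  unfolding S_semigroup_apply by measurable

lemma S_kernel_abs_integral:
  assumes "0 < \<beta>" "\<beta> \<le> 2" "0 < t"
  shows "(\<integral>(x::real^'n). \<bar>S_kernel \<beta> x t\<bar> \<partial>lborel) = 1"
  by (simp add: S_kernel_nonneg[OF assms] S_kernel_integral[OF assms])

context
  fixes \<beta> :: real
  assumes \<beta>: "0 < \<beta>" "\<beta> \<le> 2"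
begin

lemma S_semigroup_integrable:
  fixes v :: "real^'n \<Rightarrow> real"
  assumes "0 < t" "v \<in> borel_measurable borel" "AE x in lborel. \<bar>v x\<bar> \<le> B"
  shows "integrable lborel (\<lambda>y. S_kernel \<beta> (x - y) t * v y)"
  using convolution_bounded(1)[OF S_kernel_integrable[OF \<beta> assms(1)] assms(2,3)] .

lemma S_semigroup_bound:
  fixes v :: "real^'n \<Rightarrow> real"
  assumes "0 < t" "v \<in> borel_measurable borel" "AE x in lborel. \<bar>v x\<bar> \<le> B"
  shows "\<bar>S_semigroup \<beta> t v x\<bar> \<le> B"
  using convolution_bounded(2)[OF S_kernel_integrable[OF \<beta> assms(1)] assms(2,3), of x] assms(1)
  by (simp add: S_semigroup_apply S_kernel_abs_integral[OF \<beta> assms(1)])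

lemma S_semigroup_bound':
  fixes v :: "real^'n \<Rightarrow> real"
  assumes "0 \<le> t" "v \<in> borel_measurable borel" "\<And>x. \<bar>v x\<bar> \<le> B"
  shows "\<bar>S_semigroup \<beta> t v x\<bar> \<le> B"
  using S_semigroup_bound[of t v B x] assms by (cases "t = 0") (auto simp: S_semigroup_apply)

lemma S_semigroup_AE_bound:
  fixes v :: "real^'n \<Rightarrow> real"
  assumes "0 \<le> t" "v \<in> borel_measurable borel" "AE x in lborel. \<bar>v x\<bar> \<le> B"
  shows "AE x in lborel. \<bar>S_semigroup \<beta> t v x\<bar> \<le> B"
  using S_semigroup_bound[of t v B] assms by (cases "t = 0") (auto simp: S_semigroup_apply)

lemma S_semigroup_nonneg:
  fixes v :: "real^'n \<Rightarrow> real"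
  assumes "0 < t" "AE x in lborel. 0 \<le> v x"
  shows "0 \<le> S_semigroup \<beta> t v x"
  using assms
  by (auto simp: S_semigroup_apply intro!: integral_nonneg_AE mult_nonneg_nonneg S_kernel_nonneg[OF \<beta>] elim!: eventually_mono)

lemma S_semigroup_diff:
  fixes v w :: "real^'n \<Rightarrow> real"
  assumes t: "0 \<le> t" and v: "v \<in> borel_measurable borel" "AE x in lborel. \<bar>v x\<bar> \<le> B"
    and w: "w \<in> borel_measurable borel" "AE x in lborel. \<bar>w x\<bar> \<le> C"
  shows "S_semigroup \<beta> t (\<lambda>y. v y - w y) x = S_semigroup \<beta> t v x - S_semigroup \<beta> t w x"
proof (cases "t = 0")
  case False
  then have "0 < t" using t by simp
  from Bochner_Integration.integral_diff[OF S_semigroup_integrable[OF this v] S_semigroup_integrable[OF this w], of x x]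
  show ?thesis using False by (simp add: S_semigroup_apply right_diff_distrib)
qed (simp add: S_semigroup_apply)

lemma S_semigroup_add:
  fixes v w :: "real^'n \<Rightarrow> real"
  assumes t: "0 \<le> t" and v: "v \<in> borel_measurable borel" "AE x in lborel. \<bar>v x\<bar> \<le> B"
    and w: "w \<in> borel_measurable borel" "AE x in lborel. \<bar>w x\<bar> \<le> C"
  shows "S_semigroup \<beta> t (\<lambda>y. v y + w y) x = S_semigroup \<beta> t v x + S_semigroup \<beta> t w x"
proof (cases "t = 0")
  case False
  then have "0 < t" using t by simp
  from Bochner_Integration.integral_add[OF S_semigroup_integrable[OF this v] S_semigroup_integrable[OF this w], of x x]
  show ?thesis using False by (simp add: S_semigroup_apply distrib_left)
qed (simp add: S_semigroup_apply)

lemma S_semigroup_Lp_mass: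
  fixes v :: "real^'n \<Rightarrow> real"
  assumes "1 < s" "0 \<le> t" "v \<in> borel_measurable borel" "AE x in lborel. \<bar>v x\<bar> \<le> B"
  shows "Lp_mass s (S_semigroup \<beta> t v) \<le> Lp_mass s v"
proof (cases "t = 0")
  case False
  then have t: "0 < t" using assms by simp
  show ?thesis
    using Lp_mass_convolution[OF assms(1) S_kernel_integrable[OF \<beta> t] assms(3,4)] t
    by (simp add: S_semigroup_eq S_kernel_abs_integral[OF \<beta> t])
qed (simp add: S_semigroup_def)

text \<open>The difference of two kernels is itself an L^1 convolution kernel, of norm \<omega>, so
  both convolution bounds apply to it.\<close>

lemma S_semigroup_time_diff:
  fixes v :: "real^'n \<Rightarrow> real"
  assumes r: "0 < r" and t: "0 < t" and v: "v \<in> borel_measurable borel" "AE x in lborel. \<bar>v x\<bar> \<le> B"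
  defines "\<omega> \<equiv> \<integral>(x::real^'n). \<bar>S_kernel \<beta> x r - S_kernel \<beta> x t\<bar> \<partial>lborel"
  shows "\<bar>S_semigroup \<beta> r v x - S_semigroup \<beta> t v x\<bar> \<le> \<omega> * B"
    and "1 < s \<Longrightarrow> Lp_mass s (\<lambda>x. S_semigroup \<beta> r v x - S_semigroup \<beta> t v x) \<le> ennreal (\<omega> powr s) * Lp_mass s v"
proof -
  note K = S_kernel_diff_integrable[OF \<beta> r t, where 'n = 'n]
  have eq: "S_semigroup \<beta> r v x - S_semigroup \<beta> t v x = (\<integral>y. (S_kernel \<beta> (x - y) r - S_kernel \<beta> (x - y) t) * v y \<partial>lborel)" for x
    using Bochner_Integration.integral_diff[OF S_semigroup_integrable[OF r v] S_semigroup_integrable[OF t v], of x x] r t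
    by (simp add: S_semigroup_apply left_diff_distrib)
  show "\<bar>S_semigroup \<beta> r v x - S_semigroup \<beta> t v x\<bar> \<le> \<omega> * B"
    unfolding eq \<omega>_def by (rule convolution_bounded(2)[OF K v])
  show "Lp_mass s (\<lambda>x. S_semigroup \<beta> r v x - S_semigroup \<beta> t v x) \<le> ennreal (\<omega> powr s) * Lp_mass s v" if "1 < s"
    unfolding eq \<omega>_def by (rule Lp_mass_convolution[OF that K v])
qed

text \<open>After exchanging the two space integrals, the inner one is the kernel convolution
  shifted by z. Absolute integrability comes from the sup bound applied to |v|.\<close>

lemma S_semigroup_semigroup:
  fixes v :: "real^'n \<Rightarrow> real"
  assumes r: "0 \<le> r" and t: "0 \<le> t" and v [measurable]: "v \<in> borel_measurable borel" and B: "AE x in lborel. \<bar>v x\<bar> \<le> B"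
  shows "S_semigroup \<beta> r (S_semigroup \<beta> t v) = S_semigroup \<beta> (r + t) v"
proof (cases "r = 0 \<or> t = 0")
  case True
  then show ?thesis by (auto simp: S_semigroup_def)
next
  case False
  then have r0: "0 < r" and t0: "0 < t" using r t by auto
  show ?thesis
  proof
    fix x
    let ?K = "\<lambda>t z. S_kernel \<beta> z t"
    have pair: "integrable (lborel \<Otimes>\<^sub>M lborel) (\<lambda>(y, z). ?K r (x - y) * (?K t (y - z) * v z))"
    proof (rule lborel_pair.Fubini_integrable)
      show "(\<lambda>(y, z). ?K r (x - y) * (?K t (y - z) * v z)) \<in> borel_measurable (lborel \<Otimes>\<^sub>M lborel)" by measurable
      show "AE y in lborel. integrable lborel (\<lambda>z. case (y, z) of (y, z) \<Rightarrow> ?K r (x - y) * (?K t (y - z) * v z))"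
        using S_semigroup_integrable[OF t0 v B] by simp
      have "(\<lambda>y. \<integral>z. norm (case (y, z) of (y, z) \<Rightarrow> ?K r (x - y) * (?K t (y - z) * v z)) \<partial>lborel)
         = (\<lambda>y. ?K r (x - y) * S_semigroup \<beta> t (\<lambda>z. \<bar>v z\<bar>) y)"
        using t0 by (auto simp: abs_mult S_semigroup_apply fun_eq_iff S_kernel_nonneg[OF \<beta> r0] S_kernel_nonneg[OF \<beta> t0])
      moreover have "integrable lborel (\<lambda>y. ?K r (x - y) * S_semigroup \<beta> t (\<lambda>z. \<bar>v z\<bar>) y)"
        using S_semigroup_bound[OF t0, of "\<lambda>z. \<bar>v z\<bar>" B] B
        by (intro S_semigroup_integrable[OF r0]) (auto intro!: AE_I2)
      ultimately show "integrable lborel (\<lambda>y. \<integral>z. norm (case (y, z) of (y, z) \<Rightarrow> ?K r (x - y) * (?K t (y - z) * v z)) \<partial>lborel)"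
        by simp
    qed
    have "S_semigroup \<beta> r (S_semigroup \<beta> t v) x = (\<integral>y. (\<integral>z. ?K r (x - y) * (?K t (y - z) * v z) \<partial>lborel) \<partial>lborel)"
      using r0 t0 by (simp add: S_semigroup_apply)
    also have "\<dots> = (\<integral>z. (\<integral>y. ?K r (x - y) * (?K t (y - z) * v z) \<partial>lborel) \<partial>lborel)"
      by (rule lborel_pair.Fubini_integral[OF pair, symmetric])
    also have "\<dots> = (\<integral>z. ?K (r + t) (x - z) * v z \<partial>lborel)"
    proof (intro Bochner_Integration.integral_cong refl)
      fix z
      have "(\<integral>y. ?K r (x - y) * (?K t (y - z) * v z) \<partial>lborel) = (\<integral>y. ?K r (x - y) * ?K t (y - z) \<partial>lborel) * v z"
        by (simp add: mult.assoc[symmetric])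
      also have "(\<integral>y. ?K r (x - y) * ?K t (y - z) \<partial>lborel) = (\<integral>y. ?K r ((x - z) - y) * ?K t y \<partial>lborel)"
        using integral_translate[of "\<lambda>y. ?K r ((x - z) - y) * ?K t y" z] by (simp add: diff_diff_eq2)
      also have "\<dots> = ?K (r + t) (x - z)"
        by (rule S_kernel_convolution[OF \<beta> t0 r0])
      finally show "(\<integral>y. ?K r (x - y) * (?K t (y - z) * v z) \<partial>lborel) = ?K (r + t) (x - z) * v z" .
    qed
    also have "\<dots> = S_semigroup \<beta> (r + t) v x" using r0 t0 by (simp add: S_semigroup_apply)
    finally show "S_semigroup \<beta> r (S_semigroup \<beta> t v) x = S_semigroup \<beta> (r + t) v x" .
  qed
qed

end

section \<open>Integrals over time intervals and the Picard map\<close>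

lemma time_integral_measurable [measurable (raw)]:
  fixes G :: "'b \<Rightarrow> real \<Rightarrow> real"
  assumes [measurable]: "case_prod G \<in> borel_measurable (N \<Otimes>\<^sub>M borel)" "a \<in> borel_measurable N" "b \<in> borel_measurable N"
  shows "(\<lambda>z. LINT \<tau>:{a z..b z}|lborel. G z \<tau>) \<in> borel_measurable N"
proof -
  have "indicator {a z..b z} \<tau> *\<^sub>R G z \<tau> = (if a z \<le> \<tau> \<and> \<tau> \<le> b z then G z \<tau> else 0)" for z \<tau>
    by (simp split: split_indicator)
  then show ?thesis unfolding set_lebesgue_integral_def by simp measurable
qed

lemma time_integral_bound:
  fixes G :: "real \<Rightarrow> real"
  assumes G [measurable]: "G \<in> borel_measurable borel" and ab: "a \<le> b"
    and B: "AE \<tau> in lborel. \<tau> \<in> {a..b} \<longrightarrow> \<bar>G \<tau>\<bar> \<le> C" and C: "0 \<le> C"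
  shows "set_integrable lborel {a..b} G" "\<bar>LINT \<tau>:{a..b}|lborel. G \<tau>\<bar> \<le> (b - a) * C"
proof -
  have i: "integrable lborel (\<lambda>\<tau>. indicator {a..b} \<tau> * C)"
    using ab by (intro integrable_mult_left) auto
  have le: "AE \<tau> in lborel. \<bar>indicator {a..b} \<tau> *\<^sub>R G \<tau>\<bar> \<le> indicator {a..b} \<tau> * C"
    using B by eventually_elim (auto split: split_indicator)
  show S: "set_integrable lborel {a..b} G"
    unfolding set_integrable_def
    by (rule Bochner_Integration.integrable_bound[OF i]) (use le C in \<open>auto elim: eventually_mono\<close>)
  have "\<bar>LINT \<tau>:{a..b}|lborel. G \<tau>\<bar> \<le> (\<integral>\<tau>. \<bar>indicator {a..b} \<tau> *\<^sub>R G \<tau>\<bar> \<partial>lborel)"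
    unfolding set_lebesgue_integral_def by (rule integral_abs_bound)
  also have "\<dots> \<le> (\<integral>\<tau>. indicator {a..b} \<tau> * C \<partial>lborel)"
    using S unfolding set_integrable_def by (intro integral_mono_AE[OF integrable_abs i le])
  also have "\<dots> = (b - a) * C" using ab by simp
  finally show "\<bar>LINT \<tau>:{a..b}|lborel. G \<tau>\<bar> \<le> (b - a) * C" .
qed

lemma set_integral_diff_le:
  fixes F G :: "real \<Rightarrow> real"
  assumes F: "set_integrable lborel {a..b} F" and G: "set_integrable lborel {a..b} G" and ab: "a \<le> b" and C: "0 \<le> C"
    and B: "AE \<tau> in lborel. \<tau> \<in> {a..b} \<longrightarrow> \<bar>F \<tau> - G \<tau>\<bar> \<le> C"
  shows "\<bar>(LINT \<tau>:{a..b}|lborel. F \<tau>) - (LINT \<tau>:{a..b}|lborel. G \<tau>)\<bar> \<le> (b - a) * C"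
proof -
  have i: "integrable lborel (\<lambda>\<tau>. indicator {a..b} \<tau> * C)"
    using ab by (intro integrable_mult_left) auto
  have FG: "set_integrable lborel {a..b} (\<lambda>\<tau>. F \<tau> - G \<tau>)" using F G by (rule set_integral_diff)
  have "\<bar>LINT \<tau>:{a..b}|lborel. F \<tau> - G \<tau>\<bar> \<le> (\<integral>\<tau>. \<bar>indicator {a..b} \<tau> *\<^sub>R (F \<tau> - G \<tau>)\<bar> \<partial>lborel)"
    unfolding set_lebesgue_integral_def by (rule integral_abs_bound)
  also have "\<dots> \<le> (\<integral>\<tau>. indicator {a..b} \<tau> * C \<partial>lborel)"
    using FG B unfolding set_integrable_def
    by (intro integral_mono_AE[OF integrable_abs i]) (auto elim!: eventually_mono split: split_indicator)
  also have "\<dots> = (b - a) * C" using ab by simp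
  finally show ?thesis using set_integral_diff(2)[OF F G] by simp
qed

context fractional_problem
begin

abbreviation D :: "(real \<Rightarrow> real^'n \<Rightarrow> real) \<Rightarrow> real \<Rightarrow> real \<Rightarrow> real^'n \<Rightarrow> real" where
  "D u t \<tau> \<equiv> duhamel_integrand \<alpha> \<beta> p u t \<tau>"

lemma duhamel_eq: "D u t \<tau> = S_semigroup \<beta> (t - \<tau>) (source (u \<tau>))"
  by (simp add: duhamel_integrand_def source_def)

lemma duhamel_measurable [measurable (raw)]:
  assumes [measurable]: "case_prod u \<in> borel_measurable (borel \<Otimes>\<^sub>M borel)"
    "f \<in> borel_measurable N" "g \<in> borel_measurable N" "h \<in> borel_measurable N"
  shows "(\<lambda>z. D u (f z) (g z) (h z)) \<in> borel_measurable N"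
  unfolding duhamel_eq by measurable

definition picard :: "(real^'n \<Rightarrow> real) \<Rightarrow> (real \<Rightarrow> real^'n \<Rightarrow> real) \<Rightarrow> real \<Rightarrow> real^'n \<Rightarrow> real" where
  "picard u0 u t x = S_semigroup \<beta> t u0 x + (LINT \<tau>:{0..t}|lborel. D u t \<tau> x)"

lemma picard_measurable [measurable (raw)]:
  assumes [measurable]: "case_prod u \<in> borel_measurable (borel \<Otimes>\<^sub>M borel)" "u0 \<in> borel_measurable borel"
    "f \<in> borel_measurable N" "h \<in> borel_measurable N"
  shows "(\<lambda>z. picard u0 u (f z) (h z)) \<in> borel_measurable N"
  unfolding picard_def by measurable

definition bounded_path :: "real \<Rightarrow> real \<Rightarrow> (real \<Rightarrow> real^'n \<Rightarrow> real) \<Rightarrow> bool" where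
  "bounded_path T M u \<longleftrightarrow> case_prod u \<in> borel_measurable (borel \<Otimes>\<^sub>M borel) \<and> (\<forall>t\<in>{0..T}. data_ball s M (u t))"

text \<open>The Duhamel integrand depends on u \<tau> only up to null sets, so demanding the
  equation at every point selects one representative. Uniqueness then becomes equality of
  functions.\<close>

definition pointwise_solution :: "(real^'n \<Rightarrow> real) \<Rightarrow> real \<Rightarrow> real \<Rightarrow> (real \<Rightarrow> real^'n \<Rightarrow> real) \<Rightarrow> bool" where
  "pointwise_solution u0 T M u \<longleftrightarrow> bounded_path T M u \<and> (\<forall>t\<in>{0..T}. \<forall>x. u t x = picard u0 u t x)"

lemma source_abs_bound:
  assumes "source_bound M C" "data_ball s M u"
  shows "\<bar>source u x\<bar> \<le> C"
  using source_boundD(2)[OF assms, of x] source_nonneg[of u x] by simp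

lemma source_borel:
  assumes [measurable]: "u \<in> borel_measurable borel"
  shows "source u \<in> borel_measurable borel"
  unfolding source_eq[abs_def] by measurable

lemma duhamel_bound:
  assumes u: "data_ball s M (u \<tau>)" and t: "\<tau> \<le> t"
    and SB: "source_bound M C"
  shows "\<bar>D u t \<tau> x\<bar> \<le> C"
proof -
  have t0: "0 \<le> t - \<tau>" using t by simp
  have b: "\<bar>source (u \<tau>) x\<bar> \<le> C" for x by (rule source_abs_bound[OF SB u])
  show ?thesis
    unfolding duhamel_eq by (rule S_semigroup_bound'[OF \<beta> t0 source_borel[OF data_ballD(1)[OF u]] b])
qed

lemma duhamel_Lp_mass:
  assumes u: "data_ball s M (u \<tau>)" and t: "\<tau> \<le> t"
    and SB: "source_bound M C"
  shows "Lp_mass s (D u t \<tau>) \<le> ennreal C"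
proof -
  have t0: "0 \<le> t - \<tau>" using t by simp
  have b: "AE x in lborel. \<bar>source (u \<tau>) x\<bar> \<le> C" by (rule AE_I2) (rule source_abs_bound[OF SB u])
  have "Lp_mass s (D u t \<tau>) \<le> Lp_mass s (source (u \<tau>))"
    unfolding duhamel_eq by (rule S_semigroup_Lp_mass[OF \<beta> s_gt_1 t0 source_borel[OF data_ballD(1)[OF u]] b])
  also have "\<dots> \<le> ennreal C" by (rule source_boundD(3)[OF SB u])
  finally show ?thesis .
qed

lemma duhamel_diff_bound:
  assumes u: "data_ball s M (u \<tau>)" and v: "data_ball s M (v \<tau>)" and t: "\<tau> \<le> t"
    and SB: "source_bound M C"
    and H: "AE y in lborel. \<bar>u \<tau> y - v \<tau> y\<bar> \<le> H"
  shows "\<bar>D u t \<tau> x - D v t \<tau> x\<bar> \<le> C * H"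
proof -
  note bu = data_ballD(1)[OF u] and bv = data_ballD(1)[OF v]
  note mu = source_borel[OF bu] and mv = source_borel[OF bv]
  have t0: "0 \<le> t - \<tau>" using t by simp
  have au: "AE x in lborel. \<bar>source (u \<tau>) x\<bar> \<le> C" by (rule AE_I2) (rule source_abs_bound[OF SB u])
  have av: "AE x in lborel. \<bar>source (v \<tau>) x\<bar> \<le> C" by (rule AE_I2) (rule source_abs_bound[OF SB v])
  have d: "\<bar>source (u \<tau>) x - source (v \<tau>) x\<bar> \<le> C * H" for x by (rule source_boundD(4)[OF SB u v H])
  have "D u t \<tau> x - D v t \<tau> x = S_semigroup \<beta> (t - \<tau>) (\<lambda>y. source (u \<tau>) y - source (v \<tau>) y) x"
    unfolding duhamel_eq by (rule S_semigroup_diff[OF \<beta> t0 mu au mv av, symmetric])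
  also have "\<bar>\<dots>\<bar> \<le> C * H"
    by (rule S_semigroup_bound'[OF \<beta> t0 borel_measurable_diff[OF mu mv] d])
  finally show ?thesis .
qed

text \<open>The Duhamel part contributes t C in sup norm and t^s C in mass. Both vanish with t, and
  this determines the length of the existence interval.\<close>

lemma picard_step:
  assumes u0: "data_ball s R u0" and u: "bounded_path T M u" and t: "t \<in> {0..T}"
    and SB: "source_bound M C"
  shows "set_integrable lborel {0..t} (\<lambda>\<tau>. D u t \<tau> x)"
    and "\<bar>LINT \<tau>:{0..t}|lborel. D u t \<tau> x\<bar> \<le> t * C"
    and "AE x in lborel. \<bar>picard u0 u t x\<bar> \<le> R + t * C"
    and "Lp_mass s (picard u0 u t) \<le> ennreal (2 powr s * (R + t powr s * C))"
proof -
  note C = source_boundD(1)[OF SB]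
  have [measurable]: "case_prod u \<in> borel_measurable (borel \<Otimes>\<^sub>M borel)" using u unfolding bounded_path_def by (rule conjunct1)
  have [measurable]: "u0 \<in> borel_measurable borel" using u0 by (rule data_ballD)
  have R: "0 \<le> R" using data_ball_nonneg[OF u0] .
  have ut: "data_ball s M (u \<tau>)" if "\<tau> \<in> {0..t}" for \<tau> using u t that by (auto simp: bounded_path_def)
  have Db: "\<bar>D u t \<tau> x\<bar> \<le> C" if "\<tau> \<in> {0..t}" for \<tau> x
    using that by (intro duhamel_bound[OF ut _ SB]) auto
  have tm: "(\<lambda>\<tau>. D u t \<tau> x) \<in> borel_measurable borel" for x by measurable
  show "set_integrable lborel {0..t} (\<lambda>\<tau>. D u t \<tau> x)"
    using t Db C by (intro time_integral_bound(1)[where C = C] tm) auto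
  have Ib: "\<bar>LINT \<tau>:{0..t}|lborel. D u t \<tau> x\<bar> \<le> t * C" for x
    using time_integral_bound(2)[OF tm, where a = 0 and b = t and C = C] t Db C by auto
  then show "\<bar>LINT \<tau>:{0..t}|lborel. D u t \<tau> x\<bar> \<le> t * C" .
  have t0: "0 \<le> t" using t by simp
  show "AE x in lborel. \<bar>picard u0 u t x\<bar> \<le> R + t * C"
    using S_semigroup_AE_bound[OF \<beta> t0 data_ballD(1,2)[OF u0]]
  proof eventually_elim
    case (elim x)
    then show ?case using Ib[of x] by (simp add: picard_def)
  qed
  have "Lp_mass s (picard u0 u t) \<le> ennreal (2 powr s) * (Lp_mass s (S_semigroup \<beta> t u0) + Lp_mass s (\<lambda>x. LINT \<tau>:{0..t}|lborel. D u t \<tau> x))"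
    unfolding picard_def[abs_def] using s_gt_1 by (intro Lp_mass_add_le) auto
  also have "\<dots> \<le> ennreal (2 powr s) * (ennreal R + ennreal (t powr s * C))"
  proof (intro mult_left_mono add_mono)
    show "Lp_mass s (S_semigroup \<beta> t u0) \<le> ennreal R"
      using S_semigroup_Lp_mass[OF \<beta> s_gt_1 t0 data_ballD(1,2)[OF u0]] data_ballD(3)[OF u0] by (rule order_trans)
    have "Lp_mass s (\<lambda>x. LINT \<tau>:{0..t}|lborel. D u t \<tau> x) \<le> ennreal ((t - 0) powr s) * ennreal C"
    proof (rule Lp_mass_time_integral[OF s_gt_1 t0])
      show "(\<lambda>(\<tau>, x). D u t \<tau> x) \<in> borel_measurable (borel \<Otimes>\<^sub>M borel)" by measurable
      show "Lp_mass s (D u t \<tau>) \<le> ennreal C" if "\<tau> \<in> {0..t}" for \<tau>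
        using that by (intro duhamel_Lp_mass[OF ut _ SB]) auto
    qed (rule Db)
    then show "Lp_mass s (\<lambda>x. LINT \<tau>:{0..t}|lborel. D u t \<tau> x) \<le> ennreal (t powr s * C)"
      using C by (simp add: ennreal_mult)
  qed simp
  also have "\<dots> = ennreal (2 powr s * (R + t powr s * C))"
    using R C by (simp add: ennreal_mult)
  finally show "Lp_mass s (picard u0 u t) \<le> ennreal (2 powr s * (R + t powr s * C))" .
qed

end

section \<open>Local existence\<close>

lemma Lp_mass_liminf:
  fixes f :: "nat \<Rightarrow> 'a::euclidean_space \<Rightarrow> real"
  assumes [measurable]: "\<And>k. f k \<in> borel_measurable borel" and lim: "AE x in lborel. (\<lambda>k. f k x) \<longlonglongrightarrow> g x"
    and bd: "\<And>k. Lp_mass s (f k) \<le> C" and s: "0 < s"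
  shows "Lp_mass s g \<le> C"
proof -
  have "Lp_mass s g = (\<integral>\<^sup>+x. liminf (\<lambda>k. ennreal (\<bar>f k x\<bar> powr s)) \<partial>lborel)"
    unfolding Lp_mass_def
  proof (rule nn_integral_cong_AE)
    show "AE x in lborel. ennreal (\<bar>g x\<bar> powr s) = liminf (\<lambda>k. ennreal (\<bar>f k x\<bar> powr s))"
      using lim
    proof eventually_elim
      case (elim x)
      have "(\<lambda>k. \<bar>f k x\<bar> powr s) \<longlonglongrightarrow> \<bar>g x\<bar> powr s"
        using s elim by (intro tendsto_powr' tendsto_rabs tendsto_const) auto
      then have "(\<lambda>k. ennreal (\<bar>f k x\<bar> powr s)) \<longlonglongrightarrow> ennreal (\<bar>g x\<bar> powr s)"
        by (rule tendsto_ennrealI)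
      then show ?case by (intro lim_imp_Liminf[symmetric]) auto
    qed
  qed
  also have "\<dots> \<le> liminf (\<lambda>k. Lp_mass s (f k))"
    unfolding Lp_mass_def by (rule nn_integral_liminf) measurable
  also have "\<dots> \<le> C"
    using bd by (intro Liminf_le) auto
  finally show ?thesis .
qed

context fractional_problem
begin

lemma picard_diff_bound:
  assumes u: "bounded_path T M u" and v: "bounded_path T M v" and t: "t \<in> {0..T}"
    and SB: "source_bound M C"
    and u0: "data_ball s R u0"
    and H: "0 \<le> H" "\<And>\<tau>. \<tau> \<in> {0..T} \<Longrightarrow> AE y in lborel. \<bar>u \<tau> y - v \<tau> y\<bar> \<le> H"
  shows "\<bar>picard u0 u t x - picard u0 v t x\<bar> \<le> t * (C * H)"
proof -
  have ball: "data_ball s M (u \<tau>)" "data_ball s M (v \<tau>)" if "\<tau> \<in> {0..T}" for \<tau>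
    using u v that unfolding bounded_path_def by blast+
  have "\<bar>(LINT \<tau>:{0..t}|lborel. D u t \<tau> x) - (LINT \<tau>:{0..t}|lborel. D v t \<tau> x)\<bar> \<le> (t - 0) * (C * H)"
  proof (rule set_integral_diff_le)
    show "set_integrable lborel {0..t} (\<lambda>\<tau>. D u t \<tau> x)" by (rule picard_step(1)[OF u0 u t SB])
    show "set_integrable lborel {0..t} (\<lambda>\<tau>. D v t \<tau> x)" by (rule picard_step(1)[OF u0 v t SB])
    show "0 \<le> t" using t by simp
    show "0 \<le> C * H" using source_boundD(1)[OF SB] H(1) by simp
    show "AE \<tau> in lborel. \<tau> \<in> {0..t} \<longrightarrow> \<bar>D u t \<tau> x - D v t \<tau> x\<bar> \<le> C * H"
    proof (rule AE_I2, rule impI)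
      fix \<tau> assume \<tau>: "\<tau> \<in> {0..t}"
      then have \<tau>': "\<tau> \<in> {0..T}" "\<tau> \<le> t" using t by auto
      show "\<bar>D u t \<tau> x - D v t \<tau> x\<bar> \<le> C * H"
        by (rule duhamel_diff_bound[where u = u and v = v and \<tau> = \<tau>, OF ball[OF \<tau>'(1)] \<tau>'(2) SB H(2)[OF \<tau>'(1)]])
    qed
  qed
  then show ?thesis by (simp add: picard_def)
qed

lemma geometric_cauchy_limit:
  fixes a :: "nat \<Rightarrow> real"
  assumes "\<And>k. \<bar>a (Suc k) - a k\<bar> \<le> (1/2) ^ k"
  shows "a \<longlonglongrightarrow> lim a" "\<bar>lim a - a k\<bar> \<le> 2 * (1/2) ^ k"
proof -
  \<comment> \<open>The negative remainder is kept so that the induction closes; dropping it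
    afterwards gives the tail bound.\<close>
  have le: "\<bar>a (k + m) - a k\<bar> \<le> 2 * (1/2) ^ k - 2 * (1/2) ^ (k + m)" for k m
  proof (induction m)
    case (Suc m)
    have "\<bar>a (k + Suc m) - a k\<bar> \<le> \<bar>a (Suc (k + m)) - a (k + m)\<bar> + \<bar>a (k + m) - a k\<bar>" by simp
    also have "\<dots> \<le> (1/2) ^ (k + m) + (2 * (1/2) ^ k - 2 * (1/2) ^ (k + m))"
      by (rule add_mono[OF assms Suc])
    finally show ?case by simp
  qed simp
  have le': "\<bar>a (k + m) - a k\<bar> \<le> 2 * (1/2) ^ k" for k m
  proof -
    have "0 \<le> 2 * (1/2 :: real) ^ (k + m)" by simp
    then show ?thesis using le[of k m] by linarith
  qed
  have "Cauchy a"
  proof (rule metric_CauchyI)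
    fix e :: real assume e: "0 < e"
    have "(\<lambda>k. 4 * (1/2 :: real) ^ k) \<longlonglongrightarrow> 4 * 0" by (intro tendsto_intros LIMSEQ_power_zero) simp
    then have "eventually (\<lambda>k. 4 * (1/2 :: real) ^ k < e) sequentially"
      using e by (intro order_tendstoD(2)[where y = "4 * 0"]) auto
    then obtain N where N: "4 * (1/2 :: real) ^ N < e" by (auto simp: eventually_sequentially)
    have "dist (a m) (a n) < e" if "m \<ge> N" "n \<ge> N" for m n
      using le'[of N "m - N"] le'[of N "n - N"] that N by (simp add: dist_real_def)
    then show "\<exists>N. \<forall>m\<ge>N. \<forall>n\<ge>N. dist (a m) (a n) < e" by blast
  qed
  then show lim: "a \<longlonglongrightarrow> lim a" by (simp add: Cauchy_convergent_iff convergent_LIMSEQ_iff)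
  have "(\<lambda>m. \<bar>a (k + m) - a k\<bar>) \<longlonglongrightarrow> \<bar>lim a - a k\<bar>"
    using LIMSEQ_ignore_initial_segment[OF lim, of k] by (intro tendsto_intros) (simp add: add.commute)
  then show "\<bar>lim a - a k\<bar> \<le> 2 * (1/2) ^ k"
    by (rule LIMSEQ_le_const2) (use le' in auto)
qed

fun picard_iterate :: "(real^'n \<Rightarrow> real) \<Rightarrow> nat \<Rightarrow> real \<Rightarrow> real^'n \<Rightarrow> real" where
  "picard_iterate u0 0 = (\<lambda>t x. S_semigroup \<beta> t u0 x)"
| "picard_iterate u0 (Suc k) = picard u0 (picard_iterate u0 k)"

text \<open>\<delta> and M are obtained before the datum: one interval length serves every datum of
  size R, and continuation and blow-up rest on this uniformity.\<close>

theorem local_existence: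
  assumes R: "0 \<le> R"
  obtains \<delta> M where "0 < \<delta>"
    and "\<And>u0. data_ball s R u0 \<Longrightarrow> \<exists>u. pointwise_solution u0 \<delta> M u"
proof -
  \<comment> \<open>M is at least the sup bound R + t C and the mass bound 2^s (R + t^s C) of the
    Picard map whenever t C \<le> 1 and t^s C \<le> 1.\<close>
  define M where "M = 2 powr s * (R + 1) + R + 1"
  have M: "R + 1 \<le> M" "2 powr s * (R + 1) \<le> M" "0 \<le> M" using R by (auto simp: M_def)
  from source_bounds[OF M(3)] obtain C where SB: "source_bound M C" .
  note C = source_boundD[OF SB]
  \<comment> \<open>\<delta> C \<le> 1/2 makes the Picard map a contraction by one half in sup norm;
    \<delta> \<le> 1 gives t^s \<le> t, so the same smallness covers the mass bound.\<close>
  define \<delta> where "\<delta> = 1 / (2 * (C + 1))"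
  have \<delta>: "0 < \<delta>" "\<delta> \<le> 1" "\<delta> * C \<le> 1 / 2" using C(1) by (auto simp: \<delta>_def field_simps)
  show thesis
  proof (rule that[OF \<delta>(1)])
    fix u0 :: "real^'n \<Rightarrow> real" assume u0: "data_ball s R u0"
    have [measurable]: "u0 \<in> borel_measurable borel" using u0 by (rule data_ballD)
    let ?U = "picard_iterate u0"
    have tC: "t * C \<le> 1 / 2" "t powr s * C \<le> 1" if "t \<in> {0..\<delta>}" for t
    proof -
      have "t * C \<le> \<delta> * C" using that C(1) by (intro mult_right_mono) auto
      then show 1: "t * C \<le> 1 / 2" using \<delta>(3) by linarith
      have "t powr s \<le> t powr 1" using that \<delta>(2) s_gt_1 by (intro powr_mono') auto
      then have "t powr s * C \<le> t * C" using that C(1) by (intro mult_right_mono) auto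
      then show "t powr s * C \<le> 1" using 1 by linarith
    qed
    have step: "bounded_path \<delta> M (picard u0 v)" if v: "bounded_path \<delta> M v" for v
      unfolding bounded_path_def
    proof (intro conjI ballI)
      have [measurable]: "case_prod v \<in> borel_measurable (borel \<Otimes>\<^sub>M borel)" using v unfolding bounded_path_def by (rule conjunct1)
      show "case_prod (picard u0 v) \<in> borel_measurable (borel \<Otimes>\<^sub>M borel)" by measurable
      fix t assume t: "t \<in> {0..\<delta>}"
      note ps = picard_step[OF u0 v t SB]
      show "data_ball s M (picard u0 v t)"
        unfolding data_ball_def
      proof (intro conjI)
        have "(\<lambda>x. picard u0 v t x) \<in> borel_measurable borel" by measurable
        then show "picard u0 v t \<in> borel_measurable borel" by simp
        have "R + t * C \<le> M" using tC(1)[OF t] M(1) by linarith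
        then show "AE x in lborel. \<bar>picard u0 v t x\<bar> \<le> M"
          using ps(3) by (auto elim: eventually_mono)
        have "2 powr s * (R + t powr s * C) \<le> 2 powr s * (R + 1)"
          using tC(2)[OF t] by (intro mult_left_mono) auto
        then have "2 powr s * (R + t powr s * C) \<le> M" using M(2) by linarith
        then show "Lp_mass s (picard u0 v t) \<le> ennreal M"
          using ps(4) by (meson ennreal_leI order_trans)
      qed
    qed
    have U0: "bounded_path \<delta> M (?U 0)"
      unfolding bounded_path_def
    proof (intro conjI ballI)
      show "case_prod (?U 0) \<in> borel_measurable (borel \<Otimes>\<^sub>M borel)" by simp
      fix t assume "t \<in> {0..\<delta>}"
      then have t: "0 \<le> t" by simp
      have "data_ball s R (S_semigroup \<beta> t u0)"
        unfolding data_ball_def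
      proof (intro conjI)
        have "(\<lambda>x. S_semigroup \<beta> t u0 x) \<in> borel_measurable borel" by measurable
        then show "S_semigroup \<beta> t u0 \<in> borel_measurable borel" by simp
        show "AE x in lborel. \<bar>S_semigroup \<beta> t u0 x\<bar> \<le> R" by (rule S_semigroup_AE_bound[OF \<beta> t data_ballD(1,2)[OF u0]])
        show "Lp_mass s (S_semigroup \<beta> t u0) \<le> ennreal R"
          using S_semigroup_Lp_mass[OF \<beta> s_gt_1 t data_ballD(1,2)[OF u0]] data_ballD(3)[OF u0] by (rule order_trans)
      qed
      then show "data_ball s M (?U 0 t)" using M(1) by (auto intro: data_ball_mono)
    qed
    have U: "bounded_path \<delta> M (?U k)" for k
      by (induction k) (use U0 step in auto)
    \<comment> \<open>The iteration starts at the free evolution, so the first difference is a bare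
      Duhamel integral, at most t C \<le> 1.\<close>
    have diff: "\<bar>?U (Suc k) t x - ?U k t x\<bar> \<le> (1/2) ^ k" if t: "t \<in> {0..\<delta>}" for k t x
      using t
    proof (induction k arbitrary: t x)
      case 0
      then show ?case
        using picard_step(2)[OF u0 U0 0 SB, of x] tC(1)[OF 0] by (simp add: picard_def)
    next
      case (Suc k)
      have "?U (Suc (Suc k)) t x - ?U (Suc k) t x = picard u0 (?U (Suc k)) t x - picard u0 (?U k) t x" by simp
      also have "\<bar>\<dots>\<bar> \<le> t * (C * (1/2) ^ k)"
      proof (rule picard_diff_bound[OF U U Suc.prems SB u0])
        show "AE y in lborel. \<bar>?U (Suc k) \<tau> y - ?U k \<tau> y\<bar> \<le> (1/2) ^ k" if "\<tau> \<in> {0..\<delta>}" for \<tau>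
          by (rule AE_I2) (rule Suc.IH[OF that])
        show "0 \<le> (1/2 :: real) ^ k" by (rule zero_le_power) simp
      qed
      also have "\<dots> = (t * C) * (1/2) ^ k" by simp
      also have "\<dots> \<le> (1/2) * (1/2) ^ k" by (intro mult_right_mono tC(1) Suc.prems) simp
      finally show ?case by simp
    qed
    define u where "u t x = lim (\<lambda>k. ?U k t x)" for t x
    have conv: "(\<lambda>k. ?U k t x) \<longlonglongrightarrow> u t x" and rate: "\<bar>u t x - ?U k t x\<bar> \<le> 2 * (1/2) ^ k"
      if "t \<in> {0..\<delta>}" for t x k
      using geometric_cauchy_limit[of "\<lambda>k. ?U k t x", OF diff[OF that]] by (simp_all add: u_def)
    have U_meas [measurable]: "case_prod (?U k) \<in> borel_measurable (borel \<Otimes>\<^sub>M borel)" for k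
      using U[of k] unfolding bounded_path_def by (rule conjunct1)
    have u_path: "bounded_path \<delta> M u"
      unfolding bounded_path_def
    proof (intro conjI ballI)
      have "case_prod u = (\<lambda>z. lim (\<lambda>k. case_prod (?U k) z))" by (auto simp: u_def)
      then show um [measurable]: "case_prod u \<in> borel_measurable (borel \<Otimes>\<^sub>M borel)"
        by (simp only: borel_measurable_lim_metric U_meas)
      fix t assume t: "t \<in> {0..\<delta>}"
      have ball: "data_ball s M (?U k t)" for k using U[of k] t unfolding bounded_path_def by blast
      show "data_ball s M (u t)"
        unfolding data_ball_def
      proof (intro conjI)
        have "(\<lambda>x. u t x) \<in> borel_measurable borel" by measurable
        then show "u t \<in> borel_measurable borel" by simp
        have "AE x in lborel. \<forall>k. \<bar>?U k t x\<bar> \<le> M"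
          using data_ballD(2)[OF ball] by (simp add: AE_all_countable)
        then show "AE x in lborel. \<bar>u t x\<bar> \<le> M"
        proof eventually_elim
          case (elim x)
          then show ?case by (intro LIMSEQ_le_const2[OF tendsto_rabs[OF conv[OF t]]]) auto
        qed
        show "Lp_mass s (u t) \<le> ennreal M"
          using s_gt_1 by (intro Lp_mass_liminf[OF data_ballD(1)[OF ball] AE_I2[OF conv[OF t]] data_ballD(3)[OF ball]]) simp
      qed
    qed
    have "u t x = picard u0 u t x" if t: "t \<in> {0..\<delta>}" for t x
    proof (rule LIMSEQ_unique)
      show "(\<lambda>k. ?U (Suc k) t x) \<longlonglongrightarrow> u t x" using conv[OF t] by (rule LIMSEQ_Suc)
      have le: "\<bar>?U (Suc k) t x - picard u0 u t x\<bar> \<le> (1/2) ^ k" for k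
      proof -
        have "\<bar>picard u0 u t x - picard u0 (?U k) t x\<bar> \<le> t * (C * (2 * (1/2) ^ k))"
        proof (rule picard_diff_bound[OF u_path U t SB u0])
          show "AE y in lborel. \<bar>u \<tau> y - ?U k \<tau> y\<bar> \<le> 2 * (1/2) ^ k" if "\<tau> \<in> {0..\<delta>}" for \<tau>
            by (rule AE_I2) (rule rate[OF that])
          show "0 \<le> 2 * (1/2 :: real) ^ k" by (intro mult_nonneg_nonneg zero_le_power) simp_all
        qed
        also have "\<dots> = (t * C) * (2 * (1/2) ^ k)" by simp
        also have "\<dots> \<le> (1/2) * (2 * (1/2) ^ k)" by (intro mult_right_mono tC(1) t) simp
        finally show ?thesis by (simp add: abs_minus_commute)
      qed
      have "(\<lambda>k. (1/2 :: real) ^ k) \<longlonglongrightarrow> 0" by (rule LIMSEQ_power_zero) simp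
      then have "(\<lambda>k. ?U (Suc k) t x - picard u0 u t x) \<longlonglongrightarrow> 0"
        by (rule Lim_null_comparison[rotated]) (use le in auto)
      then show "(\<lambda>k. ?U (Suc k) t x) \<longlonglongrightarrow> picard u0 u t x" by (rule LIM_zero_cancel)
    qed
    then show "\<exists>u. pointwise_solution u0 \<delta> M u"
      using u_path by (auto simp: pointwise_solution_def)
  qed
qed

end

section \<open>Restarting and continuity in time\<close>

context fractional_problem
begin

lemma bounded_pathD:
  assumes "bounded_path T M u"
  shows "case_prod u \<in> borel_measurable (borel \<Otimes>\<^sub>M borel)" "t \<in> {0..T} \<Longrightarrow> data_ball s M (u t)"
proof -
  show "case_prod u \<in> borel_measurable (borel \<Otimes>\<^sub>M borel)"
    using assms unfolding bounded_path_def by (rule conjunct1)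
  show "data_ball s M (u t)" if "t \<in> {0..T}"
    using assms that unfolding bounded_path_def by (elim conjE) (rule bspec)
qed

lemma pointwise_solutionD:
  assumes "pointwise_solution u0 T M u"
  shows "bounded_path T M u" "t \<in> {0..T} \<Longrightarrow> u t x = picard u0 u t x"
proof -
  show "bounded_path T M u"
    using assms unfolding pointwise_solution_def by (rule conjunct1)
  show "u t x = picard u0 u t x" if "t \<in> {0..T}"
    using assms that unfolding pointwise_solution_def by (elim conjE) (drule (1) bspec, erule allE)
qed

lemma semigroup_duhamel:
  assumes u: "data_ball s M (u \<tau>)" and \<tau>: "\<tau> \<le> r" and h: "0 \<le> h"
  shows "S_semigroup \<beta> h (D u r \<tau>) = D u (h + r) \<tau>"
proof -
  have M: "0 \<le> M" using data_ball_nonneg[OF u] .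
  from source_bounds[OF M] obtain C where SB: "source_bound M C" .
  have b: "AE x in lborel. \<bar>source (u \<tau>) x\<bar> \<le> C" by (rule AE_I2) (rule source_abs_bound[OF SB u])
  have r: "0 \<le> r - \<tau>" using \<tau> by simp
  have "S_semigroup \<beta> h (S_semigroup \<beta> (r - \<tau>) (source (u \<tau>))) = S_semigroup \<beta> (h + (r - \<tau>)) (source (u \<tau>))"
    by (rule S_semigroup_semigroup[OF \<beta> h r source_borel[OF data_ballD(1)[OF u]] b])
  then show ?thesis by (simp add: duhamel_eq add_diff_eq)
qed

text \<open>The semigroup passes under the time integral by Fubini and moves the terminal time of
  every Duhamel integrand from r to h + r. The result is the evolution of the datum and of the
  sources active up to time r.\<close>

lemma semigroup_picard:
  assumes u0: "data_ball s R u0" and u: "bounded_path T M u" and r: "r \<in> {0..T}" and h: "0 \<le> h"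
  shows "S_semigroup \<beta> h (picard u0 u r) x = S_semigroup \<beta> (h + r) u0 x + (LINT \<tau>:{0..r}|lborel. D u (h + r) \<tau> x)"
proof (cases "h = 0")
  case True
  then show ?thesis by (simp add: S_semigroup_def picard_def)
next
  case False
  then have h0: "0 < h" using h by simp
  have r0: "0 \<le> r" using r by simp
  have [measurable]: "case_prod u \<in> borel_measurable (borel \<Otimes>\<^sub>M borel)" by (rule bounded_pathD[OF u])
  have [measurable]: "u0 \<in> borel_measurable borel" using u0 by (rule data_ballD)
  have ball: "data_ball s M (u \<tau>)" if "\<tau> \<in> {0..r}" for \<tau> using that r by (intro bounded_pathD(2)[OF u]) auto
  have "0 \<in> {0..r}" using r0 by simp
  from data_ball_nonneg[OF ball[OF this]] have M: "0 \<le> M" .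
  from source_bounds[OF M] obtain C where SB: "source_bound M C" .
  let ?v = "\<lambda>y. S_semigroup \<beta> r u0 y"
  let ?w = "\<lambda>y. LINT \<tau>:{0..r}|lborel. D u r \<tau> y"
  let ?i = "indicator {0..r} :: real \<Rightarrow> real"
  have v: "?v \<in> borel_measurable borel" "AE y in lborel. \<bar>?v y\<bar> \<le> R"
    by measurable (rule S_semigroup_AE_bound[OF \<beta> r0 data_ballD(1,2)[OF u0]])
  have w: "?w \<in> borel_measurable borel" "AE y in lborel. \<bar>?w y\<bar> \<le> r * C"
    by measurable (rule AE_I2, rule picard_step(2)[OF u0 u r SB])
  have Db: "\<bar>D u r \<tau> y\<bar> \<le> C" if "\<tau> \<in> {0..r}" for \<tau> y
    using that by (intro duhamel_bound[OF ball _ SB]) auto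
  have K: "integrable lborel (\<lambda>y. S_kernel \<beta> (x - y) h)"
    by (rule integrable_reflect[OF S_kernel_integrable[OF \<beta> h0]])
  have iC: "integrable lborel (\<lambda>\<tau>. ?i \<tau> * C)" using r0 by (intro integrable_mult_left) auto
  have pair: "integrable (lborel \<Otimes>\<^sub>M lborel) (\<lambda>(y, \<tau>). S_kernel \<beta> (x - y) h * (?i \<tau> *\<^sub>R D u r \<tau> y))"
  proof (rule Bochner_Integration.integrable_bound[OF integrable_product[OF K iC]])
    show "(\<lambda>(y, \<tau>). S_kernel \<beta> (x - y) h * (?i \<tau> *\<^sub>R D u r \<tau> y)) \<in> borel_measurable (lborel \<Otimes>\<^sub>M lborel)" by measurable
    have le: "\<bar>?i \<tau> * D u r \<tau> y\<bar> \<le> \<bar>?i \<tau> * C\<bar>" for \<tau> y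
      using Db[of \<tau> y] by (auto split: split_indicator)
    have "\<bar>S_kernel \<beta> (x - y) h * (?i \<tau> * D u r \<tau> y)\<bar> \<le> \<bar>S_kernel \<beta> (x - y) h * (?i \<tau> * C)\<bar>" for \<tau> y
      unfolding abs_mult[of "S_kernel \<beta> (x - y) h"] by (intro mult_left_mono le) simp
    then show "AE z in lborel \<Otimes>\<^sub>M lborel. norm (case z of (y, \<tau>) \<Rightarrow> S_kernel \<beta> (x - y) h * (?i \<tau> *\<^sub>R D u r \<tau> y))
        \<le> norm (case z of (y, \<tau>) \<Rightarrow> S_kernel \<beta> (x - y) h * (?i \<tau> * C))"
      by (intro AE_I2) (simp only: split_beta real_norm_def real_scaleR_def)
  qed
  have "S_semigroup \<beta> h ?w x = (\<integral>y. (\<integral>\<tau>. S_kernel \<beta> (x - y) h * (?i \<tau> *\<^sub>R D u r \<tau> y) \<partial>lborel) \<partial>lborel)"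
    using h0 unfolding set_lebesgue_integral_def by (simp add: S_semigroup_apply)
  also have "\<dots> = (\<integral>\<tau>. (\<integral>y. S_kernel \<beta> (x - y) h * (?i \<tau> *\<^sub>R D u r \<tau> y) \<partial>lborel) \<partial>lborel)"
    by (rule lborel_pair.Fubini_integral[OF pair, symmetric])
  also have "\<dots> = (\<integral>\<tau>. ?i \<tau> *\<^sub>R D u (h + r) \<tau> x \<partial>lborel)"
  proof (intro Bochner_Integration.integral_cong refl)
    fix \<tau>
    show "(\<integral>y. S_kernel \<beta> (x - y) h * (?i \<tau> *\<^sub>R D u r \<tau> y) \<partial>lborel) = ?i \<tau> *\<^sub>R D u (h + r) \<tau> x"
    proof (cases "\<tau> \<in> {0..r}")
      case True
      then have "S_semigroup \<beta> h (D u r \<tau>) x = D u (h + r) \<tau> x"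
        using semigroup_duhamel[of M u \<tau> r h] ball h by simp
      then show ?thesis using True h0 by (simp add: S_semigroup_apply)
    qed simp
  qed
  finally have w_eq: "S_semigroup \<beta> h ?w x = (LINT \<tau>:{0..r}|lborel. D u (h + r) \<tau> x)"
    by (simp add: set_lebesgue_integral_def)
  have "S_semigroup \<beta> h (\<lambda>y. ?v y + ?w y) x = S_semigroup \<beta> h ?v x + S_semigroup \<beta> h ?w x"
    by (rule S_semigroup_add[OF \<beta> h v w])
  moreover have "S_semigroup \<beta> h ?v = S_semigroup \<beta> (h + r) u0"
    using S_semigroup_semigroup[OF \<beta> h r0 data_ballD(1,2)[OF u0]] by simp
  ultimately show ?thesis using w_eq by (simp add: picard_def[abs_def])
qed

text \<open>The Duhamel integral is split at r; its part before r combines with the free evolution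
  of u0 into the evolution of u r.\<close>

lemma restart:
  assumes u0: "data_ball s R u0" and sol: "pointwise_solution u0 T M u" and rt: "0 \<le> r" "r \<le> t" "t \<le> T"
  shows "u t x = S_semigroup \<beta> (t - r) (u r) x + (LINT \<tau>:{r..t}|lborel. D u t \<tau> x)"
proof -
  note u = pointwise_solutionD(1)[OF sol]
  have r: "r \<in> {0..T}" and t: "t \<in> {0..T}" and h: "0 \<le> t - r" using rt by auto
  from data_ball_nonneg[OF bounded_pathD(2)[OF u t]] have M: "0 \<le> M" .
  from source_bounds[OF M] obtain C where SB: "source_bound M C" .
  have int: "set_integrable lborel {0..t} (\<lambda>\<tau>. D u t \<tau> x)" by (rule picard_step(1)[OF u0 u t SB])
  have "(LINT \<tau>:{0..r} \<union> {r..t}|lborel. D u t \<tau> x) = (LINT \<tau>:{0..r}|lborel. D u t \<tau> x) + (LINT \<tau>:{r..t}|lborel. D u t \<tau> x)"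
  proof (rule set_integral_Un_AE)
    show "AE \<tau> in lborel. \<not> (\<tau> \<in> {0..r} \<and> \<tau> \<in> {r..t})"
      using AE_lborel_singleton[of r] by eventually_elim auto
    show "set_integrable lborel {0..r} (\<lambda>\<tau>. D u t \<tau> x)" "set_integrable lborel {r..t} (\<lambda>\<tau>. D u t \<tau> x)"
      using rt by (auto intro: set_integrable_subset[OF int])
  qed auto
  moreover have "{0..r} \<union> {r..t} = {0..t}" using rt by auto
  moreover have "u r = picard u0 u r" using pointwise_solutionD(2)[OF sol r] by (intro ext)
  then have "S_semigroup \<beta> (t - r) (u r) x = S_semigroup \<beta> (t - r + r) u0 x + (LINT \<tau>:{0..r}|lborel. D u (t - r + r) \<tau> x)"
    using semigroup_picard[OF u0 u r h, of x] by simp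
  ultimately show ?thesis
    using pointwise_solutionD(2)[OF sol t, of x] by (simp add: picard_def)
qed

lemma increment_bounds:
  assumes u0: "data_ball s R u0" and sol: "pointwise_solution u0 T M u" and rt: "0 \<le> r" "r \<le> t" "t \<le> T"
    and SB: "source_bound M C"
  shows "\<bar>u t x - S_semigroup \<beta> (t - r) (u r) x\<bar> \<le> (t - r) * C"
    and "Lp_mass s (\<lambda>x. u t x - S_semigroup \<beta> (t - r) (u r) x) \<le> ennreal ((t - r) powr s * C)"
proof -
  note C = source_boundD(1)[OF SB]
  note u = pointwise_solutionD(1)[OF sol]
  have [measurable]: "case_prod u \<in> borel_measurable (borel \<Otimes>\<^sub>M borel)" by (rule bounded_pathD[OF u])
  have ball: "data_ball s M (u \<tau>)" if "\<tau> \<in> {r..t}" for \<tau> using that rt by (intro bounded_pathD(2)[OF u]) auto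
  have eq: "u t x - S_semigroup \<beta> (t - r) (u r) x = (LINT \<tau>:{r..t}|lborel. D u t \<tau> x)" for x
    using restart[OF u0 sol rt, of x] by simp
  have Db: "\<bar>D u t \<tau> x\<bar> \<le> C" if "\<tau> \<in> {r..t}" for \<tau> x
    using that by (intro duhamel_bound[OF ball _ SB]) auto
  have tm: "(\<lambda>\<tau>. D u t \<tau> x) \<in> borel_measurable borel" for x by measurable
  show "\<bar>u t x - S_semigroup \<beta> (t - r) (u r) x\<bar> \<le> (t - r) * C"
    unfolding eq using Db C by (intro time_integral_bound(2)[OF tm rt(2)]) auto
  have "Lp_mass s (\<lambda>x. LINT \<tau>:{r..t}|lborel. D u t \<tau> x) \<le> ennreal ((t - r) powr s) * ennreal C"
  proof (rule Lp_mass_time_integral[OF s_gt_1 rt(2)])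
    show "(\<lambda>(\<tau>, x). D u t \<tau> x) \<in> borel_measurable (borel \<Otimes>\<^sub>M borel)" by measurable
    show "Lp_mass s (D u t \<tau>) \<le> ennreal C" if "\<tau> \<in> {r..t}" for \<tau>
      using that by (intro duhamel_Lp_mass[OF ball _ SB]) auto
  qed (rule Db)
  then show "Lp_mass s (\<lambda>x. u t x - S_semigroup \<beta> (t - r) (u r) x) \<le> ennreal ((t - r) powr s * C)"
    unfolding eq using C by (simp add: ennreal_mult)
qed

lemma Lp_mass_minus: "Lp_mass s (\<lambda>x. - f x) = Lp_mass s f"
  by (simp add: Lp_mass_def)

lemma powr_le_self: "0 \<le> x \<Longrightarrow> x \<le> 1 \<Longrightarrow> x powr s \<le> x"
  using powr_mono'[of 1 s x] s_gt_1 by simp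

text \<open>One starting time r = t0 - \<eta> is used for both t and t0. The two Duhamel increments
  are of order \<eta>; what remains is the difference of S(t - r) and S(t0 - r) on u r, taken near
  the fixed positive time \<eta>. Positivity of t0 leaves room for r.\<close>

lemma solution_continuous_pos:
  assumes u0: "data_ball s R u0" and sol: "pointwise_solution u0 T M u" and t0: "0 < t0" "t0 \<le> T" and e: "0 < e"
  shows "\<exists>d>0. \<forall>t\<in>{0..T}. \<bar>t - t0\<bar> < d \<longrightarrow> (\<forall>x. \<bar>u t x - u t0 x\<bar> \<le> e) \<and> Lp_mass s (\<lambda>x. u t x - u t0 x) \<le> ennreal e"
proof -
  note u = pointwise_solutionD(1)[OF sol]
  have "t0 \<in> {0..T}" using t0 by simp
  from data_ball_nonneg[OF bounded_pathD(2)[OF u this]] have M: "0 \<le> M" .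
  from source_bounds[OF M] obtain C where SB: "source_bound M C" .
  note C = source_boundD[OF SB]
  \<comment> \<open>Three terms require two uses of the quasi-triangle inequality of
    \<open>Lp_mass\<close>, each costing 2^s.\<close>
  define Q :: real where "Q = 2 powr s * 2 powr s"
  have two: "1 \<le> 2 powr s" using s_gt_1 by (intro ge_one_powr_ge_zero) auto
  have Q: "1 \<le> Q" "2 powr s \<le> Q" using two mult_mono[of 1 "2 powr s" 1 "2 powr s"] mult_left_mono[of 1 "2 powr s" "2 powr s"]
    by (auto simp: Q_def)
  \<comment> \<open>\<eta> < t0 keeps r positive; \<eta> \<le> 1/2 keeps t - r \<le> 1, so that s-th
    powers are at most first powers; the last entry makes the two increments, at most 3 \<eta> C
    together, at most e / 2 after the factor Q.\<close>
  define \<eta> where "\<eta> = min (t0 / 2) (min (1 / 2) (e / (6 * Q * (C + 1))))"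
  have \<eta>: "0 < \<eta>" "\<eta> < t0" "\<eta> \<le> 1 / 2" "\<eta> \<le> e / (6 * Q * (C + 1))"
    using t0 e Q C(1) by (auto simp: \<eta>_def intro!: divide_pos_pos mult_pos_pos)
  have "0 < 6 * Q * (C + 1)" using Q C(1) by (intro mult_pos_pos) auto
  with \<eta>(4) have "6 * Q * (C + 1) * \<eta> \<le> e" by (simp only: pos_le_divide_eq mult.commute)
  then have \<eta>e: "Q * (3 * \<eta> * C) \<le> e / 2"
  proof -
    have "2 * (Q * (3 * \<eta> * C)) = 6 * Q * (C + 1) * \<eta> - 6 * Q * \<eta>" by (simp add: algebra_simps)
    moreover have "0 \<le> 6 * Q * \<eta>" using Q \<eta>(1) by simp
    ultimately show ?thesis using \<open>6 * Q * (C + 1) * \<eta> \<le> e\<close> by linarith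
  qed
  define r where "r = t0 - \<eta>"
  have r: "0 \<le> r" "r < t0" using \<eta> by (auto simp: r_def)
  define \<omega> where "\<omega> h = (\<integral>(x::real^'n). \<bar>S_kernel \<beta> x h - S_kernel \<beta> x \<eta>\<bar> \<partial>lborel)" for h
  have \<omega>0: "0 \<le> \<omega> h" for h by (simp add: \<omega>_def)
  have \<omega>\<eta>: "\<omega> \<eta> = 0" by (simp add: \<omega>_def)
  have "(\<omega> \<longlongrightarrow> 0) (at \<eta>)" unfolding \<omega>_def[abs_def] by (rule S_kernel_L1_continuous[OF \<beta> \<eta>(1)])
  moreover have pos: "0 < min 1 (e / (2 * Q * (M + 1)))" using e Q M by (auto intro!: divide_pos_pos mult_pos_pos)
  ultimately have "eventually (\<lambda>h. \<omega> h < min 1 (e / (2 * Q * (M + 1)))) (at \<eta>)" by (rule order_tendstoD(2))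
  then obtain d where d: "0 < d" "\<And>h. h \<noteq> \<eta> \<Longrightarrow> dist h \<eta> < d \<Longrightarrow> \<omega> h < min 1 (e / (2 * Q * (M + 1)))"
    unfolding eventually_at by auto
  have \<omega>_small: "\<omega> h \<le> 1" "Q * (\<omega> h * M) \<le> e / 2" if "\<bar>h - \<eta>\<bar> < d" for h
  proof -
    have w: "\<omega> h \<le> min 1 (e / (2 * Q * (M + 1)))"
      using d(2)[of h] that pos \<omega>\<eta> by (cases "h = \<eta>") (auto simp: dist_real_def)
    then show "\<omega> h \<le> 1" by simp
    have "0 < 2 * Q * (M + 1)" using Q M by (intro mult_pos_pos) auto
    moreover have "\<omega> h \<le> e / (2 * Q * (M + 1))" using w by simp
    ultimately have "2 * Q * (M + 1) * \<omega> h \<le> e" by (simp only: pos_le_divide_eq mult.commute)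
    then show "Q * (\<omega> h * M) \<le> e / 2"
    proof -
      have "2 * (Q * (\<omega> h * M)) = 2 * Q * (M + 1) * \<omega> h - 2 * Q * \<omega> h" by (simp add: algebra_simps)
      moreover have "0 \<le> 2 * Q * \<omega> h" using Q \<omega>0[of h] by simp
      ultimately show ?thesis using \<open>2 * Q * (M + 1) * \<omega> h \<le> e\<close> by linarith
    qed
  qed
  show ?thesis
  \<comment> \<open>The second entry keeps t - r between \<eta> / 2 and 3 \<eta> / 2, in particular
    r < t.\<close>
  proof (intro exI[of _ "min d (\<eta> / 2)"] conjI ballI impI allI)
    show "0 < min d (\<eta> / 2)" using d \<eta> by simp
  next
    fix t assume t: "t \<in> {0..T}" "\<bar>t - t0\<bar> < min d (\<eta> / 2)"
    have tr: "0 < t - r" "t - r \<le> 1" "\<bar>(t - r) - \<eta>\<bar> < d" "t - r \<le> 2 * \<eta>" "r \<le> t" "t \<le> T"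
    proof -
      have "\<bar>t - t0\<bar> < d" "\<bar>t - t0\<bar> < \<eta> / 2" using t(2) by (simp_all only: min_less_iff_conj)
      then have "t - t0 < d" "t0 - t < d" "t - t0 < \<eta> / 2" "t0 - t < \<eta> / 2" "t \<le> T" using t(1) by (simp_all only: abs_less_iff atLeastAtMost_iff) linarith+
      then show "0 < t - r" "t - r \<le> 1" "\<bar>(t - r) - \<eta>\<bar> < d" "t - r \<le> 2 * \<eta>" "r \<le> t" "t \<le> T"
        using \<eta>(1,3) unfolding r_def abs_less_iff by simp_all
    qed
    have t0r: "t0 - r = \<eta>" by (simp add: r_def)
    have "r \<in> {0..T}" using r t0 by simp
    note ur = bounded_pathD(2)[OF u this]
    let ?a = "\<lambda>x. u t x - S_semigroup \<beta> (t - r) (u r) x"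
    let ?b = "\<lambda>x. u t0 x - S_semigroup \<beta> (t0 - r) (u r) x"
    let ?c = "\<lambda>x. S_semigroup \<beta> (t - r) (u r) x - S_semigroup \<beta> (t0 - r) (u r) x"
    have [measurable]: "case_prod u \<in> borel_measurable (borel \<Otimes>\<^sub>M borel)" by (rule bounded_pathD[OF u])
    have decomp: "u t x - u t0 x = (?a x + - ?b x) + ?c x" for x by simp
    note ia = increment_bounds[OF u0 sol r(1) tr(5,6) SB]
    note ib = increment_bounds[OF u0 sol r(1) less_imp_le[OF r(2)] t0(2) SB]
    note ic = S_semigroup_time_diff[OF \<beta> tr(1) \<eta>(1) data_ballD(1,2)[OF ur], folded \<omega>_def]
    have inc: "(t - r) * C \<le> 2 * \<eta> * C" "(t0 - r) * C \<le> \<eta> * C"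
      using tr(4) C(1) t0r by (auto intro!: mult_right_mono)
    have bd: "2 * \<eta> * C + \<eta> * C + \<omega> (t - r) * M \<le> e"
    proof -
      have "1 * (3 * \<eta> * C) \<le> Q * (3 * \<eta> * C)" "1 * (\<omega> (t - r) * M) \<le> Q * (\<omega> (t - r) * M)"
        using Q \<eta>(1) C(1) M \<omega>0 by (intro mult_right_mono; simp)+
      then show ?thesis using \<eta>e \<omega>_small(2)[OF tr(3)] by linarith
    qed
    show "\<bar>u t x - u t0 x\<bar> \<le> e" for x
      using ia(1)[of x] ib(1)[of x] ic(1)[of x] inc bd unfolding t0r by linarith
    have A: "Lp_mass s ?a \<le> ennreal (2 * \<eta> * C)"
    proof -
      have "(t - r) powr s * C \<le> (t - r) * C"
        using tr C(1) by (intro mult_right_mono powr_le_self) auto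
      then show ?thesis using ia(2) inc(1) by (meson ennreal_leI order_trans)
    qed
    have Bb: "Lp_mass s (\<lambda>x. - ?b x) \<le> ennreal (\<eta> * C)"
    proof -
      have "(t0 - r) powr s * C \<le> (t0 - r) * C"
        using t0r \<eta> C(1) by (intro mult_right_mono powr_le_self) auto
      then show ?thesis unfolding Lp_mass_minus using ib(2) inc(2) by (meson ennreal_leI order_trans)
    qed
    have Cc: "Lp_mass s ?c \<le> ennreal (\<omega> (t - r) * M)"
    proof -
      have "Lp_mass s ?c \<le> ennreal (\<omega> (t - r) powr s) * Lp_mass s (u r)"
        unfolding t0r by (rule ic(2)[OF s_gt_1])
      also have "\<dots> \<le> ennreal (\<omega> (t - r)) * ennreal M"
        by (intro mult_mono ennreal_leI powr_le_self \<omega>0 \<omega>_small(1)[OF tr(3)] data_ballD(3)[OF ur]) auto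
      also have "\<dots> = ennreal (\<omega> (t - r) * M)" by (rule ennreal_mult[symmetric, OF \<omega>0 M])
      finally show ?thesis .
    qed
    have "Lp_mass s (\<lambda>x. u t x - u t0 x) \<le> ennreal (2 powr s) * (Lp_mass s (\<lambda>x. ?a x + - ?b x) + Lp_mass s ?c)"
      unfolding decomp using s_gt_1 by (intro Lp_mass_add_le) auto
    also have "\<dots> \<le> ennreal (2 powr s) * (ennreal (2 powr s) * (Lp_mass s ?a + Lp_mass s (\<lambda>x. - ?b x)) + Lp_mass s ?c)"
      using s_gt_1 by (intro mult_left_mono add_mono order_refl Lp_mass_add_le) auto
    also have "\<dots> \<le> ennreal (2 powr s) * (ennreal (2 powr s) * (ennreal (2 * \<eta> * C) + ennreal (\<eta> * C)) + ennreal (\<omega> (t - r) * M))"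
      by (intro mult_left_mono add_mono A Bb Cc) auto
    also have "\<dots> = ennreal (2 powr s * (2 powr s * (2 * \<eta> * C + \<eta> * C) + \<omega> (t - r) * M))"
    proof -
      have "ennreal a * (ennreal a * (ennreal b + ennreal c) + ennreal d) = ennreal (a * (a * (b + c) + d))"
        if "0 \<le> a" "0 \<le> b" "0 \<le> c" "0 \<le> d" for a b c d
        using that by (simp add: ennreal_mult)
      then show ?thesis
        using \<eta>(1) C(1) M \<omega>0[of "t - r"] by simp
    qed
    also have "\<dots> \<le> ennreal e"
    proof (intro ennreal_leI)
      have "2 powr s * (\<omega> (t - r) * M) \<le> Q * (\<omega> (t - r) * M)"
        using Q M \<omega>0 by (intro mult_right_mono) auto
      moreover have "2 powr s * (2 powr s * (2 * \<eta> * C + \<eta> * C)) = Q * (3 * \<eta> * C)"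
        by (simp add: Q_def)
      ultimately have "2 powr s * (2 powr s * (2 * \<eta> * C + \<eta> * C)) + 2 powr s * (\<omega> (t - r) * M) \<le> e"
        using \<eta>e \<omega>_small(2)[OF tr(3)] by linarith
      then show "2 powr s * (2 powr s * (2 * \<eta> * C + \<eta> * C) + \<omega> (t - r) * M) \<le> e"
        by (simp only: distrib_left)
    qed
    finally show "Lp_mass s (\<lambda>x. u t x - u t0 x) \<le> ennreal e" .
  qed
qed

lemma solution_at_0: "pointwise_solution u0 T M u \<Longrightarrow> 0 \<le> T \<Longrightarrow> u 0 = u0"
  using pointwise_solutionD(2)[of u0 T M u 0]
  by (auto simp: picard_def S_semigroup_def set_lebesgue_integral_def integral_eq_zero_AE AE_lborel_singleton fun_eq_iff
      intro!: integral_eq_zero_AE eventually_mono[OF AE_lborel_singleton[of 0]])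

text \<open>The claim is restricted to L^s: for merely bounded data S(t) u0 may fail to approach u0
  in sup norm.\<close>

lemma solution_continuous_0:
  assumes u0: "data_ball s R u0" and sol: "pointwise_solution u0 T M u" and T: "0 \<le> T" and e: "0 < e"
  shows "\<exists>d>0. \<forall>t\<in>{0..T}. \<bar>t - 0\<bar> < d \<longrightarrow> Lp_mass s (\<lambda>x. u t x - u 0 x) \<le> ennreal e"
proof -
  note u = pointwise_solutionD(1)[OF sol]
  have "0 \<in> {0..T}" using T by simp
  from data_ball_nonneg[OF bounded_pathD(2)[OF u this]] have M: "0 \<le> M" .
  from source_bounds[OF M] obtain C where SB: "source_bound M C" .
  note C = source_boundD[OF SB]
  have z: "u 0 = u0" by (rule solution_at_0[OF sol T])
  have [measurable]: "case_prod u \<in> borel_measurable (borel \<Otimes>\<^sub>M borel)" by (rule bounded_pathD[OF u])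
  have [measurable]: "u0 \<in> borel_measurable borel" by (rule data_ballD[OF u0])
  \<comment> \<open>Half of e after the factor 2^s: one share for the Duhamel increment, one for
    S(t) u0 - u0.\<close>
  define q where "q = e / (2 * 2 powr s)"
  have q: "0 < q" using e by (simp add: q_def)
  have "Lp_mass s u0 < \<infinity>" using data_ballD(3)[OF u0] by (simp add: le_less_trans)
  from S_semigroup_tendsto_initial[OF \<beta> s_gt_1 data_ballD(1,2)[OF u0] this]
  have "eventually (\<lambda>t. Lp_mass s (\<lambda>x. S_semigroup \<beta> t u0 x - u0 x) < ennreal q) (at_right 0)"
    using q by (intro order_tendstoD(2)) auto
  then obtain b where b: "0 < b" "\<And>t. 0 < t \<Longrightarrow> t < b \<Longrightarrow> Lp_mass s (\<lambda>x. S_semigroup \<beta> t u0 x - u0 x) < ennreal q"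
    unfolding eventually_at_right_field by auto
  show ?thesis
  proof (intro exI[of _ "min b (min 1 (q / (C + 1)))"] conjI ballI impI)
    show "0 < min b (min 1 (q / (C + 1)))" using b q C(1) by simp
  next
    fix t assume t: "t \<in> {0..T}" "\<bar>t - 0\<bar> < min b (min 1 (q / (C + 1)))"
    show "Lp_mass s (\<lambda>x. u t x - u 0 x) \<le> ennreal e"
    proof (cases "t = 0")
      case True
      then show ?thesis by (simp add: Lp_mass_zero)
    next
      case False
      then have t': "0 < t" "t < b" "t \<le> 1" "t < q / (C + 1)" "t \<le> T" using t by auto
      have tC: "t powr s * C \<le> q"
      proof -
        have "t powr s * C \<le> t * C" using t' C(1) by (intro mult_right_mono powr_le_self) auto
        also have "\<dots> \<le> t * (C + 1)" using t' by simp
        also have "\<dots> \<le> q" using t'(4) C(1) by (simp add: field_simps)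
        finally show ?thesis .
      qed
      note ia = increment_bounds(2)[OF u0 sol order_refl less_imp_le[OF t'(1)] t'(5) SB, simplified, unfolded z]
      have "Lp_mass s (\<lambda>x. u t x - u 0 x) = Lp_mass s (\<lambda>x. (u t x - S_semigroup \<beta> t u0 x) + (S_semigroup \<beta> t u0 x - u0 x))"
        by (simp add: z)
      also have "\<dots> \<le> ennreal (2 powr s) * (Lp_mass s (\<lambda>x. u t x - S_semigroup \<beta> t u0 x) + Lp_mass s (\<lambda>x. S_semigroup \<beta> t u0 x - u0 x))"
        using s_gt_1 by (intro Lp_mass_add_le) auto
      also have "\<dots> \<le> ennreal (2 powr s) * (ennreal q + ennreal q)"
        by (intro mult_left_mono add_mono order_trans[OF ia ennreal_leI[OF tC]] less_imp_le[OF b(2)[OF t'(1,2)]]) simp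
      also have "\<dots> = ennreal (2 powr s) * ennreal (q + q)" using q by (subst ennreal_plus) auto
      also have "\<dots> = ennreal (2 powr s * (q + q))" using q by (intro ennreal_mult[symmetric]) auto
      also have "2 powr s * (q + q) = e" by (simp add: q_def)
      finally show ?thesis .
    qed
  qed
qed

lemma solution_Lp_continuous:
  assumes u0: "data_ball s R u0" and sol: "pointwise_solution u0 T M u" and t0: "t0 \<in> {0..T}" and e: "0 < e"
  shows "\<exists>d>0. \<forall>t\<in>{0..T}. \<bar>t - t0\<bar> < d \<longrightarrow> Lp_mass s (\<lambda>x. u t x - u t0 x) \<le> ennreal e"
proof (cases "t0 = 0")
  case True
  then show ?thesis using solution_continuous_0[OF u0 sol _ e] t0 by simp
next
  case False
  then show ?thesis using solution_continuous_pos[OF u0 sol _ _ e, of t0] t0 by fastforce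
qed

end

section \<open>The norms and regularity of solutions\<close>

lemma Lp_spaceI:
  fixes f :: "real^'n \<Rightarrow> real"
  assumes [measurable]: "f \<in> borel_measurable borel" and "Lp_mass s f < \<infinity>"
  shows "f \<in> Lp_space s"
  using assms by (auto simp: Lp_space_def Lp_mass_def integrable_iff_bounded)

lemma Lp_mass_eq_norm:
  fixes f :: "real^'n \<Rightarrow> real"
  assumes f: "f \<in> Lp_space s" and s: "0 < s"
  shows "Lp_mass s f = ennreal (Lp_norm s f powr s)"
proof -
  have int: "integrable lborel (\<lambda>x. \<bar>f x\<bar> powr s)" using f by (simp add: Lp_space_def)
  have "0 \<le> (\<integral>x. \<bar>f x\<bar> powr s \<partial>lborel)" by simp
  then have "Lp_norm s f powr s = (\<integral>x. \<bar>f x\<bar> powr s \<partial>lborel)"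
    unfolding Lp_norm_def using s by (simp add: powr_powr)
  moreover have "Lp_mass s f = ennreal (\<integral>x. \<bar>f x\<bar> powr s \<partial>lborel)"
    unfolding Lp_mass_def by (rule nn_integral_eq_integral[OF int]) simp
  ultimately show ?thesis by simp
qed

lemma Lp_norm_le:
  fixes f :: "real^'n \<Rightarrow> real"
  assumes [measurable]: "f \<in> borel_measurable borel" and le: "Lp_mass s f \<le> ennreal e" and s: "0 < s" and e: "0 \<le> e"
  shows "f \<in> Lp_space s" "Lp_norm s f \<le> e powr (1 / s)"
proof -
  have "Lp_mass s f < \<infinity>" using le by (simp add: le_less_trans)
  then show f: "f \<in> Lp_space s" by (intro Lp_spaceI) auto
  then have int: "integrable lborel (\<lambda>x. \<bar>f x\<bar> powr s)" by (simp add: Lp_space_def)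
  have "ennreal (\<integral>x. \<bar>f x\<bar> powr s \<partial>lborel) \<le> ennreal e"
    using le unfolding Lp_mass_def by (subst (asm) nn_integral_eq_integral[OF int]) auto
  then have "(\<integral>x. \<bar>f x\<bar> powr s \<partial>lborel) \<le> e" using e by simp
  then show "Lp_norm s f \<le> e powr (1 / s)"
    unfolding Lp_norm_def using s by (intro powr_mono2) auto
qed

lemma Lp_norm_nonneg: "0 \<le> Lp_norm s f"
  by (simp add: Lp_norm_def)

lemma Linf_space_measurable: "f \<in> Linf_space \<Longrightarrow> f \<in> borel_measurable borel"
  by (simp add: Linf_space_def)

text \<open>Measurability is not assumed, because the measurability criterion for continuous paths
  asks for a norm that is nonnegative on all functions. For a non-measurable function the essential
  supremum is the top element, which is mapped to 0.\<close>

lemma Linf_norm_nonneg: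
  fixes f :: "real^'n \<Rightarrow> real"
  shows "0 \<le> Linf_norm f"
proof (cases "(\<lambda>x. ereal \<bar>f x\<bar>) \<in> borel_measurable lborel")
  case True
  then have "esssup lborel (\<lambda>x::real^'n. 0 :: ereal) \<le> esssup lborel (\<lambda>x. ereal \<bar>f x\<bar>)"
    by (intro esssup_AE_mono) auto
  then show ?thesis unfolding Linf_norm_def
    by (simp add: esssup_const real_of_ereal_pos)
next
  case False
  then show ?thesis by (simp add: Linf_norm_def esssup_non_measurable top_ereal_def)
qed

lemma Linf_norm_le:
  fixes f :: "real^'n \<Rightarrow> real"
  assumes [measurable]: "f \<in> borel_measurable borel" and AE: "AE x in lborel. \<bar>f x\<bar> \<le> c"
  shows "f \<in> Linf_space" "Linf_norm f \<le> c"
proof -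
  have le: "esssup lborel (\<lambda>x. ereal \<bar>f x\<bar>) \<le> ereal c"
    using AE by (intro esssup_I) auto
  then show "f \<in> Linf_space" by (auto simp: Linf_space_def)
  have "AE (x::real^'n) in lborel. 0 \<le> c" using AE by eventually_elim simp
  then have "0 \<le> c" by (rule AE_lborel_const)
  then show "Linf_norm f \<le> c" unfolding Linf_norm_def
    using le by (cases "esssup lborel (\<lambda>x. ereal \<bar>f x\<bar>)") auto
qed

lemma Linf_norm_AE:
  fixes f :: "real^'n \<Rightarrow> real"
  assumes f: "f \<in> Linf_space"
  shows "AE x in lborel. \<bar>f x\<bar> \<le> Linf_norm f"
proof -
  have fin: "esssup lborel (\<lambda>x. ereal \<bar>f x\<bar>) < \<infinity>" using f by (simp add: Linf_space_def)
  have [measurable]: "f \<in> borel_measurable borel" using f by (rule Linf_space_measurable)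
  have "esssup lborel (\<lambda>x::real^'n. 0 :: ereal) \<le> esssup lborel (\<lambda>x. ereal \<bar>f x\<bar>)"
    by (rule esssup_mono) auto
  then have "0 \<le> esssup lborel (\<lambda>x. ereal \<bar>f x\<bar>)" by (simp add: esssup_const)
  with fin have eq: "ereal (Linf_norm f) = esssup lborel (\<lambda>x. ereal \<bar>f x\<bar>)"
    unfolding Linf_norm_def by (cases "esssup lborel (\<lambda>x. ereal \<bar>f x\<bar>)") auto
  show ?thesis
    using esssup_AE[of "\<lambda>x. ereal \<bar>f x\<bar>" lborel] unfolding eq[symmetric] by simp
qed

lemma data_ball_norms:
  fixes f :: "real^'n \<Rightarrow> real"
  assumes f: "data_ball s M f" and s: "0 < s"
  shows "f \<in> Lp_space s" "f \<in> Linf_space" "Lp_norm s f \<le> M powr (1 / s)" "Linf_norm f \<le> M"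
  using Lp_norm_le[OF data_ballD(1,3)[OF f] s data_ball_nonneg[OF f]] Linf_norm_le[OF data_ballD(1,2)[OF f]]
  by auto

text \<open>Z bounds the sup norm and Z^s the mass; the maximum serves both. This expression
  converts norm bounds into ball sizes throughout.\<close>

lemma data_ball_of_norms:
  fixes f :: "real^'n \<Rightarrow> real"
  assumes f: "f \<in> Lp_space s" "f \<in> Linf_space" and s: "0 < s" and Z: "Lp_norm s f \<le> Z" "Linf_norm f \<le> Z"
  shows "data_ball s (max Z (Z powr s)) f"
  unfolding data_ball_def
proof (intro conjI)
  show "f \<in> borel_measurable borel" using f(2) by (rule Linf_space_measurable)
  show "AE x in lborel. \<bar>f x\<bar> \<le> max Z (Z powr s)"
    using Linf_norm_AE[OF f(2)] by eventually_elim (use Z(2) in simp)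
  have "Lp_norm s f powr s \<le> Z powr s" using Z(1) s Lp_norm_nonneg[of s f] by (intro powr_mono2) auto
  then show "Lp_mass s f \<le> ennreal (max Z (Z powr s))"
    unfolding Lp_mass_eq_norm[OF f(1) s] by (intro ennreal_leI) simp
qed

text \<open>The approximating step maps sample the path at the midpoints of a uniform subdivision.\<close>

lemma strongly_measurable_continuous:
  fixes u :: "real \<Rightarrow> real^'n \<Rightarrow> real"
  assumes T: "0 < T" and V: "\<And>t. t \<in> {0<..<T} \<Longrightarrow> u t \<in> V" and N: "\<And>f. 0 \<le> N f"
    and cont: "\<And>t0 e. t0 \<in> {0<..<T} \<Longrightarrow> 0 < e \<Longrightarrow> \<exists>d>0. \<forall>t\<in>{0<..<T}. \<bar>t - t0\<bar> < d \<longrightarrow> N (\<lambda>x. u t x - u t0 x) \<le> e"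
  shows "strongly_measurable_into V N {0<..<T} u"
proof -
  define q where "q k t = T * (real_of_int \<lfloor>t * real (Suc k) / T\<rfloor> + 1 / 2) / real (Suc k)" for k and t :: real
  have fl: "0 \<le> \<lfloor>t * real (Suc k) / T\<rfloor>" "\<lfloor>t * real (Suc k) / T\<rfloor> < int (Suc k)" if "t \<in> {0<..<T}" for t k
  proof -
    have "0 \<le> t * real (Suc k) / T" using that T by (intro divide_nonneg_pos mult_nonneg_nonneg) auto
    then show "0 \<le> \<lfloor>t * real (Suc k) / T\<rfloor>" by simp
    have "t * real (Suc k) < T * real (Suc k)" using that by (intro mult_strict_right_mono) auto
    then have "t * real (Suc k) / T < real (Suc k)" using T by (simp add: pos_divide_less_eq mult.commute)
    then show "\<lfloor>t * real (Suc k) / T\<rfloor> < int (Suc k)" by (simp add: floor_less_iff)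
  qed
  have q_in: "q k t \<in> {0<..<T}" if t: "t \<in> {0<..<T}" for k t
  proof -
    let ?j = "real_of_int \<lfloor>t * real (Suc k) / T\<rfloor>"
    have j: "0 \<le> ?j" "?j \<le> real (Suc k) - 1"
      using fl[OF t, of k] by linarith+
    have "0 < T * (?j + 1 / 2)" using j(1) T by (intro mult_pos_pos) linarith+
    moreover have "T * (?j + 1 / 2) < T * real (Suc k)" using j(2) T by (intro mult_strict_left_mono) linarith+
    ultimately show ?thesis unfolding q_def
      by (auto simp: pos_divide_less_eq simp del: of_nat_Suc intro!: divide_pos_pos)
  qed
  have q_close: "\<bar>q k t - t\<bar> \<le> T / real (Suc k)" for k t
  proof -
    let ?y = "t * real (Suc k) / T"
    have "q k t - t = T * (real_of_int \<lfloor>?y\<rfloor> + 1 / 2 - ?y) / real (Suc k)"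
    proof -
      have "T * (j + 1 / 2) / N - t = T * (j + 1 / 2 - t * N / T) / N" if "0 < N" for j N
        using that T by (simp add: field_simps)
      then show ?thesis unfolding q_def by simp
    qed
    then have "\<bar>q k t - t\<bar> = T * \<bar>real_of_int \<lfloor>?y\<rfloor> + 1 / 2 - ?y\<bar> / real (Suc k)"
      using T by (simp add: abs_mult)
    also have "\<dots> \<le> T * 1 / real (Suc k)"
    proof (intro divide_right_mono mult_left_mono)
      show "\<bar>real_of_int \<lfloor>?y\<rfloor> + 1 / 2 - ?y\<bar> \<le> 1" by linarith
    qed (use T in auto)
    finally show ?thesis by simp
  qed
  show ?thesis
    unfolding strongly_measurable_into_def
  proof (intro exI[of _ "\<lambda>k t. u (q k t)"] conjI allI)
    fix k
    have "simple_function (restrict_space lborel {0<..<T}) (q k)"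
    proof (rule simple_function_borel_measurable)
      have "q k \<in> borel_measurable borel" unfolding q_def[abs_def] by measurable
      then show "q k \<in> borel_measurable (restrict_space lborel {0<..<T})"
        by (intro measurable_restrict_space1) simp
      have "q k ` {0<..<T} \<subseteq> (\<lambda>j. T * (real_of_int j + 1 / 2) / real (Suc k)) ` {0..<int (Suc k)}"
      proof (rule image_subsetI)
        fix t assume "t \<in> {0<..<T}"
        from fl[OF this, of k] show "q k t \<in> (\<lambda>j. T * (real_of_int j + 1 / 2) / real (Suc k)) ` {0..<int (Suc k)}"
          unfolding q_def by (intro imageI) simp
      qed
      then have "finite (q k ` {0<..<T})" by (rule finite_subset) simp
      then show "finite (q k ` space (restrict_space lborel {0<..<T}))" by (simp add: space_restrict_space)
    qed
    then show "simple_function (restrict_space lborel {0<..<T}) (\<lambda>t. u (q k t))"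
      by (rule simple_function_compose1)
    show "(\<lambda>t. u (q k t)) ` {0<..<T} \<subseteq> V" using V q_in by blast
  next
    show "AE t in restrict_space lborel {0<..<T}. u t \<in> V \<and> (\<lambda>k. N (\<lambda>x. u (q k t) x - u t x)) \<longlonglongrightarrow> 0"
    proof (rule AE_I2)
      fix t assume "t \<in> space (restrict_space lborel {0<..<T})"
      then have t: "t \<in> {0<..<T}" by (simp add: space_restrict_space)
      have "(\<lambda>k. N (\<lambda>x. u (q k t) x - u t x)) \<longlonglongrightarrow> 0"
      proof (rule tendstoI)
        fix e :: real assume e: "0 < e"
        then obtain d where d: "0 < d" "\<And>r. r \<in> {0<..<T} \<Longrightarrow> \<bar>r - t\<bar> < d \<Longrightarrow> N (\<lambda>x. u r x - u t x) \<le> e / 2"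
          using cont[OF t, of "e / 2"] by auto
        have "(\<lambda>k. T * inverse (real (Suc k))) \<longlonglongrightarrow> T * 0" by (intro tendsto_intros LIMSEQ_inverse_real_of_nat)
        then have "eventually (\<lambda>k. T * inverse (real (Suc k)) < d) sequentially"
          using d(1) by (intro order_tendstoD(2)[where y = "T * 0"]) auto
        then show "eventually (\<lambda>k. dist (N (\<lambda>x. u (q k t) x - u t x)) 0 < e) sequentially"
        proof eventually_elim
          case (elim k)
          then have "\<bar>q k t - t\<bar> < d" using q_close[of k t] by (simp add: divide_inverse del: of_nat_Suc)
          from d(2)[OF q_in[OF t] this] show ?case using N[of "\<lambda>x. u (q k t) x - u t x"] e by simp
        qed
      qed
      then show "u t \<in> V \<and> (\<lambda>k. N (\<lambda>x. u (q k t) x - u t x)) \<longlonglongrightarrow> 0" using V[OF t] by simp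
    qed
  qed
qed

lemma X_norm_nonneg: "0 \<le> X_norm s f"
  by (simp add: X_norm_def Lp_norm_nonneg Linf_norm_nonneg)

context fractional_problem
begin

lemma s_pos: "0 < s" using s_gt_1 by simp

lemma solution_X_continuous:
  assumes u0: "data_ball s R u0" and sol: "pointwise_solution u0 T M u" and t0: "t0 \<in> {0<..<T}" and e: "0 < e"
  shows "\<exists>d>0. \<forall>t\<in>{0<..<T}. \<bar>t - t0\<bar> < d \<longrightarrow> X_norm s (\<lambda>x. u t x - u t0 x) \<le> e \<and> Linf_norm (\<lambda>x. u t x - u t0 x) \<le> e"
proof -
  note u = pointwise_solutionD(1)[OF sol]
  have um [measurable]: "case_prod u \<in> borel_measurable (borel \<Otimes>\<^sub>M borel)" by (rule bounded_pathD[OF u])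
  \<comment> \<open>Mass e' corresponds to L^s norm at most e / 2, and e' itself bounds the sup norm
    by e / 2.\<close>
  define e' where "e' = min (e / 2) ((e / 2) powr s)"
  have e': "0 < e'" using e by (simp add: e'_def)
  have "e' powr (1 / s) \<le> ((e / 2) powr s) powr (1 / s)" using e' s_pos by (intro powr_mono2) (auto simp: e'_def)
  also have "\<dots> = e / 2" using e s_pos by (simp add: powr_powr)
  finally have e's: "e' powr (1 / s) \<le> e / 2" .
  have "0 < t0" "t0 \<le> T" using t0 by auto
  from solution_continuous_pos[OF u0 sol this e'] obtain d where d: "0 < d"
    "\<And>t. t \<in> {0..T} \<Longrightarrow> \<bar>t - t0\<bar> < d \<Longrightarrow> (\<forall>x. \<bar>u t x - u t0 x\<bar> \<le> e') \<and> Lp_mass s (\<lambda>x. u t x - u t0 x) \<le> ennreal e'"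
    by blast
  show ?thesis
  proof (intro exI[of _ d] conjI ballI impI)
    fix t assume t: "t \<in> {0<..<T}" "\<bar>t - t0\<bar> < d"
    then have t': "t \<in> {0..T}" by auto
    have m: "(\<lambda>x. u t x - u t0 x) \<in> borel_measurable borel" by measurable
    have L: "Lp_norm s (\<lambda>x. u t x - u t0 x) \<le> e / 2"
      using Lp_norm_le(2)[OF m _ s_pos less_imp_le[OF e']] d(2)[OF t' t(2)] e's by (blast intro: order_trans)
    have "Linf_norm (\<lambda>x. u t x - u t0 x) \<le> e'"
      using d(2)[OF t' t(2)] by (intro Linf_norm_le(2)[OF m] AE_I2) blast
    then have I: "Linf_norm (\<lambda>x. u t x - u t0 x) \<le> e / 2" by (simp add: e'_def)
    show "X_norm s (\<lambda>x. u t x - u t0 x) \<le> e" using L I by (simp add: X_norm_def)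
    show "Linf_norm (\<lambda>x. u t x - u t0 x) \<le> e" using I e by simp
  qed (use d in simp)
qed

lemma solution_C_time:
  assumes u0: "data_ball s R u0" and sol: "pointwise_solution u0 T M u"
  shows "u \<in> C_time (Lp_space s) (Lp_norm s) {0..T}"
  unfolding C_time_def
proof (intro CollectI ballI conjI)
  note u = pointwise_solutionD(1)[OF sol]
  have um [measurable]: "case_prod u \<in> borel_measurable (borel \<Otimes>\<^sub>M borel)" by (rule bounded_pathD[OF u])
  fix t0 assume t0: "t0 \<in> {0..T}"
  show "u t0 \<in> Lp_space s" by (rule data_ball_norms(1)[OF bounded_pathD(2)[OF u t0] s_pos])
  show "((\<lambda>r. Lp_norm s (\<lambda>x. u r x - u t0 x)) \<longlongrightarrow> 0) (at t0 within {0..T})"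
  proof (rule tendstoI)
    fix e :: real assume e: "0 < e"
    define e' where "e' = (e / 2) powr s"
    have e': "0 < e'" "e' powr (1 / s) = e / 2" using e s_pos by (simp_all add: e'_def powr_powr)
    from solution_Lp_continuous[OF u0 sol t0 e'(1)] obtain d where d: "0 < d"
      "\<And>t. t \<in> {0..T} \<Longrightarrow> \<bar>t - t0\<bar> < d \<Longrightarrow> Lp_mass s (\<lambda>x. u t x - u t0 x) \<le> ennreal e'" by blast
    show "eventually (\<lambda>r. dist (Lp_norm s (\<lambda>x. u r x - u t0 x)) 0 < e) (at t0 within {0..T})"
      unfolding eventually_at
    proof (intro exI[of _ d] conjI ballI impI)
      fix r assume r: "r \<in> {0..T}" "r \<noteq> t0 \<and> dist r t0 < d"
      have m: "(\<lambda>x. u r x - u t0 x) \<in> borel_measurable borel" by measurable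
      have "Lp_norm s (\<lambda>x. u r x - u t0 x) \<le> e / 2"
        using Lp_norm_le(2)[OF m d(2)[OF r(1)] s_pos less_imp_le[OF e'(1)]] r(2) e'(2) by (simp add: dist_real_def)
      then show "dist (Lp_norm s (\<lambda>x. u r x - u t0 x)) 0 < e"
        using Lp_norm_nonneg[of s "\<lambda>x. u r x - u t0 x"] e by simp
    qed (use d in simp)
  qed
qed

text \<open>Strong measurability into L^\<infinity> asks for simple maps that approximate in sup
  norm; continuity on the open interval, away from time 0, provides them.\<close>

lemma solution_regular:
  assumes u0: "data_ball s R u0" and sol: "pointwise_solution u0 T M u" and T: "0 < T"
  shows "regular_mild_solution \<alpha> \<beta> p s u0 T u"
proof -
  note u = pointwise_solutionD(1)[OF sol]
  have ball: "data_ball s M (u t)" if "t \<in> {0<..<T}" for t using that by (intro bounded_pathD(2)[OF u]) auto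
  note nb = data_ball_norms[OF ball s_pos]
  have "T \<in> {0..T}" using T by simp
  from data_ball_nonneg[OF bounded_pathD(2)[OF u this]] have M: "0 \<le> M" .
  from source_bounds[OF M] obtain C where SB: "source_bound M C" .
  have X: "u \<in> Linf_time (X_space s) (X_norm s) {0<..<T}"
    unfolding Linf_time_def
  proof (intro CollectI conjI exI[of _ "M powr (1 / s) + M"] AE_I2)
    show "strongly_measurable_into (X_space s) (X_norm s) {0<..<T} u"
    proof (rule strongly_measurable_continuous[OF T _ X_norm_nonneg])
      show "u t \<in> X_space s" if "t \<in> {0<..<T}" for t using nb(1,2)[OF that] by (simp add: X_space_def)
      show "\<exists>d>0. \<forall>t\<in>{0<..<T}. \<bar>t - t0\<bar> < d \<longrightarrow> X_norm s (\<lambda>x. u t x - u t0 x) \<le> e" if "t0 \<in> {0<..<T}" "0 < e" for t0 e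
        using solution_X_continuous[OF u0 sol that] by blast
    qed
    fix t assume "t \<in> space (restrict_space lborel {0<..<T})"
    then have t: "t \<in> {0<..<T}" by (simp add: space_restrict_space)
    show "u t \<in> X_space s" using nb(1,2)[OF t] by (simp add: X_space_def)
    show "X_norm s (u t) \<le> M powr (1 / s) + M" unfolding X_norm_def by (rule add_mono[OF nb(3,4)[OF t]])
  qed
  have I: "u \<in> Linf_time Linf_space Linf_norm {0<..<T}"
    unfolding Linf_time_def
  proof (intro CollectI conjI exI[of _ M] AE_I2)
    show "strongly_measurable_into Linf_space Linf_norm {0<..<T} u"
    proof (rule strongly_measurable_continuous[OF T _ Linf_norm_nonneg])
      show "u t \<in> Linf_space" if "t \<in> {0<..<T}" for t using nb(2)[OF that] .
      show "\<exists>d>0. \<forall>t\<in>{0<..<T}. \<bar>t - t0\<bar> < d \<longrightarrow> Linf_norm (\<lambda>x. u t x - u t0 x) \<le> e" if "t0 \<in> {0<..<T}" "0 < e" for t0 e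
        using solution_X_continuous[OF u0 sol that] by blast
    qed
    fix t assume "t \<in> space (restrict_space lborel {0<..<T})"
    then have t: "t \<in> {0<..<T}" by (simp add: space_restrict_space)
    show "u t \<in> Linf_space" "Linf_norm (u t) \<le> M" using nb(2,4)[OF t] by auto
  qed
  have "mild_solution \<alpha> \<beta> p s u0 T u"
    unfolding mild_solution_def
  proof (intro conjI X ballI)
    show "AE x in lborel. u 0 x = u0 x" using solution_at_0[OF sol] T by simp
    fix t assume t: "t \<in> {0..T}"
    show "AE x in lborel. set_integrable lborel {0..t} (\<lambda>\<tau>. D u t \<tau> x) \<and>
        u t x = S_semigroup \<beta> t u0 x + (LINT \<tau>:{0..t}|lborel. D u t \<tau> x)"
    proof (intro AE_I2 conjI)
      fix x
      show "set_integrable lborel {0..t} (\<lambda>\<tau>. D u t \<tau> x)" by (rule picard_step(1)[OF u0 u t SB])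
      show "u t x = S_semigroup \<beta> t u0 x + (LINT \<tau>:{0..t}|lborel. D u t \<tau> x)"
        using pointwise_solutionD(2)[OF sol t, of x] by (simp only: picard_def)
    qed
  qed
  with I solution_C_time[OF u0 sol] show ?thesis unfolding regular_mild_solution_def by blast
qed

end

section \<open>Uniqueness, continuation and blow-up\<close>

lemma Linf_time_cong:
  assumes eq: "\<And>t. t \<in> I \<Longrightarrow> u t = v t" and I: "I \<in> sets borel" and u: "u \<in> Linf_time V N I"
  shows "v \<in> Linf_time V N I"
proof -
  have sp: "u t = v t" if "t \<in> space (restrict_space lborel I)" for t
    using that eq by (simp add: space_restrict_space)
  have AE: "(AE t in restrict_space lborel I. P t (u t)) \<longleftrightarrow> (AE t in restrict_space lborel I. P t (v t))" for P
    by (rule AE_cong) (simp add: sp)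
  show ?thesis
    using u unfolding Linf_time_def strongly_measurable_into_def
    by (simp only: mem_Collect_eq AE[of "\<lambda>t f. f \<in> V \<and> (\<lambda>k. N (\<lambda>x. \<sigma> k t x - f x)) \<longlonglongrightarrow> 0" for \<sigma>] AE[of "\<lambda>t f. f \<in> V \<and> N f \<le> C" for C])
qed

lemma C_time_cong:
  assumes eq: "\<And>t. t \<in> I \<Longrightarrow> u t = v t" and u: "u \<in> C_time V N I"
  shows "v \<in> C_time V N I"
  unfolding C_time_def
proof (intro CollectI ballI conjI)
  fix t assume t: "t \<in> I"
  show "v t \<in> V" using u t eq[OF t] by (auto simp: C_time_def)
  have "((\<lambda>r. N (\<lambda>x. u r x - u t x)) \<longlongrightarrow> 0) (at t within I)" using u t by (auto simp: C_time_def)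
  moreover have "eventually (\<lambda>r. N (\<lambda>x. u r x - u t x) = N (\<lambda>x. v r x - v t x)) (at t within I)"
    unfolding eventually_at_filter using eq t by (intro always_eventually) auto
  ultimately show "((\<lambda>r. N (\<lambda>x. v r x - v t x)) \<longlongrightarrow> 0) (at t within I)"
    by (rule Lim_transform_eventually)
qed

text \<open>Otherwise the interval would be a null set. This supplies good times for paths that are
  bounded only almost everywhere in time.\<close>

lemma AE_interval_witness:
  fixes a b :: real
  assumes "AE t in lborel. P t" "a < b"
  shows "\<exists>t\<in>{a<..<b}. P t"
proof (rule ccontr)
  assume "\<not> ?thesis"
  then have "AE t in lborel. t \<notin> {a<..<b}"
    using assms(1) by (auto elim: eventually_mono)
  then have "emeasure lborel {a<..<b} = 0"
    by (intro null_setsD1) (simp add: AE_iff_null_sets)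
  then show False using assms(2) by simp
qed

context fractional_problem
begin

lemma duhamel_cong: "u \<tau> = v \<tau> \<Longrightarrow> D u t \<tau> = D v t \<tau>"
  by (simp add: duhamel_eq)

lemma picard_cong:
  assumes "\<And>\<tau>. \<tau> \<in> {0..t} \<Longrightarrow> D u t \<tau> x = D v t \<tau> x"
  shows "picard u0 u t x = picard u0 v t x"
  unfolding picard_def using assms by (intro arg_cong2[where f = "(+)"] refl set_lebesgue_integral_cong) auto

text \<open>Serves the maximal solution, a glued function that agrees with a given constructed
  solution only on its interval.\<close>

lemma regular_cong:
  fixes u v :: "real \<Rightarrow> real^'n \<Rightarrow> real"
  assumes eq: "\<And>t. t \<in> {0..T} \<Longrightarrow> u t = v t" and T: "0 \<le> T" and u: "regular_mild_solution \<alpha> \<beta> p s u0 T u"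
  shows "regular_mild_solution \<alpha> \<beta> p s u0 T v"
proof -
  have ms: "mild_solution \<alpha> \<beta> p s u0 T u" and C: "u \<in> C_time (Lp_space s) (Lp_norm s) {0..T}"
    and I: "u \<in> Linf_time Linf_space Linf_norm {0<..<T}"
    using u by (auto simp: regular_mild_solution_def)
  have X: "u \<in> Linf_time (X_space s) (X_norm s) {0<..<T}" and ini: "AE x in lborel. u 0 x = u0 x"
    and eqn: "\<And>t. t \<in> {0..T} \<Longrightarrow> AE x in lborel. set_integrable lborel {0..t} (\<lambda>\<tau>. D u t \<tau> x) \<and>
        u t x = S_semigroup \<beta> t u0 x + (LINT \<tau>:{0..t}|lborel. D u t \<tau> x)"
    using ms by (auto simp: mild_solution_def)
  have "mild_solution \<alpha> \<beta> p s u0 T v"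
    unfolding mild_solution_def
  proof (intro conjI ballI)
    show "v \<in> Linf_time (X_space s) (X_norm s) {0<..<T}"
      by (rule Linf_time_cong[OF _ _ X]) (auto intro: eq)
    show "AE x in lborel. v 0 x = u0 x" using ini eq[of 0] T by simp
    fix t assume t: "t \<in> {0..T}"
    have Deq: "D u t \<tau> x = D v t \<tau> x" if "\<tau> \<in> {0..t}" for \<tau> x
      using duhamel_cong[of u \<tau> v t] eq[of \<tau>] that t by auto
    have "set_integrable lborel {0..t} (\<lambda>\<tau>. D u t \<tau> x) = set_integrable lborel {0..t} (\<lambda>\<tau>. D v t \<tau> x)" for x
      by (rule set_integrable_cong) (auto intro: Deq)
    moreover have "(LINT \<tau>:{0..t}|lborel. D u t \<tau> x) = (LINT \<tau>:{0..t}|lborel. D v t \<tau> x)" for x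
      by (rule set_lebesgue_integral_cong) (auto intro: Deq)
    ultimately show "AE x in lborel. set_integrable lborel {0..t} (\<lambda>\<tau>. D v t \<tau> x) \<and>
        v t x = S_semigroup \<beta> t u0 x + (LINT \<tau>:{0..t}|lborel. D v t \<tau> x)"
      using eqn[OF t] eq[OF t] by simp
  qed
  moreover have "v \<in> C_time (Lp_space s) (Lp_norm s) {0..T}" by (rule C_time_cong[OF eq C])
  moreover have "v \<in> Linf_time Linf_space Linf_norm {0<..<T}" by (rule Linf_time_cong[OF _ _ I]) (auto intro: eq)
  ultimately show ?thesis unfolding regular_mild_solution_def by blast
qed

text \<open>Membership in the ball holds only at almost every time, as boundedness in the sense of
  L^\<infinity> in time permits; the equation holds at every time, but only for almost every
  x.\<close>

definition ae_solution :: "(real^'n \<Rightarrow> real) \<Rightarrow> real \<Rightarrow> real \<Rightarrow> (real \<Rightarrow> real^'n \<Rightarrow> real) \<Rightarrow> bool" where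
  "ae_solution u0 T M v \<longleftrightarrow> (AE \<tau> in lborel. \<tau> \<in> {0<..<T} \<longrightarrow> data_ball s M (v \<tau>)) \<and>
    (\<forall>t\<in>{0..T}. AE x in lborel. set_integrable lborel {0..t} (\<lambda>\<tau>. D v t \<tau> x) \<and>
        v t x = S_semigroup \<beta> t u0 x + (LINT \<tau>:{0..t}|lborel. D v t \<tau> x))"

lemma ae_solutionD:
  assumes "ae_solution u0 T M v"
  shows "AE \<tau> in lborel. \<tau> \<in> {0<..<T} \<longrightarrow> data_ball s M (v \<tau>)"
    and "t \<in> {0..T} \<Longrightarrow> AE x in lborel. set_integrable lborel {0..t} (\<lambda>\<tau>. D v t \<tau> x) \<and>
        v t x = S_semigroup \<beta> t u0 x + (LINT \<tau>:{0..t}|lborel. D v t \<tau> x)"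
proof -
  show "AE \<tau> in lborel. \<tau> \<in> {0<..<T} \<longrightarrow> data_ball s M (v \<tau>)"
    using assms unfolding ae_solution_def by (rule conjunct1)
  show "AE x in lborel. set_integrable lborel {0..t} (\<lambda>\<tau>. D v t \<tau> x) \<and>
        v t x = S_semigroup \<beta> t u0 x + (LINT \<tau>:{0..t}|lborel. D v t \<tau> x)" if "t \<in> {0..T}"
    using assms that unfolding ae_solution_def by (elim conjE) (rule bspec)
qed

lemma ae_solution_mono:
  assumes v: "ae_solution u0 T M v" and "T' \<le> T" "M \<le> M'"
  shows "ae_solution u0 T' M' v"
  unfolding ae_solution_def
proof (intro conjI ballI)
  show "AE \<tau> in lborel. \<tau> \<in> {0<..<T'} \<longrightarrow> data_ball s M' (v \<tau>)"
    using ae_solutionD(1)[OF v] by eventually_elim (use assms in \<open>auto intro: data_ball_mono\<close>)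
  fix t assume "t \<in> {0..T'}"
  then have "t \<in> {0..T}" using assms(2) by simp
  then show "AE x in lborel. set_integrable lborel {0..t} (\<lambda>\<tau>. D v t \<tau> x) \<and>
        v t x = S_semigroup \<beta> t u0 x + (LINT \<tau>:{0..t}|lborel. D v t \<tau> x)"
    by (rule ae_solutionD(2)[OF v])
qed

lemma pointwise_ae_solution:
  assumes u0: "data_ball s R u0" and sol: "pointwise_solution u0 T M u" and T: "0 \<le> T"
  shows "ae_solution u0 T M u"
proof -
  note u = pointwise_solutionD(1)[OF sol]
  have "T \<in> {0..T}" using T by simp
  from data_ball_nonneg[OF bounded_pathD(2)[OF u this]] have M: "0 \<le> M" .
  from source_bounds[OF M] obtain C where SB: "source_bound M C" .
  show ?thesis
    unfolding ae_solution_def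
  proof (intro conjI ballI AE_I2 impI)
    show "data_ball s M (u \<tau>)" if "\<tau> \<in> {0<..<T}" for \<tau> using that by (intro bounded_pathD(2)[OF u]) auto
    fix t x assume t: "t \<in> {0..T}"
    show "set_integrable lborel {0..t} (\<lambda>\<tau>. D u t \<tau> x)" by (rule picard_step(1)[OF u0 u t SB])
    show "u t x = S_semigroup \<beta> t u0 x + (LINT \<tau>:{0..t}|lborel. D u t \<tau> x)"
      using pointwise_solutionD(2)[OF sol t, of x] by (simp only: picard_def)
  qed
qed

lemma mild_ae_solution:
  assumes v: "mild_solution \<alpha> \<beta> p s u0 T v"
  obtains M where "ae_solution u0 T M v"
proof -
  obtain Z where Z: "AE t in restrict_space lborel {0<..<T}. v t \<in> X_space s \<and> X_norm s (v t) \<le> Z"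
    using v by (auto simp: mild_solution_def Linf_time_def)
  have "AE \<tau> in lborel. \<tau> \<in> {0<..<T} \<longrightarrow> v \<tau> \<in> X_space s \<and> X_norm s (v \<tau>) \<le> Z"
    using Z by (subst (asm) AE_restrict_space_iff) auto
  then have ball: "AE \<tau> in lborel. \<tau> \<in> {0<..<T} \<longrightarrow> data_ball s (max Z (Z powr s)) (v \<tau>)"
  proof eventually_elim
    case (elim \<tau>)
    show ?case
    proof
      assume "\<tau> \<in> {0<..<T}"
      with elim have "v \<tau> \<in> Lp_space s" "v \<tau> \<in> Linf_space" "Lp_norm s (v \<tau>) + Linf_norm (v \<tau>) \<le> Z"
        by (auto simp: X_space_def X_norm_def)
      moreover from this have "Lp_norm s (v \<tau>) \<le> Z" "Linf_norm (v \<tau>) \<le> Z"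
        using Lp_norm_nonneg[of s "v \<tau>"] Linf_norm_nonneg[of "v \<tau>"] by linarith+
      ultimately show "data_ball s (max Z (Z powr s)) (v \<tau>)"
        by (intro data_ball_of_norms s_pos)
    qed
  qed
  show thesis
    by (rule that[of "max Z (Z powr s)"]) (use v ball in \<open>simp add: ae_solution_def mild_solution_def\<close>)
qed

text \<open>Iterating the Duhamel inequality for the difference of two solutions in the sup norm. Only the
  bound \<open>2 * M * (C * \<tau>) ^ k / fact k\<close>, which is explicit in \<open>\<tau>\<close>, is integrated in time, so no joint
  measurability of the solutions is needed.\<close>

lemma ae_solution_unique:
  assumes v: "ae_solution u0 T M v" and w: "ae_solution u0 T M w" and t: "t \<in> {0..T}"
  shows "AE x in lborel. v t x = w t x"
\<comment> \<open>For T = 0 the open interval offers no time at which a bound could be read off; the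
  equation alone settles t = 0.\<close>
proof (cases "T = 0")
  case True
  then have t0: "t = 0" using t by simp
  have z: "(LINT \<tau>:{0..0}|lborel. D u t \<tau> x) = 0" for u x
    unfolding set_lebesgue_integral_def
    by (intro integral_eq_zero_AE eventually_mono[OF AE_lborel_singleton[of 0]]) auto
  show ?thesis
    using ae_solutionD(2)[OF v t] ae_solutionD(2)[OF w t] by eventually_elim (use z t0 in simp)
next
  case False
  then have T: "0 < T" using t by auto
  obtain \<tau>0 where "data_ball s M (v \<tau>0)"
    using AE_interval_witness[OF ae_solutionD(1)[OF v] T] by auto
  then have M: "0 \<le> M" by (rule data_ball_nonneg)
  from source_bounds[OF M] obtain C where SB: "source_bound M C" .
  define B where "B k \<tau> = 2 * M * (C * \<tau>) ^ k / fact k" for k and \<tau> :: real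
  have ball: "AE \<tau> in lborel. \<tau> \<in> {0<..<T} \<longrightarrow> data_ball s M (v \<tau>) \<and> data_ball s M (w \<tau>)"
    using ae_solutionD(1)[OF v] ae_solutionD(1)[OF w] by eventually_elim simp
  have step: "AE x in lborel. \<bar>v t x - w t x\<bar> \<le> B (Suc k) t"
    if IH: "AE \<tau> in lborel. \<tau> \<in> {0<..<T} \<longrightarrow> (AE x in lborel. \<bar>v \<tau> x - w \<tau> x\<bar> \<le> B k \<tau>)" and t: "t \<in> {0..T}" for k t
  proof -
    \<comment> \<open>At a good time the hypothesis bounds the difference for almost every x, while
      the Duhamel integrand turns this into a bound for every x. The exceptional times are therefore
      independent of x.\<close>
    have Ddiff: "AE \<tau> in lborel. \<forall>x. indicator {0..t} \<tau> * \<bar>D v t \<tau> x - D w t \<tau> x\<bar> \<le> \<tau> ^ k * indicator {0..t} \<tau> * (2 * M * C * C ^ k / fact k)"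
      using IH ball AE_lborel_singleton[of 0] AE_lborel_singleton[of T]
    proof eventually_elim
      case (elim \<tau>)
      show ?case
      proof
        fix x
        show "indicator {0..t} \<tau> * \<bar>D v t \<tau> x - D w t \<tau> x\<bar> \<le> \<tau> ^ k * indicator {0..t} \<tau> * (2 * M * C * C ^ k / fact k)"
        proof (cases "\<tau> \<in> {0..t}")
          case True
          then have \<tau>: "\<tau> \<in> {0<..<T}" "\<tau> \<le> t" using elim t by auto
          have "\<bar>D v t \<tau> x - D w t \<tau> x\<bar> \<le> C * B k \<tau>"
            using elim \<tau>(1)
            by (intro duhamel_diff_bound[where u = v and v = w and \<tau> = \<tau>, OF _ _ \<tau>(2) SB]) auto
          then show ?thesis using True by (simp add: B_def power_mult_distrib mult_ac)
        qed simp
      qed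
    qed
    have ik: "integrable lborel (\<lambda>\<tau>. \<tau> ^ k * indicator {0..t} \<tau>)"
    proof -
      have "continuous_on {0..t} (\<lambda>\<tau>. \<tau> ^ k)" by (intro continuous_intros)
      from borel_integrable_atLeastAtMost'[OF this] show ?thesis
        by (simp add: set_integrable_def mult.commute)
    qed
    have vk: "(\<integral>\<tau>. \<tau> ^ k * indicator {0..t} \<tau> \<partial>lborel) = t ^ Suc k / real (Suc k)"
      using t integral_power[of 0 t k] by simp
    show ?thesis
      using ae_solutionD(2)[OF v t] ae_solutionD(2)[OF w t]
    proof eventually_elim
      case (elim x)
      let ?d = "\<lambda>\<tau>. indicator {0..t} \<tau> *\<^sub>R (D v t \<tau> x - D w t \<tau> x)"
      have int: "integrable lborel ?d"
        using set_integral_diff(1)[of lborel "{0..t}" "\<lambda>\<tau>. D v t \<tau> x" "\<lambda>\<tau>. D w t \<tau> x"] elim by (simp add: set_integrable_def)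
      have "v t x - w t x = (LINT \<tau>:{0..t}|lborel. D v t \<tau> x - D w t \<tau> x)"
        using elim by (subst set_integral_diff(2)) auto
      then have "\<bar>v t x - w t x\<bar> \<le> (\<integral>\<tau>. \<bar>?d \<tau>\<bar> \<partial>lborel)"
        unfolding set_lebesgue_integral_def using integral_abs_bound[of lborel ?d] by simp
      also have "\<dots> \<le> (\<integral>\<tau>. \<tau> ^ k * indicator {0..t} \<tau> * (2 * M * C * C ^ k / fact k) \<partial>lborel)"
        using Ddiff by (intro integral_mono_AE integrable_abs[OF int] integrable_mult_left[OF ik])
          (auto elim!: eventually_mono simp: abs_mult)
      also have "\<dots> = t ^ Suc k / real (Suc k) * (2 * M * C * C ^ k / fact k)"
        by (simp only: integral_mult_left_zero vk)
      also have "\<dots> = B (Suc k) t"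
        by (simp add: B_def power_mult_distrib mult_ac)
      finally show ?case .
    qed
  qed
  have all: "AE \<tau> in lborel. \<tau> \<in> {0<..<T} \<longrightarrow> (AE x in lborel. \<bar>v \<tau> x - w \<tau> x\<bar> \<le> B k \<tau>)" for k
  proof (induction k)
    case 0
    show ?case
      using ball
    proof eventually_elim
      case (elim \<tau>)
      show ?case
      proof
        assume "\<tau> \<in> {0<..<T}"
        with elim have "data_ball s M (v \<tau>)" "data_ball s M (w \<tau>)" by auto
        from data_ballD(2)[OF this(1)] data_ballD(2)[OF this(2)]
        show "AE x in lborel. \<bar>v \<tau> x - w \<tau> x\<bar> \<le> B 0 \<tau>"
          by eventually_elim (simp add: B_def)
      qed
    qed
  next
    case (Suc k)
    show ?case by (intro AE_I2 impI step[OF Suc]) auto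
  qed
  have "AE x in lborel. \<forall>k. \<bar>v t x - w t x\<bar> \<le> B (Suc k) t"
    using step[OF all t] by (simp add: AE_all_countable)
  then show ?thesis
  proof eventually_elim
    case (elim x)
    have "(\<lambda>k. (C * t) ^ k / fact k) \<longlonglongrightarrow> 0"
      using summable_LIMSEQ_zero[OF summable_exp_generic[of "C * t"]] by (simp add: divide_inverse mult.commute)
    then have "(\<lambda>k. 2 * M * ((C * t) ^ k / fact k)) \<longlonglongrightarrow> 2 * M * 0" by (intro tendsto_intros)
    then have "(\<lambda>k. B k t) \<longlonglongrightarrow> 0" by (simp add: B_def)
    then have "(\<lambda>k. B (Suc k) t) \<longlonglongrightarrow> 0" by (rule LIMSEQ_Suc)
    then have "\<bar>v t x - w t x\<bar> \<le> 0" by (rule LIMSEQ_le_const) (use elim in auto)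
    then show ?case by simp
  qed
qed

lemma ae_solution_unique':
  assumes v: "ae_solution u0 T M v" and w: "ae_solution u0 T' M' w" and t: "0 \<le> t" "t \<le> T" "t \<le> T'"
  shows "AE x in lborel. v t x = w t x"
  by (rule ae_solution_unique[OF ae_solution_mono[OF v t(2), of "max M M'"] ae_solution_mono[OF w t(3), of "max M M'"]])
     (use t in auto)

lemma pointwise_solution_mono:
  assumes sol: "pointwise_solution u0 T M u" and "T' \<le> T"
  shows "pointwise_solution u0 T' M u"
  using assms unfolding pointwise_solution_def bounded_path_def by auto

text \<open>Almost-everywhere equality at each time gives equal sources, hence equal Duhamel
  integrands at every point; the equation, valid everywhere, upgrades this to equality of
  functions.\<close>

lemma pointwise_solution_unique:
  assumes u0: "data_ball s R u0" and u: "pointwise_solution u0 T M u" and v: "pointwise_solution u0 T' M' v"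
    and t: "0 \<le> t" "t \<le> T" "t \<le> T'"
  shows "u t = v t"
proof
  fix x
  have T: "0 \<le> T" "0 \<le> T'" using t by auto
  have "picard u0 u t x = picard u0 v t x"
  proof (rule picard_cong)
    fix \<tau> assume \<tau>: "\<tau> \<in> {0..t}"
    then have \<tau>': "0 \<le> \<tau>" "\<tau> \<le> T" "\<tau> \<le> T'" "\<tau> \<in> {0..T}" "\<tau> \<in> {0..T'}" using t by auto
    have "AE y in lborel. u \<tau> y = v \<tau> y"
      by (rule ae_solution_unique'[OF pointwise_ae_solution[OF u0 u T(1)] pointwise_ae_solution[OF u0 v T(2)] \<tau>'(1-3)])
    then have "source (u \<tau>) = source (v \<tau>)"
      by (rule source_cong_AE)
         (rule data_ballD(1)[OF bounded_pathD(2)[OF pointwise_solutionD(1)[OF u] \<tau>'(4)]],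
          rule data_ballD(1)[OF bounded_pathD(2)[OF pointwise_solutionD(1)[OF v] \<tau>'(5)]])
    then show "D u t \<tau> x = D v t \<tau> x" by (simp add: duhamel_eq)
  qed
  then show "u t x = v t x"
    using pointwise_solutionD(2)[OF u, of t x] pointwise_solutionD(2)[OF v, of t x] t by simp
qed

text \<open>Beyond T the equation for w starts from u T. The semigroup rewrites the evolution of u T
  as a Duhamel formula over {0..T} with terminal time t, and a shift of the time variable places the
  sources of w on {T..t}.\<close>

lemma continuation:
  assumes u0: "data_ball s R u0" and u: "pointwise_solution u0 T M u" and w: "pointwise_solution (u T) \<delta> M' w"
    and T: "0 \<le> T" and \<delta>: "0 \<le> \<delta>"
  shows "pointwise_solution u0 (T + \<delta>) (max M M') (\<lambda>t. if t \<le> T then u t else w (t - T))"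
proof -
  let ?v = "\<lambda>t. if t \<le> T then u t else w (t - T)"
  note bu = pointwise_solutionD(1)[OF u] and bw = pointwise_solutionD(1)[OF w]
  have um [measurable]: "case_prod u \<in> borel_measurable (borel \<Otimes>\<^sub>M borel)" by (rule bounded_pathD[OF bu])
  have wm [measurable]: "case_prod w \<in> borel_measurable (borel \<Otimes>\<^sub>M borel)" by (rule bounded_pathD[OF bw])
  have path: "bounded_path (T + \<delta>) (max M M') ?v"
    unfolding bounded_path_def
  proof (intro conjI ballI)
    have "case_prod ?v = (\<lambda>(t, x). if t \<le> T then u t x else w (t - T) x)" by (auto simp: fun_eq_iff)
    moreover have "(\<lambda>(t, x). if t \<le> T then u t x else w (t - T) x) \<in> borel_measurable (borel \<Otimes>\<^sub>M borel)" by measurable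
    ultimately show "case_prod ?v \<in> borel_measurable (borel \<Otimes>\<^sub>M borel)" by simp
    fix t assume t: "t \<in> {0..T + \<delta>}"
    show "data_ball s (max M M') (?v t)"
    proof (cases "t \<le> T")
      case True
      then have "t \<in> {0..T}" using t by simp
      from data_ball_mono[OF bounded_pathD(2)[OF bu this], of "max M M'"] show ?thesis using True by simp
    next
      case False
      then have "t - T \<in> {0..\<delta>}" using t by simp
      from data_ball_mono[OF bounded_pathD(2)[OF bw this], of "max M M'"] show ?thesis using False by simp
    qed
  qed
  have TT: "T \<in> {0..T}" using T by simp
  have w0: "w 0 = u T" by (rule solution_at_0[OF w \<delta>])
  have "?v t x = picard u0 ?v t x" if t: "t \<in> {0..T + \<delta>}" for t x
  proof (cases "t \<le> T")
    case True
    then have "t \<in> {0..T}" using t by simp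
    have "picard u0 u t x = picard u0 ?v t x"
      by (rule picard_cong) (use True in \<open>auto simp: duhamel_eq\<close>)
    then show ?thesis using pointwise_solutionD(2)[OF u \<open>t \<in> {0..T}\<close>, of x] True by simp
  next
    case False
    then have h: "t - T \<in> {0..\<delta>}" "0 \<le> t - T" "T \<le> t" using t by auto
    have uT: "u T = picard u0 u T" using pointwise_solutionD(2)[OF u TT] by (intro ext)
    from data_ball_nonneg[OF bounded_pathD(2)[OF path t]] have MM: "0 \<le> max M M'" .
    from source_bounds[OF MM] obtain C where SB: "source_bound (max M M') C" .
    have int: "set_integrable lborel {0..t} (\<lambda>\<tau>. D ?v t \<tau> x)" by (rule picard_step(1)[OF u0 path t SB])
    have "w (t - T) x = S_semigroup \<beta> (t - T) (u T) x + (LINT \<tau>:{0..t - T}|lborel. D w (t - T) \<tau> x)"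
      using pointwise_solutionD(2)[OF w h(1), of x] by (simp only: picard_def)
    also have "S_semigroup \<beta> (t - T) (u T) x = S_semigroup \<beta> t u0 x + (LINT \<tau>:{0..T}|lborel. D u t \<tau> x)"
      using semigroup_picard[OF u0 bu TT h(2), of x] uT by simp
    also have "(LINT \<tau>:{0..T}|lborel. D u t \<tau> x) = (LINT \<tau>:{0..T}|lborel. D ?v t \<tau> x)"
      by (rule set_lebesgue_integral_cong) (auto simp: duhamel_eq)
    also have "(LINT \<tau>:{0..t - T}|lborel. D w (t - T) \<tau> x) = (LINT \<tau>:{T..t}|lborel. D ?v t \<tau> x)"
    proof -
      have "(LINT \<tau>:{T..t}|lborel. D ?v t \<tau> x) = (\<integral>\<tau>. indicator {T..t} (T + 1 * \<tau>) *\<^sub>R D ?v t (T + 1 * \<tau>) x \<partial>lborel)"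
        unfolding set_lebesgue_integral_def
        by (subst lborel_integral_real_affine[where c = 1 and t = T]) auto
      also have "\<dots> = (LINT \<tau>:{0..t - T}|lborel. D w (t - T) \<tau> x)"
        unfolding set_lebesgue_integral_def
      proof (intro Bochner_Integration.integral_cong refl)
        fix \<tau>
        \<comment> \<open>At \<tau> = 0 the glued path takes its value from u, which matches because
          w starts at u T.\<close>
        have "D ?v t (T + 1 * \<tau>) x = D w (t - T) \<tau> x" if "0 \<le> \<tau>"
          using that w0 by (auto simp: duhamel_eq diff_diff_eq)
        then show "indicator {T..t} (T + 1 * \<tau>) *\<^sub>R D ?v t (T + 1 * \<tau>) x = indicator {0..t - T} \<tau> *\<^sub>R D w (t - T) \<tau> x"
          by (auto split: split_indicator)
      qed
      finally show ?thesis ..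
    qed
    also have "S_semigroup \<beta> t u0 x + (LINT \<tau>:{0..T}|lborel. D ?v t \<tau> x) + (LINT \<tau>:{T..t}|lborel. D ?v t \<tau> x)
        = S_semigroup \<beta> t u0 x + (LINT \<tau>:{0..T} \<union> {T..t}|lborel. D ?v t \<tau> x)"
    proof -
      have "(LINT \<tau>:{0..T} \<union> {T..t}|lborel. D ?v t \<tau> x) = (LINT \<tau>:{0..T}|lborel. D ?v t \<tau> x) + (LINT \<tau>:{T..t}|lborel. D ?v t \<tau> x)"
      proof (rule set_integral_Un_AE)
        show "AE \<tau> in lborel. \<not> (\<tau> \<in> {0..T} \<and> \<tau> \<in> {T..t})"
          using AE_lborel_singleton[of T] by eventually_elim auto
        show "set_integrable lborel {0..T} (\<lambda>\<tau>. D ?v t \<tau> x)"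
          by (rule set_integrable_subset[OF int]) (use h in auto)
        show "set_integrable lborel {T..t} (\<lambda>\<tau>. D ?v t \<tau> x)"
          by (rule set_integrable_subset[OF int]) (use T in auto)
      qed auto
      then show ?thesis by simp
    qed
    also have "{0..T} \<union> {T..t} = {0..t}" using T h(3) by auto
    finally show ?thesis using False by (simp only: picard_def if_False)
  qed
  with path show ?thesis unfolding pointwise_solution_def by blast
qed

lemma data_ball_cong_AE:
  assumes v: "data_ball s M v" and eq: "AE x in lborel. u x = v x" and u: "u \<in> borel_measurable borel"
  shows "data_ball s M u"
  unfolding data_ball_def
proof (intro conjI u)
  show "AE x in lborel. \<bar>u x\<bar> \<le> M" using data_ballD(2)[OF v] eq by eventually_elim simp
  have "Lp_mass s u = Lp_mass s v"
    unfolding Lp_mass_def using eq by (intro nn_integral_cong_AE) (auto elim: eventually_mono)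
  then show "Lp_mass s u \<le> ennreal M" using data_ballD(3)[OF v] by simp
qed

text \<open>\<open>T_max\<close> is a supremum over arbitrary regular solutions, so each of their
  intervals must be reached by a constructed one. The constructed solution is restarted at times
  where v is known to be bounded; both agree there, so the restart length is the same at every
  stage.\<close>

lemma pointwise_of_regular:
  assumes u0: "data_ball s R u0" and T: "0 < T" and v: "regular_mild_solution \<alpha> \<beta> p s u0 T v"
  shows "\<exists>u M. pointwise_solution u0 T M u"
proof -
  have "mild_solution \<alpha> \<beta> p s u0 T v" using v by (simp add: regular_mild_solution_def)
  from mild_ae_solution[OF this] obtain Mv where av: "ae_solution u0 T Mv v" .
  \<comment> \<open>One size for the initial datum and for the values of v at good times, hence one
    \<delta> for the first step and all restarts.\<close>
  define R1 where "R1 = max Mv R"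
  have R1: "0 \<le> R1" "data_ball s R1 u0" using data_ball_nonneg[OF u0] data_ball_mono[OF u0] by (auto simp: R1_def)
  from local_existence[OF R1(1)] obtain \<delta> M1 where \<delta>: "0 < \<delta>"
    and ex: "\<And>u0. data_ball s R1 u0 \<Longrightarrow> \<exists>u. pointwise_solution u0 \<delta> M1 u" by blast
  \<comment> \<open>Each restart takes place less than \<delta> / 2 before the end reached so far
    and extends by \<delta>, a net gain of more than \<delta> / 2.\<close>
  have "\<exists>T' u M. 0 < T' \<and> min T (real (Suc k) * \<delta> / 2) \<le> T' \<and> pointwise_solution u0 T' M u" for k
  proof (induction k)
    case 0
    from ex[OF R1(2)] obtain u where "pointwise_solution u0 \<delta> M1 u" by blast
    with \<delta> show ?case by (intro exI[of _ \<delta>]) auto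
  next
    case (Suc k)
    then obtain T' u M where T': "0 < T'" "min T (real (Suc k) * \<delta> / 2) \<le> T'" and u: "pointwise_solution u0 T' M u" by blast
    show ?case
    proof (cases "T \<le> T'")
      case True
      then show ?thesis using T' u by (intro exI[of _ T'] exI[of _ u] exI[of _ M]) auto
    next
      case False
      have "max 0 (T' - \<delta> / 2) < T'" using T' \<delta> by simp
      from AE_interval_witness[OF ae_solutionD(1)[OF av] this] obtain \<tau>
        where \<tau>: "\<tau> \<in> {max 0 (T' - \<delta> / 2)<..<T'}" "\<tau> \<in> {0<..<T} \<longrightarrow> data_ball s Mv (v \<tau>)" by blast
      then have \<tau>': "0 < \<tau>" "T' - \<delta> / 2 < \<tau>" "\<tau> < T'" "\<tau> < T" using False by auto
      then have vb: "data_ball s R1 (v \<tau>)" using \<tau>(2) by (auto simp: R1_def intro: data_ball_mono)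
      have "\<tau> \<in> {0..T'}" using \<tau>' by simp
      then have um: "u \<tau> \<in> borel_measurable borel"
        by (intro data_ballD(1)[OF bounded_pathD(2)[OF pointwise_solutionD(1)[OF u]]])
      have "AE x in lborel. u \<tau> x = v \<tau> x"
        by (rule ae_solution_unique'[OF pointwise_ae_solution[OF u0 u less_imp_le[OF T'(1)]] av]) (use \<tau>' in auto)
      from ex[OF data_ball_cong_AE[OF vb this um]] obtain w where w: "pointwise_solution (u \<tau>) \<delta> M1 w" by blast
      have "pointwise_solution u0 (\<tau> + \<delta>) (max M M1) (\<lambda>t. if t \<le> \<tau> then u t else w (t - \<tau>))"
        by (rule continuation[OF u0 pointwise_solution_mono[OF u] w]) (use \<tau>' \<delta> in auto)
      moreover have "min T (real (Suc (Suc k)) * \<delta> / 2) \<le> \<tau> + \<delta>"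
        using T'(2) False \<tau>' by (auto simp: min_def field_simps split: if_splits)
      ultimately show ?thesis using \<tau>' \<delta> by (intro exI[of _ "\<tau> + \<delta>"]) auto
    qed
  qed
  moreover obtain k where "2 * T / \<delta> < real k" using reals_Archimedean2 by blast
  then have "T \<le> real (Suc k) * \<delta> / 2" using \<delta> by (simp add: field_simps)
  ultimately obtain T' u M where "T \<le> T'" "pointwise_solution u0 T' M u"
    by (metis min.absorb1)
  then show ?thesis using pointwise_solution_mono by blast
qed

text \<open>The source is nonnegative whatever the sign of u, so the Duhamel equation yields the
  sign directly, without a comparison argument.\<close>

lemma pointwise_solution_nonneg:
  assumes sol: "pointwise_solution u0 T M u" and t: "t \<in> {0..T}" and u0: "AE x in lborel. 0 \<le> u0 x"
  shows "AE x in lborel. 0 \<le> u t x"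
proof -
  have "AE x in lborel. 0 \<le> S_semigroup \<beta> t u0 x"
    using u0 S_semigroup_nonneg[OF \<beta>, of t u0] t by (cases "t = 0") (auto simp: S_semigroup_def)
  then show ?thesis
  proof eventually_elim
    case (elim x)
    have "0 \<le> D u t \<tau> x" if "\<tau> \<in> {0..t}" for \<tau>
      unfolding duhamel_eq using that source_nonneg S_semigroup_nonneg[OF \<beta>, of "t - \<tau>" "source (u \<tau>)" x]
      by (cases "t = \<tau>") (auto simp: S_semigroup_def)
    then have "0 \<le> (LINT \<tau>:{0..t}|lborel. D u t \<tau> x)"
      unfolding set_lebesgue_integral_def by (intro Bochner_Integration.integral_nonneg) (auto split: split_indicator)
    then show ?case using elim pointwise_solutionD(2)[OF sol t, of x] by (simp add: picard_def)
  qed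
qed

section \<open>Well-posedness, the maximal solution and the blow-up alternative\<close>

lemma regular_is_the_solution:
  fixes u :: "real \<Rightarrow> real^'n \<Rightarrow> real"
  assumes u: "regular_mild_solution \<alpha> \<beta> p s u0 T u"
  shows "is_the_mild_solution \<alpha> \<beta> p s u0 T u"
  unfolding is_the_mild_solution_def
proof (intro conjI u allI impI ballI)
  fix v t assume v: "regular_mild_solution \<alpha> \<beta> p s u0 T v" and t: "t \<in> {0..T}"
  have "mild_solution \<alpha> \<beta> p s u0 T u" "mild_solution \<alpha> \<beta> p s u0 T v"
    using u v by (simp_all add: regular_mild_solution_def)
  then obtain Mu Mv where "ae_solution u0 T Mu u" "ae_solution u0 T Mv v"
    using mild_ae_solution by metis
  then show "AE x in lborel. v t x = u t x"
    using ae_solution_unique'[of u0 T Mv v T Mu u t] t by auto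
qed

theorem well_posedness:
  fixes u0 :: "real^'n \<Rightarrow> real"
  assumes "u0 \<in> Lp_space s \<inter> Linf_space"
  shows "(\<exists>T>0. \<exists>u. is_the_mild_solution \<alpha> \<beta> p s u0 T u \<and>
            ((AE x in lborel. 0 \<le> u0 x) \<longrightarrow> (\<forall>t\<in>{0..T}. AE x in lborel. 0 \<le> u t x))) \<and>
         (\<exists>u. maximal_mild_solution \<alpha> \<beta> p s u0 u \<and>
            (T_max \<alpha> \<beta> p s u0 = \<infinity> \<or>
             (\<exists>T. T_max \<alpha> \<beta> p s u0 = ereal T \<and>
                filterlim (\<lambda>t. Linf_norm (u t) + Lp_norm s (u t)) at_top (at_left T))))"
proof -
  define Z0 where "Z0 = max (Lp_norm s u0) (Linf_norm u0)"
  define R where "R = max Z0 (Z0 powr s)"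
  have u0: "data_ball s R u0"
    unfolding R_def using assms by (intro data_ball_of_norms s_pos) (auto simp: Z0_def)
  from local_existence[OF data_ball_nonneg[OF u0]] obtain \<delta>0 M0 where \<delta>0: "0 < \<delta>0"
    and ex0: "\<And>u0. data_ball s R u0 \<Longrightarrow> \<exists>u. pointwise_solution u0 \<delta>0 M0 u" by blast
  from ex0[OF u0] obtain w0 where w0: "pointwise_solution u0 \<delta>0 M0 w0" by blast
  have local: "\<exists>T>0. \<exists>u. is_the_mild_solution \<alpha> \<beta> p s u0 T u \<and>
            ((AE x in lborel. 0 \<le> u0 x) \<longrightarrow> (\<forall>t\<in>{0..T}. AE x in lborel. 0 \<le> u t x))"
    using \<delta>0 regular_is_the_solution[OF solution_regular[OF u0 w0 \<delta>0]] pointwise_solution_nonneg[OF w0] by blast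
  \<comment> \<open>The existence times of constructed solutions; they coincide with those in the
    definition of \<open>T_max\<close>.\<close>
  define E where "E = {T. 0 < T \<and> (\<exists>u M. pointwise_solution u0 T M u)}"
  have E_eq: "{ereal T | T. T > 0 \<and> (\<exists>u. regular_mild_solution \<alpha> \<beta> p s u0 T u)} = ereal ` E"
    using pointwise_of_regular[OF u0] solution_regular[OF u0] unfolding E_def by blast
  have Tmax: "T_max \<alpha> \<beta> p s u0 = Sup (ereal ` E)" unfolding T_max_def E_eq ..
  have E_down: "T' \<in> E" if "T \<in> E" "0 < T'" "T' \<le> T" for T T'
    using that pointwise_solution_mono unfolding E_def by blast
  have E_less: "T \<in> E" if "0 < T" "ereal T < T_max \<alpha> \<beta> p s u0" for T
    using that E_down unfolding Tmax less_Sup_iff by auto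
  have E_le: "ereal T \<le> T_max \<alpha> \<beta> p s u0" if "T \<in> E" for T
    unfolding Tmax using that by (intro Sup_upper) auto
  have \<delta>0_E: "\<delta>0 \<in> E" using w0 \<delta>0 unfolding E_def by blast
  define U where "U T = (SOME u. \<exists>M. pointwise_solution u0 T M u)" for T
  have U: "\<exists>M. pointwise_solution u0 T M (U T)" if "T \<in> E" for T
    unfolding U_def using that by (intro someI_ex[of "\<lambda>u. \<exists>M. pointwise_solution u0 T M u"]) (auto simp: E_def)
  \<comment> \<open>At time t any chosen solution whose interval contains t may be used; uniqueness
    makes the value independent of the choice.\<close>
  define u where "u t = U (SOME T. T \<in> E \<and> t \<le> T) t" for t
  have u_eq: "u t = U T t" if T: "T \<in> E" and t: "t \<in> {0..T}" for t T
  proof -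
    define S where "S = (SOME T. T \<in> E \<and> t \<le> T)"
    have S: "S \<in> E" "t \<le> S"
      using someI_ex[of "\<lambda>T. T \<in> E \<and> t \<le> T"] T t unfolding S_def by auto
    obtain M M' where "pointwise_solution u0 S M (U S)" "pointwise_solution u0 T M' (U T)"
      using U[OF S(1)] U[OF T] by blast
    from pointwise_solution_unique[OF u0 this] have "U S t = U T t" using S t by simp
    then show ?thesis by (simp add: u_def S_def)
  qed
  have u_regular: "regular_mild_solution \<alpha> \<beta> p s u0 T u" if T: "T \<in> E" for T
  proof -
    have T0: "0 < T" using T by (simp add: E_def)
    obtain M where "pointwise_solution u0 T M (U T)" using U[OF T] by blast
    from solution_regular[OF u0 this T0] show ?thesis
      by (rule regular_cong[rotated 2]) (use T0 u_eq[OF T] in auto)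
  qed
  have maximal: "maximal_mild_solution \<alpha> \<beta> p s u0 u"
    unfolding maximal_mild_solution_def using E_less u_regular regular_is_the_solution by blast
  have blow_up: "filterlim (\<lambda>t. Linf_norm (u t) + Lp_norm s (u t)) at_top (at_left T)"
    if Tm: "T_max \<alpha> \<beta> p s u0 = ereal T" for T
    unfolding filterlim_at_top
  proof
    fix Z :: real
    \<comment> \<open>If both norms at a time t < T were at most Z, then u t would lie in the ball
      of size R1 and could be continued by a length \<delta> depending on Z alone. For T - t <
      \<delta> this passes T. As every such t is excluded, the norms tend to infinity along the
      whole left neighbourhood and not merely along a sequence.\<close>
    define R1 where "R1 = max Z (Z powr s)"
    have R1: "0 \<le> R1" by (simp add: R1_def le_max_iff_disj)
    from local_existence[OF R1] obtain \<delta> M1 where \<delta>: "0 < \<delta>"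
      and ex: "\<And>u0. data_ball s R1 u0 \<Longrightarrow> \<exists>u. pointwise_solution u0 \<delta> M1 u" by blast
    have T0: "0 < T"
      using E_le[OF \<delta>0_E] \<delta>0 unfolding Tm by simp
    have "Z \<le> Linf_norm (u t) + Lp_norm s (u t)" if t: "max 0 (T - \<delta>) < t" "t < T" for t
    proof (rule ccontr)
      assume "\<not> ?thesis"
      then have small: "Lp_norm s (u t) \<le> Z" "Linf_norm (u t) \<le> Z"
        using Lp_norm_nonneg[of s "u t"] Linf_norm_nonneg[of "u t"] by linarith+
      have tE: "t \<in> E" using t Tm by (intro E_less) auto
      then obtain M where sol: "pointwise_solution u0 t M (U t)" using U by blast
      have tt: "t \<in> {0..t}" using t by simp
      note b = data_ball_norms[OF bounded_pathD(2)[OF pointwise_solutionD(1)[OF sol] tt] s_pos]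
      have "data_ball s R1 (U t t)"
        unfolding R1_def using small u_eq[OF tE tt] by (intro data_ball_of_norms b s_pos) auto
      from ex[OF this] obtain w where "pointwise_solution (U t t) \<delta> M1 w" by blast
      from continuation[OF u0 sol this] have "t + \<delta> \<in> E" unfolding E_def using t \<delta> by auto
      from E_le[OF this] have "t + \<delta> \<le> T" unfolding Tm by simp
      then show False using t by simp
    qed
    then show "eventually (\<lambda>t. Z \<le> Linf_norm (u t) + Lp_norm s (u t)) (at_left T)"
      unfolding eventually_at_left_field using T0 \<delta>
      by (intro exI[of _ "max 0 (T - \<delta>)"]) auto
  qed
  have "T_max \<alpha> \<beta> p s u0 \<noteq> - \<infinity>"
    using E_le[OF \<delta>0_E] by auto
  then have "T_max \<alpha> \<beta> p s u0 = \<infinity> \<or> (\<exists>T. T_max \<alpha> \<beta> p s u0 = ereal T)"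
    by (cases "T_max \<alpha> \<beta> p s u0") auto
  with local maximal blow_up show ?thesis by blast
qed

end

theorem theorem1p2:
  fixes \<alpha> \<beta> p s :: real and u0 :: "real^'n \<Rightarrow> real"
  assumes "0 < \<beta>" "\<beta> \<le> 2"
    and "0 < \<alpha>" "\<alpha> < real CARD('n)"
    and "p > real CARD('n) / (real CARD('n) - \<alpha>)"
    and "real CARD('n) / (real CARD('n) - \<alpha>) < s" "s < real CARD('n) * (p - 1) / \<alpha>"
    and "u0 \<in> Lp_space s \<inter> Linf_space"
  shows "(\<exists>T>0. \<exists>u. is_the_mild_solution \<alpha> \<beta> p s u0 T u \<and>
            ((AE x in lborel. 0 \<le> u0 x) \<longrightarrow> (\<forall>t\<in>{0..T}. AE x in lborel. 0 \<le> u t x))) \<and>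
         (\<exists>u. maximal_mild_solution \<alpha> \<beta> p s u0 u \<and>
            (T_max \<alpha> \<beta> p s u0 = \<infinity> \<or>
             (\<exists>T. T_max \<alpha> \<beta> p s u0 = ereal T \<and>
                filterlim (\<lambda>t. Linf_norm (u t) + Lp_norm s (u t)) at_top (at_left T))))"
proof -
  interpret fractional_problem \<alpha> \<beta> p s "TYPE('n)"
    using assms by unfold_locales
  show ?thesis by (rule well_posedness[OF assms(8)])
qed

end
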